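(* Let $f\in\mathcal{E}$, let $J_1,\dots,J_k$ be the minimal components of $f$, let $A=\mathrm{Per}(f)\setminus\mathrm{Fix}(f)$ and $B=\mathrm{Fix}(f)$. Set $C_i=C(f)\cap\mathcal{E}_{J_i}$ and $C_A=C(f)\cap\mathcal{E}_A$. Then $$C(f)\cong\Big(\Big(\prod_{i=1}^k C_i\Big)\rtimes F\Big)\times C_A\times\mathcal{E}_B,$$ where $F$ is (a finite group isomorphic to) a direct product of symmetric groups, each $C_i$ is either an infinite virtually cyclic group or a subgroup of $(\mathbb{R}/\mathbb{Z})^m\rtimes\Sigma_m$ (for some $m$, with $\Sigma_m$ permuting coordinates) containing the diagonal of $(\mathbb{R}/\mathbb{Z})^m$, and $C_A$ is a direct product of finitely many groups of the form $G_m=P_m\rtimes\mathcal{E}^m_\Delta$. The factors $C_A$ and $\mathcal{E}_B$ are trivial if $\mathrm{Per}(f)=\emptyset$, and the factors $C_i$ and $F$ are trivial if $f$ has finite order.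
   Context: Identify $\mathbb{T}^1=\mathbb{R}/\mathbb{Z}$ with $[0,1)$. An interval exchange transformation is a bijection of $\mathbb{T}^1$ that is a translation on each piece of some partition of $[0,1)$ into finitely many half-open intervals $[a,b)$; $\mathcal{E}$ is the group of these, and $C(g)=\{h\in\mathcal{E}:gh=hg\}$. The support of $g$ is the complement of $\mathrm{Fix}(g)$. For a finite union $X$ of half-open intervals, $\mathcal{E}_X$ is the subgroup of interval exchanges with support contained in $X$. A minimal component of $f$ is an $f$-invariant finite union $J$ of half-open intervals such that the $f$-orbit of every $x\in J$ is dense in $J$; the set of non-periodic points of any $f\in\mathcal{E}$ is a finite union of minimal components. For $m\ge2$, with $I_i=[\frac{i-1}{m},\frac im)$ and $r_{1/m}(x)=x+1/m$: $\mathcal{E}^m_\Delta=\{g\in C(r_{1/m}): g(I_i)=I_i\ \forall i\}$, $P_m=\{g\in C(r_{1/m}):\forall x\ \exists k\in\mathbb{Z},\ g(x)=x+k/m \bmod 1\}$, and $G_m=P_m\rtimes\mathcal{E}^m_\Delta=C(r_{1/m})$; $G_1=\mathcal{E}$. *)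

theory Defs
  imports "HOL-Analysis.Analysis" "HOL-Algebra.Algebra"
begin

definition is_iet :: "(real \<Rightarrow> real) \<Rightarrow> bool" where
  "is_iet f \<longleftrightarrow>
     (\<forall>x. x \<notin> {0..<1} \<longrightarrow> f x = x) \<and>
     bij_betw f {0..<1} {0..<1} \<and>
     (\<exists>(a::nat \<Rightarrow> real) n. a 0 = 0 \<and> a n = 1 \<and> (\<forall>i<n. a i < a (Suc i)) \<and>
        (\<forall>i<n. \<exists>c. \<forall>x \<in> {a i..<a (Suc i)}. f x = frac (x + c)))"

definition IET :: "(real \<Rightarrow> real) monoid" where
  "IET = \<lparr>carrier = {f. is_iet f}, mult = (\<circ>), one = id\<rparr>"

definition centralizer :: "(real \<Rightarrow> real) \<Rightarrow> (real \<Rightarrow> real) set" where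
  "centralizer g = {h \<in> carrier IET. g \<circ> h = h \<circ> g}"

definition subgrp :: "(real \<Rightarrow> real) set \<Rightarrow> (real \<Rightarrow> real) monoid" where
  "subgrp S = IET\<lparr>carrier := S\<rparr>"

definition FixP :: "(real \<Rightarrow> real) \<Rightarrow> real set" where
  "FixP g = {x \<in> {0..<1}. g x = x}"

definition support :: "(real \<Rightarrow> real) \<Rightarrow> real set" where
  "support g = {0..<1} - FixP g"

definition E_supp :: "real set \<Rightarrow> (real \<Rightarrow> real) set" where
  "E_supp S = {h \<in> carrier IET. support h \<subseteq> S}"

definition PerP :: "(real \<Rightarrow> real) \<Rightarrow> real set" where
  "PerP f = {x \<in> {0..<1}. \<exists>n>0. (f ^^ n) x = x}"

text \<open>Full full_orbit of x under the bijection f (f is a bijection of the real line).\<close>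
definition full_orbit :: "(real \<Rightarrow> real) \<Rightarrow> real \<Rightarrow> real set" where
  "full_orbit f x = {(f ^^ n) x | n. True} \<union> {(inv_into UNIV f ^^ n) x | n. True}"

definition min_comp :: "(real \<Rightarrow> real) \<Rightarrow> real set \<Rightarrow> bool" where
  "min_comp f J \<longleftrightarrow>
     J \<noteq> {} \<and> J \<subseteq> {0..<1} \<and>
     (\<exists>(a::nat \<Rightarrow> real) b n. J = (\<Union>i<n. {a i..<b i})) \<and>
     f ` J = J \<and>
     (\<forall>x\<in>J. J \<subseteq> closure (full_orbit f x))"

definition min_comps :: "(real \<Rightarrow> real) \<Rightarrow> real set set" where
  "min_comps f = {J. min_comp f J}"

text \<open>Rotation r_(1/m) and G_m = C(r_(1/m)) (for m = 1 this is the whole group E).\<close>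
definition rot :: "real \<Rightarrow> real \<Rightarrow> real" where
  "rot t x = (if x \<in> {0..<1} then frac (x + t) else x)"

definition G_grp :: "nat \<Rightarrow> (real \<Rightarrow> real) monoid" where
  "G_grp m = subgrp (centralizer (rot (1 / real m)))"

definition semidirect ::
  "('n, 'x) monoid_scheme \<Rightarrow> ('h, 'y) monoid_scheme \<Rightarrow> ('h \<Rightarrow> 'n \<Rightarrow> 'n) \<Rightarrow> ('n \<times> 'h) monoid" where
  "semidirect N H \<phi> =
     \<lparr>carrier = carrier N \<times> carrier H,
      mult = (\<lambda>(n1, h1) (n2, h2). (n1 \<otimes>\<^bsub>N\<^esub> \<phi> h1 n2, h1 \<otimes>\<^bsub>H\<^esub> h2)),
      one = (\<one>\<^bsub>N\<^esub>, \<one>\<^bsub>H\<^esub>)\<rparr>"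

text \<open>(R/Z)^m \<rtimes> Sigma_m, with R/Z represented by [0,1) under addition mod 1,
vectors as extensional functions on {1..m}, and Sigma_m = sym_group m acting by
permuting coordinates: (v,s)(w,t) = (v + s.w, s o t), (s.w)(i) = w(s^-1 i).\<close>
definition torus_wreath :: "nat \<Rightarrow> ((nat \<Rightarrow> real) \<times> (nat \<Rightarrow> nat)) monoid" where
  "torus_wreath m =
     \<lparr>carrier = ({1..m} \<rightarrow>\<^sub>E {0..<1}) \<times> carrier (sym_group m),
      mult = (\<lambda>(v, s) (w, t). ((\<lambda>i\<in>{1..m}. frac (v i + w (inv_into UNIV s i))), s \<circ> t)),
      one = ((\<lambda>i\<in>{1..m}. 0), id)\<rparr>"

definition diagonal :: "nat \<Rightarrow> ((nat \<Rightarrow> real) \<times> (nat \<Rightarrow> nat)) set" where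
  "diagonal m = {((\<lambda>i\<in>{1..m}. t), id) | t. t \<in> {0..<1}}"

definition virtually_cyclic :: "('a, 'b) monoid_scheme \<Rightarrow> bool" where
  "virtually_cyclic G \<longleftrightarrow> (\<exists>g \<in> carrier G. finite (rcosets\<^bsub>G\<^esub> (generate G {g})))"

end

(*
On a minimal component J the map f acts on right germs x, and by its left limits on left germs y.
Call x adjacent to y if the two forward orbits eventually coincide; since nonperiodic orbits leave
every finite set, this is a bijection from right germs to left germs, and every h in C(f) respects
it. It differs from the usual gluing x = y on a set S.

If S is infinite, the finitely many f-orbits meeting S infinitely often are permuted by C(f), and an
element fixing one of them agrees with a power of f on a dense subset of J: the group is virtually
cyclic. If S is finite, gluing J along adjacency yields finitely many circles, and the unit speed
flow on them commutes with all of C(f) on J; hence each element permutes the circles and rotates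
between them, and the flow itself is the diagonal of the torus.

The nonperiodic set splits into finitely many minimal components because invariant right-open sets
are finite unions of intervals: a run of such a set does not get shorter under f or its inverse
unless it meets one of finitely many breaks, and there are only finitely many runs above any given
length. Periods are bounded: a periodic orbit can be pushed rigidly to the left until it hits a
break, which has the same period. The points of period p are a rescaled copy of the circle
on which f is the rotation by 1/p, with the minima of the orbits as fundamental domain. Choosing for
each class of C(f)-equivalent components identifications with one representative gives the
permutation part F.
*)
theory Submission
  imports Defs
begin

section \<open>Finite unions of half-open intervals and piecewise affine maps\<close>

text \<open>Interval exchanges with half-open pieces are right continuous, so a right germ is just a
  point, while left germs need a map \<open>lm\<close> of their own. The obstacle is that an element
  of C(f) may cut J at points where f does not, so touching on the real line is not preserved.
  Adjacency is therefore read off from the dynamics alone: an element of C(f) has finitely many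
  breaks, a nonperiodic orbit is eventually clear of them, and there the element agrees with its
  left limit. The flow is then described by conditions on germs only, so that commuting with C(f) is
  built into its definition. The other recurring principle is rigidity: two piecewise translations
  of J that commute with f and agree at one point agree along its orbit and, by density from the
  right, on all of J. It yields the finite number of cosets, the common period of all circles and
  the injectivity of the map into the torus group.\<close>

definition hoi :: "real set \<Rightarrow> bool" where
  "hoi W \<longleftrightarrow> (\<exists>P. finite P \<and> W = (\<Union>(a,b)\<in>P. {a..<b}))"

lemma hoi_interval [simp]: "hoi {a..<b}"
  unfolding hoi_def by (rule exI[of _ "{(a,b)}"]) auto

lemma hoi_empty [simp]: "hoi {}"
  unfolding hoi_def by (rule exI[of _ "{}"]) auto

lemma hoi_Un [simp]: "hoi W \<Longrightarrow> hoi Y \<Longrightarrow> hoi (W \<union> Y)"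
  unfolding hoi_def
proof (elim exE conjE)
  fix P Q assume "finite P" "W = (\<Union>(a,b)\<in>P. {a..<b})" "finite Q" "Y = (\<Union>(a,b)\<in>Q. {a..<b})"
  then show "\<exists>P. finite P \<and> W \<union> Y = (\<Union>(a,b)\<in>P. {a..<b::real})"
    by (intro exI[of _ "P \<union> Q"]) simp
qed

lemma hoi_UN: "finite I \<Longrightarrow> (\<And>i. i \<in> I \<Longrightarrow> hoi (W i)) \<Longrightarrow> hoi (\<Union>i\<in>I. W i)"
  by (induction I rule: finite_induct) auto

lemma hoi_Int [simp]:
  assumes "hoi W" "hoi Y" shows "hoi (W \<inter> Y)"
proof -
  obtain P where P: "finite P" "W = (\<Union>(a,b)\<in>P. {a..<b})" using assms(1) hoi_def by auto
  obtain Q where Q: "finite Q" "Y = (\<Union>(a,b)\<in>Q. {a..<b})" using assms(2) hoi_def by auto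
  have "W \<inter> Y = (\<Union>p\<in>P. \<Union>q\<in>Q. {fst p..<snd p} \<inter> {fst q..<snd q})"
    unfolding P Q by (auto simp del: Int_atLeastLessThan)
  then show ?thesis using P(1) Q(1) by (auto intro!: hoi_UN)
qed

lemma hoi_INT: "finite I \<Longrightarrow> I \<noteq> {} \<Longrightarrow> (\<And>i. i \<in> I \<Longrightarrow> hoi (W i)) \<Longrightarrow> hoi (\<Inter>i\<in>I. W i)"
  by (induction I rule: finite_ne_induct) auto

text \<open>Removing one interval leaves at most two intervals of each piece, so the subtracted
  family is peeled off one interval at a time.\<close>

lemma hoi_Diff [simp]:
  assumes "hoi W" "hoi Y" shows "hoi (W - Y)"
proof -
  obtain P where P: "finite P" "W = (\<Union>(a,b)\<in>P. {a..<b})" using assms(1) hoi_def by auto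
  obtain Q where Q: "finite Q" "Y = (\<Union>(a,b)\<in>Q. {a..<b})" using assms(2) hoi_def by auto
  have "hoi (W - (\<Union>(a,b)\<in>Q. {a..<b}))" using Q(1)
  proof (induction Q rule: finite_induct)
    case empty
    then show ?case using assms(1) by simp
  next
    case (insert q Q)
    define Z where "Z = W - (\<Union>(a,b)\<in>Q. {a..<b})"
    have Z: "hoi Z" using insert Z_def by simp
    then obtain R where R: "finite R" "Z = (\<Union>(a,b)\<in>R. {a..<b})" using hoi_def by auto
    have "W - (\<Union>(a,b)\<in>insert q Q. {a..<b}) = Z - {fst q..<snd q}"
      unfolding Z_def by auto
    also have "\<dots> = (\<Union>r\<in>R. {fst r..<snd r} - {fst q..<snd q})"
      unfolding R by auto
    also have "\<dots> = (\<Union>r\<in>R. {fst r..<min (snd r) (fst q)} \<union> {max (fst r) (snd q)..<snd r})"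
      by (intro SUP_cong refl) auto
    finally show ?case using R(1) by (auto intro!: hoi_UN)
  qed
  then show ?thesis unfolding Q .
qed

lemma hoi_right_in:
  assumes "hoi W" "x \<in> W" shows "\<exists>e>0. {x..<x+e} \<subseteq> W"
proof -
  obtain P where P: "finite P" "W = (\<Union>(a,b)\<in>P. {a..<b})" using assms(1) hoi_def by auto
  then obtain a b where "(a,b) \<in> P" "x \<in> {a..<b}" using assms(2) by auto
  then show ?thesis unfolding P by (intro exI[of _ "b - x"]) (auto intro!: bexI[of _ "(a,b)"])
qed

lemma hoi_right_out:
  assumes "hoi W" "x \<notin> W" shows "\<exists>e>0. {x..<x+e} \<inter> W = {}"
proof -
  obtain e where "e > 0" "{x..<x+e} \<subseteq> {x..<x+1} - W"
    using hoi_right_in[of "{x..<x+1} - W" x] assms by auto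
  then show ?thesis by blast
qed

text \<open>Every such \<open>b\<close> is the right end of one of the defining intervals: take a
  point left of \<open>b\<close> beyond all smaller interval ends; the interval containing it
  reaches \<open>b\<close>, and if it did not end exactly there it would contain
  \<open>b\<close>.\<close>

lemma hoi_finite_right_ends:
  assumes "hoi W" shows "finite {b. b \<notin> W \<and> (\<exists>e>0. {b-e<..<b} \<subseteq> W)}"
proof -
  obtain P where P: "finite P" "W = (\<Union>(a,b)\<in>P. {a..<b})" using assms(1) hoi_def by auto
  have "b \<in> snd ` P" if b: "b \<notin> W" "e > 0" "{b-e<..<b} \<subseteq> W" for b e
  proof (rule ccontr)
    assume nb: "b \<notin> snd ` P"
    define m where "m = Max (insert (b - e) {x \<in> snd ` P. x < b})"
    have fin: "finite {x \<in> snd ` P. x < b}" using P(1) by auto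
    have m: "m < b" unfolding m_def using fin b by auto
    have m': "b - e \<le> m" unfolding m_def using fin by auto
    define z where "z = (m + b)/2"
    have z: "z < b" "m < z" unfolding z_def using m by auto
    then have "z \<in> W" using b m' by auto
    then obtain p where p: "p \<in> P" "z \<in> {fst p..<snd p}" unfolding P by auto
    have "snd p \<ge> b"
    proof (rule ccontr)
      assume "\<not> snd p \<ge> b"
      then have "snd p \<le> m" unfolding m_def using fin p(1) by (intro Max_ge) auto
      then show False using p z by auto
    qed
    then have "snd p > b" using nb p(1) by force
    then have "b \<in> {fst p..<snd p}" using p z by auto
    then show False using b(1) p(1) unfolding P by force
  qed
  then have "{b. b \<notin> W \<and> (\<exists>e>0. {b-e<..<b} \<subseteq> W)} \<subseteq> snd ` P" by blast
  then show ?thesis using P(1) finite_subset by blast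
qed

text \<open>All pieces share the slope \<open>k\<close> and differ only in the constant. Slope 1
  gives piecewise translations; other slopes occur when a periodic stratum is rescaled onto the unit
  circle. Pieces may overlap or be empty, which spares any normal form.\<close>

definition paff :: "real \<Rightarrow> (real \<Rightarrow> real) \<Rightarrow> real set \<Rightarrow> bool" where
  "paff k f W \<longleftrightarrow> (\<exists>P. finite P \<and> W = (\<Union>(a,b,c)\<in>P. {a..<b}) \<and>
      (\<forall>(a,b,c)\<in>P. \<forall>x\<in>{a..<b}. f x = k * x + c))"

lemma paffI:
  assumes "finite P" "W = (\<Union>p\<in>P. {l p..<r p})"
    "\<And>p x. p \<in> P \<Longrightarrow> l p \<le> x \<Longrightarrow> x < r p \<Longrightarrow> f x = k * x + c p"
  shows "paff k f W"
  unfolding paff_def by (rule exI[of _ "(\<lambda>p. (l p, r p, c p)) ` P"]) (use assms in auto)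

lemma paffE:
  assumes "paff k f W"
  obtains P :: "(real \<times> real \<times> real) set" and l r c where "finite P" "W = (\<Union>p\<in>P. {l p..<r p})"
    "\<And>p x. p \<in> P \<Longrightarrow> l p \<le> x \<Longrightarrow> x < r p \<Longrightarrow> f x = k * x + c p"
proof -
  obtain P where P: "finite P" "W = (\<Union>(a,b,c)\<in>P. {a..<b})"
      "\<forall>(a,b,c)\<in>P. \<forall>x\<in>{a..<b}. f x = k * x + c" using assms paff_def by auto
  show ?thesis
    by (rule that[of P fst "\<lambda>p. fst (snd p)" "\<lambda>p. snd (snd p)"]) (use P in \<open>auto simp: split_def\<close>)
qed

lemma paff_hoi: "paff k f W \<Longrightarrow> hoi W"
  by (erule paffE) (auto intro: hoi_UN)

lemma paff_empty [simp]: "paff k f {}"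
  by (rule paffI[where P="{}"]) auto

lemma paff_interval: "(\<And>x. a \<le> x \<Longrightarrow> x < b \<Longrightarrow> f x = k * x + c) \<Longrightarrow> paff k f {a..<b}"
  by (rule paffI[where P="{()}" and l="\<lambda>_. a" and r="\<lambda>_. b" and c="\<lambda>_. c"]) auto

lemma paff_cong: "paff k f W \<Longrightarrow> (\<And>x. x \<in> W \<Longrightarrow> g x = f x) \<Longrightarrow> paff k g W"
  unfolding paff_def
  by (elim exE conjE, rule exI, intro conjI, assumption, assumption) fastforce

lemma paff_Un [intro]:
  assumes "paff k f W" "paff k f Y" shows "paff k f (W \<union> Y)"
proof -
  obtain P where P: "finite P" "W = (\<Union>(a,b,c)\<in>P. {a..<b})"
      "\<forall>(a,b,c)\<in>P. \<forall>x\<in>{a..<b}. f x = k * x + c" using assms paff_def by auto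
  obtain Q where Q: "finite Q" "Y = (\<Union>(a,b,c)\<in>Q. {a..<b})"
      "\<forall>(a,b,c)\<in>Q. \<forall>x\<in>{a..<b}. f x = k * x + c" using assms paff_def by auto
  show ?thesis unfolding paff_def by (rule exI[of _ "P \<union> Q"]) (use P Q in auto)
qed

lemma paff_UN: "finite I \<Longrightarrow> (\<And>i. i \<in> I \<Longrightarrow> paff k f (W i)) \<Longrightarrow> paff k f (\<Union>i\<in>I. W i)"
  by (induction I rule: finite_induct) auto

lemma paff_subset:
  assumes "paff k f W" "hoi Y" "Y \<subseteq> W" shows "paff k f Y"
proof -
  obtain P :: "(real \<times> real \<times> real) set" and l r c where P: "finite P" "W = (\<Union>p\<in>P. {l p..<r p})"
    "\<And>p x. p \<in> P \<Longrightarrow> l p \<le> x \<Longrightarrow> x < r p \<Longrightarrow> f x = k * x + c p" using assms(1) by (rule paffE) blast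
  obtain Q where Q: "finite Q" "Y = (\<Union>(a,b)\<in>Q. {a..<b})" using assms(2) hoi_def by auto
  show ?thesis
  proof (rule paffI[where P="P \<times> Q" and l="\<lambda>(p,q). max (l p) (fst q)"
        and r="\<lambda>(p,q). min (r p) (snd q)" and c="\<lambda>(p,q). c p"])
    have "Y = W \<inter> Y" using assms by blast
    also have "\<dots> = (\<Union>(p,q)\<in>P \<times> Q. {l p..<r p} \<inter> {fst q..<snd q})"
      unfolding P(2) Q(2) by (auto simp del: Int_atLeastLessThan)
    finally show "Y = (\<Union>p\<in>P \<times> Q. {case p of (p, q) \<Rightarrow> max (l p) (fst q)..<case p of (p, q) \<Rightarrow> min (r p) (snd q)})"
      by (simp add: split_def)
  qed (use P Q in auto)
qed

lemma paff_id: "hoi W \<Longrightarrow> (\<And>x. x \<in> W \<Longrightarrow> f x = x) \<Longrightarrow> paff 1 f W"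
  unfolding hoi_def
  by (elim exE conjE, rule paffI[where l=fst and r=snd and c="\<lambda>_. 0"]) (auto simp: split_def)

text \<open>Since the inner slope is positive, the preimage of a half-open interval is half-open on
  the same side, and the common refinement consists of the intersections of pieces with such
  preimages.\<close>

lemma paff_comp:
  assumes f: "paff k f W" and g: "paff j g Y" and k: "k > 0" and sub: "f ` W \<subseteq> Y"
  shows "paff (j * k) (g \<circ> f) W"
proof -
  obtain P :: "(real \<times> real \<times> real) set" and l r c where P: "finite P" "W = (\<Union>p\<in>P. {l p..<r p})"
    "\<And>p x. p \<in> P \<Longrightarrow> l p \<le> x \<Longrightarrow> x < r p \<Longrightarrow> f x = k * x + c p" using f by (rule paffE) blast
  obtain Q :: "(real \<times> real \<times> real) set" and l' r' c' where Q: "finite Q" "Y = (\<Union>p\<in>Q. {l' p..<r' p})"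
    "\<And>p x. p \<in> Q \<Longrightarrow> l' p \<le> x \<Longrightarrow> x < r' p \<Longrightarrow> g x = j * x + c' p" using g by (rule paffE) blast
  have eq: "x \<in> {max (l p) ((l' q - c p)/k)..<min (r p) ((r' q - c p)/k)} \<longleftrightarrow>
       l p \<le> x \<and> x < r p \<and> f x \<in> {l' q..<r' q}" if "p \<in> P" for p q x
    using P(3)[OF that, of x] k by (auto simp: field_simps)
  show ?thesis
  proof (rule paffI[where P="P \<times> Q" and l="\<lambda>(p,q). max (l p) ((l' q - c p)/k)"
        and r="\<lambda>(p,q). min (r p) ((r' q - c p)/k)" and c="\<lambda>(p,q). j * c p + c' q"])
    show "W = (\<Union>z\<in>P \<times> Q. {case z of (p, q) \<Rightarrow> max (l p) ((l' q - c p)/k)..<case z of (p, q) \<Rightarrow> min (r p) ((r' q - c p)/k)})"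
      (is "W = ?Z")
    proof
      show "W \<subseteq> ?Z"
      proof
        fix x assume x: "x \<in> W"
        then obtain p where p: "p \<in> P" "l p \<le> x" "x < r p" unfolding P by auto
        obtain q where q: "q \<in> Q" "f x \<in> {l' q..<r' q}" using sub x unfolding Q by blast
        have "x \<in> {max (l p) ((l' q - c p)/k)..<min (r p) ((r' q - c p)/k)}"
          unfolding eq[OF p(1)] using p q by blast
        then show "x \<in> ?Z" using p q by (intro UN_I[of "(p,q)"]) auto
      qed
      show "?Z \<subseteq> W" unfolding P by force
    qed
    fix z x assume z: "z \<in> P \<times> Q" "(case z of (p, q) \<Rightarrow> max (l p) ((l' q - c p)/k)) \<le> x"
      "x < (case z of (p, q) \<Rightarrow> min (r p) ((r' q - c p)/k))"
    obtain p q where pq: "z = (p,q)" by (cases z)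
    then have "l p \<le> x \<and> x < r p \<and> f x \<in> {l' q..<r' q}" using z eq[of p x q] by auto
    then show "(g \<circ> f) x = j * k * x + (case z of (p, q) \<Rightarrow> j * c p + c' q)"
      using P(3)[of p x] Q(3)[of q "f x"] z pq by (auto simp: algebra_simps)
  qed (use P Q in auto)
qed

lemma paff_inverse:
  assumes f: "paff k f W" and k: "k > 0" and g: "\<And>x. x \<in> W \<Longrightarrow> g (f x) = x"
  shows "paff (1/k) g (f ` W)"
proof -
  obtain P :: "(real \<times> real \<times> real) set" and l r c where P: "finite P" "W = (\<Union>p\<in>P. {l p..<r p})"
    "\<And>p x. p \<in> P \<Longrightarrow> l p \<le> x \<Longrightarrow> x < r p \<Longrightarrow> f x = k * x + c p" using f by (rule paffE) blast
  have im: "f ` {l p..<r p} = {k * l p + c p..<k * r p + c p}" if "p \<in> P" for p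
  proof
    show "f ` {l p..<r p} \<subseteq> {k * l p + c p..<k * r p + c p}"
      using P(3)[OF that] k by auto
    show "{k * l p + c p..<k * r p + c p} \<subseteq> f ` {l p..<r p}"
    proof
      fix y assume y: "y \<in> {k * l p + c p..<k * r p + c p}"
      have "(y - c p)/k \<in> {l p..<r p}" using y k by (auto simp: field_simps)
      moreover have "f ((y - c p)/k) = y" using P(3)[OF that] calculation k by auto
      ultimately show "y \<in> f ` {l p..<r p}" by (metis imageI)
    qed
  qed
  show ?thesis
  proof (rule paffI[where P=P and l="\<lambda>p. k * l p + c p" and r="\<lambda>p. k * r p + c p" and c="\<lambda>p. - c p / k"])
    show "f ` W = (\<Union>p\<in>P. {k * l p + c p..<k * r p + c p})"
      unfolding P(2) image_UN using im by auto
    fix p y assume p: "p \<in> P" "k * l p + c p \<le> y" "y < k * r p + c p"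
    then obtain x where x: "x \<in> {l p..<r p}" "y = f x" using im[of p] by (metis atLeastLessThan_iff imageE)
    then have "g y = x" using g p(1) P(2) by auto
    then show "g y = 1/k * y + - c p / k" using P(3)[of p x] x p k by (auto simp: field_simps)
  qed (use P in auto)
qed

text \<open>A condition that depends on the displacement alone is constant on each piece, so it
  selects a union of pieces. It is used for fixed point sets of powers and for comparing a point
  with its iterates.\<close>

lemma hoi_filter:
  assumes "paff 1 f W" "\<And>x y. x \<in> W \<Longrightarrow> y \<in> W \<Longrightarrow> f x - x = f y - y \<Longrightarrow> T x = T y"
  shows "hoi {x \<in> W. T x}"
proof -
  obtain P :: "(real \<times> real \<times> real) set" and l r c where P: "finite P" "W = (\<Union>p\<in>P. {l p..<r p})"
    "\<And>p x. p \<in> P \<Longrightarrow> l p \<le> x \<Longrightarrow> x < r p \<Longrightarrow> f x = 1 * x + c p" using assms(1) by (rule paffE) blast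
  have "{x \<in> W. T x} = (\<Union>p\<in>{p\<in>P. l p < r p \<and> T (l p)}. {l p..<r p})"
  proof (intro Set.set_eqI)
    fix x
    have "T x = T (l p)" if "p \<in> P" "x \<in> {l p..<r p}" for p
    proof (rule assms(2))
      show "x \<in> W" "l p \<in> W" unfolding P(2) using that by force+
      show "f x - x = f (l p) - l p" using P(3)[of p] that by auto
    qed
    then show "x \<in> {x \<in> W. T x} \<longleftrightarrow> x \<in> (\<Union>p\<in>{p\<in>P. l p < r p \<and> T (l p)}. {l p..<r p})"
      unfolding P(2) by fastforce
  qed
  then show ?thesis using P(1) by (auto intro: hoi_UN)
qed

lemma paff_right:
  assumes "paff k f W" "x \<in> W"
  shows "\<exists>e>0. {x..<x+e} \<subseteq> W \<and> (\<forall>h. 0 \<le> h \<longrightarrow> h < e \<longrightarrow> f (x + h) = f x + k * h)"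
proof -
  obtain P :: "(real \<times> real \<times> real) set" and l r c where P: "finite P" "W = (\<Union>p\<in>P. {l p..<r p})"
    "\<And>p x. p \<in> P \<Longrightarrow> l p \<le> x \<Longrightarrow> x < r p \<Longrightarrow> f x = k * x + c p" using assms(1) by (rule paffE) blast
  obtain p where p: "p \<in> P" "l p \<le> x" "x < r p" using assms(2) P(2) by auto
  show ?thesis
    by (rule exI[of _ "r p - x"]) (use p P(3)[of p] P(2) in \<open>force simp: algebra_simps\<close>)
qed

text \<open>The right ends of the pieces serve as breaks: if none lies in \<open>(x, y]\<close>, the
  piece containing \<open>x\<close> extends beyond \<open>y\<close>.\<close>

lemma paff_breaks:
  assumes "paff k f W" "W = {u..<v}"
  obtains D where "finite D" "u \<in> D"
    "\<And>x y. u \<le> x \<Longrightarrow> x \<le> y \<Longrightarrow> y < v \<Longrightarrow> D \<inter> {x<..y} = {} \<Longrightarrow> f y = f x + k * (y - x)"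
proof -
  obtain P :: "(real \<times> real \<times> real) set" and l r c where P: "finite P" "W = (\<Union>p\<in>P. {l p..<r p})"
    "\<And>p x. p \<in> P \<Longrightarrow> l p \<le> x \<Longrightarrow> x < r p \<Longrightarrow> f x = k * x + c p" using assms(1) by (rule paffE) blast
  show thesis
  proof (rule that[of "insert u (r ` P)"])
    fix x y assume xy: "u \<le> x" "x \<le> y" "y < v" "insert u (r ` P) \<inter> {x<..y} = {}"
    then have "x \<in> W" using assms by auto
    then obtain p where p: "p \<in> P" "l p \<le> x" "x < r p" using P(2) by auto
    then have "r p \<notin> {x<..y}" using xy by blast
    then have "y < r p" using p by auto
    then show "f y = f x + k * (y - x)" using p P(3)[of p x] P(3)[of p y] xy by (auto simp: algebra_simps)
  qed (use P in auto)
qed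


section \<open>Interval exchanges as piecewise translations, and their group structure\<close>

lemma Union_consecutive_intervals:
  fixes a :: "nat \<Rightarrow> real"
  assumes "\<And>i. i < n \<Longrightarrow> a i < a (Suc i)"
  shows "a 0 \<le> a n \<and> {a 0..<a n} = (\<Union>i<n. {a i..<a (Suc i)})"
  using assms
proof (induction n)
  case (Suc n)
  then have IH: "a 0 \<le> a n" "{a 0..<a n} = (\<Union>i<n. {a i..<a (Suc i)})" by auto
  have "a n < a (Suc n)" using Suc by auto
  moreover have "{a 0..<a (Suc n)} = {a 0..<a n} \<union> {a n..<a (Suc n)}"
    using IH(1) calculation by auto
  ultimately show ?case using IH by (auto simp: lessThan_Suc)
qed auto

lemma paff_frac:
  assumes "0 \<le> a" "b \<le> 1" "\<And>x. x \<in> {a..<b} \<Longrightarrow> f x = frac (x + c)"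
  shows "paff 1 f {a..<b}"
proof -
  \<comment> \<open>The wrap-around point: here \<open>x + c\<close> reaches the first integer above
    \<open>c\<close>.\<close>
  define t where "t = of_int \<lfloor>c\<rfloor> + 1 - c"
  have 1: "f x = 1 * x + (c - of_int \<lfloor>c\<rfloor>)" if "a \<le> x" "x < min b t" for x
  proof -
    have "\<lfloor>x + c\<rfloor> = \<lfloor>c\<rfloor>" by (rule floor_unique) (use that assms(1) in \<open>auto simp: t_def\<close>, linarith+)
    then show ?thesis using assms(3)[of x] that by (simp add: frac_def)
  qed
  have 2: "f x = 1 * x + (c - of_int \<lfloor>c\<rfloor> - 1)" if "max a t \<le> x" "x < b" for x
  proof -
    have "\<lfloor>x + c\<rfloor> = \<lfloor>c\<rfloor> + 1" by (rule floor_unique) (use that assms(2) in \<open>auto simp: t_def\<close>, linarith+)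
    then show ?thesis using assms(3)[of x] that by (simp add: frac_def)
  qed
  have "{a..<b} = {a..<min b t} \<union> {max a t..<b}" by auto
  moreover have "paff 1 f {a..<min b t}" by (rule paff_interval) (rule 1)
  moreover have "paff 1 f {max a t..<b}" by (rule paff_interval) (rule 2)
  ultimately show ?thesis using paff_Un by simp
qed

text \<open>Replaces an ordered partition with translations mod 1 by an unordered finite cover with
  genuine translations, the form in which maps are built and glued below. For the way back the
  breaks are sorted.\<close>

lemma is_iet_iff:
  "is_iet f \<longleftrightarrow> (\<forall>x. x \<notin> {0..<1} \<longrightarrow> f x = x) \<and> bij_betw f {0..<1} {0..<1} \<and> paff 1 f {0..<1}"
proof (intro iffI conjI)
  assume f: "is_iet f"
  show "\<forall>x. x \<notin> {0..<1} \<longrightarrow> f x = x" "bij_betw f {0..<1} {0..<1}" using f is_iet_def by auto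
  obtain a n where a: "a 0 = 0" "a n = 1" "\<And>i. i < n \<Longrightarrow> a i < a (Suc i)"
    "\<And>i. i < n \<Longrightarrow> \<exists>c. \<forall>x \<in> {a i..<a (Suc i)}. f x = frac (x + c)" using f is_iet_def by auto
  have un: "{0..<1} = (\<Union>i<n. {a i..<a (Suc i)})"
    using Union_consecutive_intervals[of n a] a by auto
  have "paff 1 f {a i..<a (Suc i)}" if i: "i < n" for i
  proof -
    obtain c where c: "\<forall>x \<in> {a i..<a (Suc i)}. f x = frac (x + c)" using a(4) i by blast
    have sub: "{a i..<a (Suc i)} \<subseteq> {0..<1}" using un i by blast
    have "0 \<le> a i" using sub a(3)[OF i] by auto
    moreover have "a (Suc i) \<le> 1"
      using sub a(3)[OF i] by (meson atLeastLessThan_subseteq_atLeastAtMost_iff atLeastLessThan_subset_iff not_less)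
    ultimately show ?thesis using paff_frac[of "a i" "a (Suc i)" f c] c by auto
  qed
  then show "paff 1 f {0..<1}" unfolding un by (intro paff_UN) auto
next
  assume f: "(\<forall>x. x \<notin> {0..<1} \<longrightarrow> f x = x) \<and> bij_betw f {0..<1} {0..<1} \<and> paff 1 f {0..<1}"
  then have fr: "f x \<in> {0..<1}" if "x \<in> {0..<1}" for x using that bij_betwE by blast
  obtain D where D: "finite D" "0 \<in> D"
    "\<And>x y. 0 \<le> x \<Longrightarrow> x \<le> y \<Longrightarrow> y < 1 \<Longrightarrow> D \<inter> {x<..y} = {} \<Longrightarrow> f y = f x + 1 * (y - x)"
    using paff_breaks[of 1 f "{0..<1}" 0 1] f by metis
  \<comment> \<open>\<open>D\<close> may contain points outside the unit interval, which are
    discarded; 1 is added as the end of the last interval.\<close>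
  define E where "E = insert 1 (D \<inter> {0..<1})"
  have E: "finite E" "0 \<in> E" "1 \<in> E" "E \<subseteq> {0..1}" using D E_def by auto
  define xs where "xs = sorted_list_of_set E"
  have xs: "set xs = E" "sorted_wrt (<) xs" unfolding xs_def using E(1) by auto
  define n where "n = length xs - 1"
  have len: "length xs = Suc n" using xs E(2) n_def by (cases xs) auto
  have mono: "xs ! i < xs ! j" if "i < j" "j \<le> n" for i j
    using sorted_wrt_nth_less[OF xs(2)] that len by auto
  obtain i0 where "i0 \<le> n" "xs ! i0 = 0" using xs(1) E(2) len by (metis in_set_conv_nth less_Suc_eq_le)
  then have z: "xs ! 0 = 0" using mono[of 0 i0] xs(1) E(4) len
    by (metis atLeastAtMost_iff bot_nat_0.not_eq_extremum in_mono leD nth_mem zero_less_Suc)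
  obtain i1 where "i1 \<le> n" "xs ! i1 = 1" using xs(1) E(3) len by (metis in_set_conv_nth less_Suc_eq_le)
  then have o: "xs ! n = 1" using mono[of i1 n] xs(1) E(4) len
    by (metis atLeastAtMost_iff in_mono leD lessI nth_mem order_le_less)
  have "\<exists>c. \<forall>x \<in> {xs ! i..<xs ! (Suc i)}. f x = frac (x + c)" if i: "i < n" for i
  proof (intro exI ballI)
    fix x assume x: "x \<in> {xs ! i..<xs ! (Suc i)}"
    have b: "xs ! i \<in> E" "xs ! Suc i \<in> E" using xs(1) len i by (metis Suc_lessD Suc_less_eq nth_mem)+
    have "D \<inter> {xs ! i<..x} = {}"
    proof (rule ccontr)
      assume "D \<inter> {xs ! i<..x} \<noteq> {}"
      then obtain d where d: "d \<in> D" "xs ! i < d" "d \<le> x" by auto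
      have "d \<in> E" unfolding E_def using d b x E(4) by auto
      then obtain j where j: "j \<le> n" "xs ! j = d" using xs(1) len by (metis in_set_conv_nth less_Suc_eq_le)
      have "i < j" using mono[of j i] i d j by (metis less_imp_le_nat less_irrefl not_less_iff_gr_or_eq)
      then have "xs ! Suc i \<le> d" using mono[of "Suc i" j] j by (cases "j = Suc i") auto
      then show False using d x by auto
    qed
    moreover have "0 \<le> xs ! i" "xs ! Suc i \<le> 1" using b E(4) by auto
    ultimately have "f x = x + (f (xs ! i) - xs ! i)" using D(3)[of "xs ! i" x] x by auto
    moreover have "f x \<in> {0..<1}" by (rule fr) (use x \<open>0 \<le> xs ! i\<close> \<open>xs ! Suc i \<le> 1\<close> in auto)
    ultimately show "f x = frac (x + (f (xs ! i) - xs ! i))" by (metis atLeastLessThan_iff frac_eq)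
  qed
  then show "is_iet f" unfolding is_iet_def using f z o mono by (intro conjI exI[of _ "\<lambda>i. xs ! i"] exI[of _ n]) auto
qed

lemma IET_iff:
  "f \<in> carrier IET \<longleftrightarrow> (\<forall>x. x \<notin> {0..<1} \<longrightarrow> f x = x) \<and> bij_betw f {0..<1} {0..<1} \<and> paff 1 f {0..<1}"
  unfolding IET_def using is_iet_iff by simp

lemma IET_out: "f \<in> carrier IET \<Longrightarrow> x \<notin> {0..<1} \<Longrightarrow> f x = x"
  unfolding IET_iff by blast

lemma IET_paff: "f \<in> carrier IET \<Longrightarrow> hoi W \<Longrightarrow> W \<subseteq> {0..<1} \<Longrightarrow> paff 1 f W"
  unfolding IET_iff using paff_subset by blast

lemma IET_bij: assumes "f \<in> carrier IET" shows "bij f"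
proof -
  have "bij_betw f {0..<1} {0..<1}" using assms IET_iff by blast
  moreover have "bij_betw f (-{0..<1}) (-{0..<1})"
    using IET_out[OF assms] by (auto simp: bij_betw_def inj_on_def image_iff)
  ultimately have "bij_betw f ({0..<1} \<union> -{0..<1}) ({0..<1} \<union> -{0..<1})"
    by (rule bij_betw_combine) auto
  then show ?thesis by simp
qed

lemma IET_inj: "f \<in> carrier IET \<Longrightarrow> f x = f y \<longleftrightarrow> x = y"
  using IET_bij bij_is_inj inj_eq by metis

lemma IET_unit: "f \<in> carrier IET \<Longrightarrow> f x \<in> {0..<1} \<longleftrightarrow> x \<in> {0..<1}"
  using IET_out[of f x] bij_betwE[of f "{0..<1}" "{0..<1}"] IET_iff[of f] by metis

lemma IET_I:
  assumes "bij f" "\<And>x. x \<notin> {0..<1} \<Longrightarrow> f x = x" "paff 1 f {0..<1}"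
  shows "f \<in> carrier IET"
  unfolding IET_iff
proof (intro conjI)
  have "f x \<in> {0..<1}" if "x \<in> {0..<1}" for x
    using assms(1,2) that by (metis bij_is_inj inj_eq)
  moreover have "\<exists>x\<in>{0..<1}. y = f x" if "y \<in> {0..<1}" for y
    using assms(1,2) that by (metis bij_pointE)
  ultimately show "bij_betw f {0..<1} {0..<1}"
    using assms(1) unfolding bij_betw_def image_def by (auto simp: inj_on_def)
qed (use assms in auto)

lemma IET_id [simp]: "id \<in> carrier IET"
  by (rule IET_I) (auto intro: paff_id)

lemma IET_comp [simp]:
  assumes "f \<in> carrier IET" "g \<in> carrier IET" shows "f \<circ> g \<in> carrier IET"
proof (rule IET_I)
  show "bij (f \<circ> g)" using IET_bij assms bij_comp by blast
  show "(f \<circ> g) x = x" if "x \<notin> {0..<1}" for x using that assms by (simp add: IET_out)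
  have "g ` {0..<1} \<subseteq> {0..<1}" using IET_unit[OF assms(2)] by blast
  then have "paff (1 * 1) (f \<circ> g) {0..<1}" using assms
    by (intro paff_comp[where Y="{0..<1}"]) (auto intro: IET_paff)
  then show "paff 1 (f \<circ> g) {0..<1}" by simp
qed

abbreviation finv :: "('a \<Rightarrow> 'b) \<Rightarrow> 'b \<Rightarrow> 'a" where "finv f \<equiv> inv_into UNIV f"

lemma IET_finv_left [simp]: "f \<in> carrier IET \<Longrightarrow> finv f (f x) = x"
  by (simp add: IET_bij bij_is_inj)

lemma IET_finv_right [simp]: "f \<in> carrier IET \<Longrightarrow> f (finv f x) = x"
  by (simp add: IET_bij bij_is_surj surj_f_inv_f)

lemma IET_finv_eq: "f \<in> carrier IET \<Longrightarrow> finv f x = y \<longleftrightarrow> x = f y"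
  by auto

lemma IET_finv [simp]:
  assumes "f \<in> carrier IET" shows "finv f \<in> carrier IET"
proof (rule IET_I)
  show "bij (finv f)" using IET_bij[OF assms] bij_imp_bij_inv by blast
  show "finv f x = x" if "x \<notin> {0..<1}" for x
    using that assms IET_finv_eq IET_out by metis
  have "f ` {0..<1} = {0..<1}" using assms IET_iff bij_betw_imp_surj_on by blast
  then show "paff 1 (finv f) {0..<1}"
    using paff_inverse[of 1 f "{0..<1}" "finv f"] assms IET_paff[of f "{0..<1}"] by simp
qed

lemma IET_funpow [simp]: "f \<in> carrier IET \<Longrightarrow> f ^^ n \<in> carrier IET"
  by (induction n) (auto simp del: comp_apply)

lemma group_subgrp:
  assumes "S \<subseteq> carrier IET" "id \<in> S" "\<And>f g. f \<in> S \<Longrightarrow> g \<in> S \<Longrightarrow> f \<circ> g \<in> S"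
    "\<And>f. f \<in> S \<Longrightarrow> finv f \<in> S"
  shows "group (subgrp S)"
proof (rule groupI)
  fix f assume "f \<in> carrier (subgrp S)"
  then have "finv f \<in> S" "finv f \<circ> f = id" using assms by (auto simp: subgrp_def fun_eq_iff)
  then show "\<exists>g\<in>carrier (subgrp S). g \<otimes>\<^bsub>subgrp S\<^esub> f = \<one>\<^bsub>subgrp S\<^esub>"
    by (auto simp: subgrp_def IET_def)
qed (use assms in \<open>auto simp: subgrp_def IET_def\<close>)

lemma subgrp_simps [simp]:
  "carrier (subgrp S) = S" "f \<otimes>\<^bsub>subgrp S\<^esub> g = f \<circ> g" "\<one>\<^bsub>subgrp S\<^esub> = id"
  by (auto simp: subgrp_def IET_def)

lemma E_supp_iff: "h \<in> E_supp S \<longleftrightarrow> h \<in> carrier IET \<and> (\<forall>x. x \<notin> S \<longrightarrow> h x = x)"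
  unfolding E_supp_def support_def FixP_def using IET_out[of h] by blast

lemma centralizer_iff: "h \<in> centralizer f \<longleftrightarrow> h \<in> carrier IET \<and> (\<forall>x. f (h x) = h (f x))"
  unfolding centralizer_def by (auto simp: fun_eq_iff)

lemma centralizer_comp: "f \<in> carrier IET \<Longrightarrow> g \<in> centralizer f \<Longrightarrow> h \<in> centralizer f \<Longrightarrow> g \<circ> h \<in> centralizer f"
  by (auto simp: centralizer_iff simp del: comp_apply) (auto simp: centralizer_iff)

lemma centralizer_finv: "f \<in> carrier IET \<Longrightarrow> g \<in> centralizer f \<Longrightarrow> finv g \<in> centralizer f"
  by (auto simp: centralizer_iff) (metis IET_finv_left IET_finv_right)

lemma centralizer_funpow: "h \<in> centralizer f \<Longrightarrow> (f ^^ n) (h x) = h ((f ^^ n) x)"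
  by (induction n) (auto simp: centralizer_iff)

lemma E_supp_comp: "g \<in> E_supp S \<Longrightarrow> h \<in> E_supp S \<Longrightarrow> g \<circ> h \<in> E_supp S"
  by (auto simp: E_supp_iff simp del: comp_apply) auto

lemma E_supp_finv: "g \<in> E_supp S \<Longrightarrow> finv g \<in> E_supp S"
  by (auto simp: E_supp_iff) (metis IET_finv_left)

lemma group_centralizer_supp:
  assumes "f \<in> carrier IET" shows "group (subgrp (centralizer f \<inter> E_supp S))"
  by (rule group_subgrp)
     (use assms in \<open>auto simp: centralizer_comp E_supp_comp centralizer_finv E_supp_finv simp del: comp_apply\<close>,
      auto simp: centralizer_iff E_supp_iff)

text \<open>The pieces may be exchanged by \<open>\<pi>\<close>. With one piece this extends a map
  of a single set by the identity; with the minimal components as pieces it realises permutations of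
  components.\<close>

lemma glue_IET:
  assumes fin: "finite I" and W: "\<And>i. i \<in> I \<Longrightarrow> W i \<subseteq> {0..<1} \<and> bij_betw h (W i) (W (\<pi> i)) \<and> paff 1 h (W i)"
    and disj: "disjoint_family_on W I" and perm: "bij_betw \<pi> I I"
    and out: "\<And>x. (\<And>i. i \<in> I \<Longrightarrow> x \<notin> W i) \<Longrightarrow> h x = x"
  shows "h \<in> carrier IET"
proof (rule IET_I)
  let ?U = "\<Union>i\<in>I. W i"
  have "disjoint_family_on (\<lambda>i. W (\<pi> i)) I"
    using disj perm unfolding disjoint_family_on_def bij_betw_def inj_on_def by blast
  then have "bij_betw h ?U (\<Union>i\<in>I. W (\<pi> i))"
    by (rule bij_betw_UNION_disjoint) (use W in auto)
  moreover have "(\<Union>i\<in>I. W (\<pi> i)) = ?U"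
    using bij_betw_imp_surj_on[OF perm] by (metis image_image)
  ultimately have 1: "bij_betw h ?U ?U" by simp
  have "bij_betw h (-?U) (-?U)"
    using out by (auto simp: bij_betw_def inj_on_def image_iff)
  from bij_betw_combine[OF 1 this] show "bij h" by (simp only: Compl_partition Compl_disjoint)
  show "h x = x" if "x \<notin> {0..<1}" for x using that W out by blast
  have "paff 1 h ?U" using fin W by (intro paff_UN) auto
  moreover have "paff 1 h ({0..<1} - ?U)"
    by (rule paff_id) (use fin W out in \<open>auto intro!: hoi_Diff hoi_UN intro: paff_hoi\<close>)
  moreover have "?U \<union> ({0..<1} - ?U) = {0..<1}" using W by blast
  ultimately show "paff 1 h {0..<1}" using paff_Un by metis
qed

section \<open>Periodic points and minimal components\<close>

definition right_ends :: "real set \<Rightarrow> real set" where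
  "right_ends U = {b. b \<notin> U \<and> (\<exists>e>0. {b-e<..<b} \<subseteq> U)}"

text \<open>Runs are recorded by right end and length because the length is the quantity that does
  not decrease as long as the run meets no break.\<close>

definition run_length :: "real set \<Rightarrow> real \<Rightarrow> real" where
  "run_length U b = Sup {t. {b-t<..<b} \<subseteq> U}"

lemma right_ends_le_1:
  assumes U: "U \<subseteq> {0..<1}" and b: "b \<in> right_ends U"
  shows "b \<le> 1"
proof (rule ccontr)
  assume "\<not> b \<le> 1"
  obtain e where e: "e > 0" "{b-e<..<b} \<subseteq> U" using b right_ends_def by auto
  have "max ((1 + b)/2) (b - e/2) \<in> {b-e<..<b}" using e \<open>\<not> b \<le> 1\<close> by auto
  then have "max ((1 + b)/2) (b - e/2) < 1" using e U by (meson atLeastLessThan_iff in_mono)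
  then show False using \<open>\<not> b \<le> 1\<close> by auto
qed

lemma run_le:
  assumes U: "U \<subseteq> {0..<1}" and b: "b \<in> right_ends U" and t: "{b-t<..<b} \<subseteq> U"
  shows "t \<le> b"
proof -
  obtain e where e: "e > 0" "{b-e<..<b} \<subseteq> U" using b right_ends_def by auto
  then have "b - e/2 \<in> U" by auto
  then have "b - e/2 \<in> {0..<1}" using U by blast
  then have b0: "b > 0" using e by auto
  show ?thesis
  proof (rule ccontr)
    assume "\<not> t \<le> b"
    then have "min ((b-t)/2) (b/2) \<in> {b-t<..<b}" using b0 by auto
    then have "min ((b-t)/2) (b/2) \<ge> 0" using t U by (meson atLeastLessThan_iff in_mono)
    then show False using \<open>\<not> t \<le> b\<close> b0 by auto
  qed
qed

lemma run_length_ge: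
  assumes U: "U \<subseteq> {0..<1}" and b: "b \<in> right_ends U" and t: "{b-t<..<b} \<subseteq> U"
  shows "t \<le> run_length U b"
  unfolding run_length_def
  by (rule cSup_upper) (use t run_le[OF U b] in \<open>auto intro!: bdd_aboveI\<close>)

lemma run_length:
  assumes U: "U \<subseteq> {0..<1}" and b: "b \<in> right_ends U"
  shows "run_length U b > 0" "{b - run_length U b<..<b} \<subseteq> U"
proof -
  obtain e where e: "e > 0" "{b-e<..<b} \<subseteq> U" using b right_ends_def by auto
  then show "run_length U b > 0" using run_length_ge[OF U b] by (meson less_le_trans)
  show "{b - run_length U b<..<b} \<subseteq> U"
  proof
    fix x assume x: "x \<in> {b - run_length U b<..<b}"
    then have "b - x < Sup {t. {b-t<..<b} \<subseteq> U}" unfolding run_length_def by auto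
    then obtain t where "t \<in> {t. {b-t<..<b} \<subseteq> U}" "b - x < t"
      by (rule less_cSupE) (use e in auto)
    then show "x \<in> U" using x by auto
  qed
qed

lemma run_length_sep:
  assumes U: "U \<subseteq> {0..<1}" and b: "b \<in> right_ends U" "b' \<in> right_ends U" "b < b'"
  shows "b \<le> b' - run_length U b'"
proof (rule ccontr)
  assume "\<not> b \<le> b' - run_length U b'"
  then have "b \<in> {b' - run_length U b'<..<b'}" using b(3) by auto
  then show False using run_length(2)[OF U b(2)] b(1) unfolding right_ends_def by blast
qed

text \<open>The right end of one run is never inside another, so right ends of runs of length at
  least \<open>l\<close> are at least \<open>l\<close> apart. Hence
  \<open>\<lfloor>b / l\<rfloor>\<close> tells them apart, and it takes finitely many
  values.\<close>

lemma finite_long_runs: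
  assumes U: "U \<subseteq> {0..<1}" and l: "l > 0"
  shows "finite {b \<in> right_ends U. run_length U b \<ge> l}" (is "finite ?B")
proof -
  have "inj_on (\<lambda>b. \<lfloor>b / l\<rfloor>) ?B"
  proof (rule linorder_inj_onI')
    fix b b' assume b: "b \<in> ?B" "b' \<in> ?B" "b < b'"
    then have "b + l \<le> b'" using run_length_sep[OF U, of b b'] by auto
    then have "(b + l) / l \<le> b' / l" using l by (intro divide_right_mono) auto
    then have "b / l + 1 \<le> b' / l" using l by (simp add: add_divide_distrib)
    then show "\<lfloor>b / l\<rfloor> \<noteq> \<lfloor>b' / l\<rfloor>" by linarith
  qed
  moreover have "(\<lambda>b. \<lfloor>b / l\<rfloor>) ` ?B \<subseteq> {0..\<lfloor>1/l\<rfloor>}"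
  proof (intro image_subsetI)
    fix b assume b: "b \<in> ?B"
    then have "b \<le> 1" using right_ends_le_1[OF U] by auto
    moreover have "b \<ge> 0" using b run_le[OF U _ run_length(2)[OF U]] l by fastforce
    ultimately show "\<lfloor>b / l\<rfloor> \<in> {0..\<lfloor>1/l\<rfloor>}" using l by (auto intro!: floor_mono divide_right_mono)
  qed
  ultimately show ?thesis using finite_imageD finite_subset by blast
qed

text \<open>The windows \<open>(b - run_length U b, b]\<close> of different runs are disjoint, so a
  choice of a point of \<open>D\<close> in each is injective. The window includes \<open>b\<close>
  itself, since a break there would separate the run from its end.\<close>

lemma finite_runs_meeting:
  assumes U: "U \<subseteq> {0..<1}" and D: "finite D"
  shows "finite {b \<in> right_ends U. D \<inter> {b - run_length U b<..b} \<noteq> {}}" (is "finite ?B")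
proof -
  define c where "c b = (SOME d. d \<in> D \<inter> {b - run_length U b<..b})" for b
  have c: "c b \<in> D \<inter> {b - run_length U b<..b}" if "b \<in> ?B" for b
  proof -
    have "\<exists>d. d \<in> D \<inter> {b - run_length U b<..b}" using that by blast
    then show ?thesis unfolding c_def by (rule someI_ex)
  qed
  have "inj_on c ?B"
  proof (rule linorder_inj_onI')
    fix b b' assume b: "b \<in> ?B" "b' \<in> ?B" "b < b'"
    then have "b \<le> b' - run_length U b'" using run_length_sep[OF U] by simp
    moreover have "c b \<le> b" "b' - run_length U b' < c b'" using c[OF b(1)] c[OF b(2)] by simp_all
    ultimately show "c b \<noteq> c b'" by linarith
  qed
  moreover have "c ` ?B \<subseteq> D" using c by blast
  ultimately show ?thesis using finite_imageD finite_subset D by blast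
qed

text \<open>A finite set outside of which the map continues as a translation from the left; surplus
  points are allowed. Requiring 0 gives every point of the unit interval a break at or below it, so
  that the maximum of those breaks exists.\<close>

definition breaks :: "(real \<Rightarrow> real) \<Rightarrow> real set \<Rightarrow> bool" where
  "breaks g D \<longleftrightarrow> finite D \<and> 0 \<in> D \<and>
     (\<forall>x y. 0 \<le> x \<longrightarrow> x \<le> y \<longrightarrow> y < 1 \<longrightarrow> D \<inter> {x<..y} = {} \<longrightarrow> g y = g x + (y - x))"

lemma breaksD:
  assumes "breaks g D"
  shows "finite D" "0 \<in> D"
    "0 \<le> x \<Longrightarrow> x \<le> y \<Longrightarrow> y < 1 \<Longrightarrow> D \<inter> {x<..y} = {} \<Longrightarrow> g y = g x + (y - x)"
  using assms unfolding breaks_def by blast+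

lemma IET_breaks:
  assumes "f \<in> carrier IET" obtains D where "breaks f D"
  using paff_breaks[of 1 f "{0..<1}" 0 1] IET_paff[OF assms] unfolding breaks_def by (metis hoi_interval mult_1 order_refl)

text \<open>Without a break in its window the run and its end \<open>b\<close> are translated
  together, and \<open>g b\<close> stays outside \<open>U\<close> by invariance. The image may be
  part of a longer run, joined to something on its left. The condition \<open>b < 1\<close> excludes
  runs ending at 1, a point that \<open>g\<close> fixes while moving the run.\<close>

lemma right_ends_step:
  assumes g: "g \<in> carrier IET" and U: "U \<subseteq> {0..<1}" and inv: "\<And>x. g x \<in> U \<longleftrightarrow> x \<in> U"
    and D: "breaks g D"
    and b: "b \<in> right_ends U" "b < 1" "D \<inter> {b - run_length U b<..b} = {}"
  shows "g b \<in> right_ends U \<and> run_length U b \<le> run_length U (g b)"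
proof -
  let ?l = "run_length U b"
  note l = run_length[OF U b(1)]
  have sub: "{g b - ?l<..<g b} \<subseteq> U"
  proof
    fix y assume y: "y \<in> {g b - ?l<..<g b}"
    define x where "x = b - (g b - y)"
    have x: "x \<in> {b - ?l<..<b}" using y x_def by auto
    then have xU: "x \<in> U" using l by blast
    then have "g b = g x + (b - x)" using x b U by (intro breaksD(3)[OF D]) auto
    then have "y = g x" unfolding x_def by auto
    then show "y \<in> U" using xU inv by auto
  qed
  have "g b \<notin> U" using inv b(1) right_ends_def by auto
  then have r: "g b \<in> right_ends U" unfolding right_ends_def using sub l(1) by blast
  then show ?thesis using run_length_ge[OF U r sub] by auto
qed

text \<open>From some time \<open>n0\<close> on, the orbit avoids the finitely many runs that meet a
  break. Lengths no longer decrease after that, so infinitely many runs would share a positive lower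
  bound on their lengths.\<close>

lemma right_ends_no_infinite_orbit:
  assumes g: "g \<in> carrier IET" and U: "U \<subseteq> {0..<1}" and inv: "\<And>x. g x \<in> U \<longleftrightarrow> x \<in> U"
    and inj: "inj (\<lambda>n. (g ^^ n) b)" and R: "\<And>n. (g ^^ n) b \<in> right_ends U"
  shows False
proof -
  obtain D where D: "breaks g D" by (rule IET_breaks[OF g])
  define B where "B = {b \<in> right_ends U. D \<inter> {b - run_length U b<..b} \<noteq> {}}"
  have "finite B" using finite_runs_meeting[OF U breaksD(1)[OF D]] B_def by simp
  then have "finite ((\<lambda>n. (g ^^ n) b) -` B)" using inj finite_vimageI by blast
  then obtain n0 where n0: "\<And>n. (g ^^ n) b \<in> B \<Longrightarrow> n < n0"
    using finite_nat_set_iff_bounded by (metis (no_types) vimageI)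
  have lt1: "(g ^^ n) b < 1" for n
  proof (rule ccontr)
    assume "\<not> (g ^^ n) b < 1"
    then have "g ((g ^^ n) b) = (g ^^ n) b" using IET_out[OF g] by auto
    then have "(g ^^ Suc n) b = (g ^^ n) b" by simp
    then show False using inj by (metis injD n_not_Suc_n)
  qed
  let ?l = "run_length U ((g ^^ n0) b)"
  have "run_length U ((g ^^ (n0 + n)) b) \<ge> ?l" for n
  proof (induction n)
    case (Suc n)
    have "(g ^^ (n0 + n)) b \<notin> B" using n0 by fastforce
    then have "D \<inter> {(g ^^ (n0 + n)) b - run_length U ((g ^^ (n0 + n)) b)<..(g ^^ (n0 + n)) b} = {}"
      using R unfolding B_def by blast
    then show ?case using right_ends_step[OF g U inv D R[of "n0+n"] lt1[of "n0+n"]] Suc by auto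
  qed auto
  then have "(\<lambda>n. (g ^^ (n0 + n)) b) ` UNIV \<subseteq> {b \<in> right_ends U. run_length U b \<ge> ?l}"
    using R by auto
  then have "finite ((\<lambda>n. (g ^^ (n0 + n)) b) ` UNIV)"
    using finite_long_runs[OF U run_length(1)[OF U R]] finite_subset by blast
  moreover have "inj (\<lambda>n. (g ^^ (n0 + n)) b)" using inj unfolding inj_def by (metis add_left_cancel)
  ultimately show False using finite_imageD infinite_UNIV_nat by blast
qed

lemma IET_right: "g \<in> carrier IET \<Longrightarrow> x \<in> {0..<1} \<Longrightarrow> \<exists>e>0. \<forall>h. 0 \<le> h \<longrightarrow> h < e \<longrightarrow> g (x + h) = g x + h"
  using paff_right[OF IET_paff[of g "{0..<1}"], of x] by auto

section \<open>Bounded periods\<close>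

locale iet =
  fixes f :: "real \<Rightarrow> real"
  assumes fI: "f \<in> carrier IET"
begin

lemma fpow_inj: "(f ^^ n) x = (f ^^ n) y \<longleftrightarrow> x = y"
  using IET_inj[OF IET_funpow[OF fI]] .

lemma fpow_unit: "(f ^^ n) x \<in> {0..<1} \<longleftrightarrow> x \<in> {0..<1}"
  using IET_unit[OF IET_funpow[OF fI]] .

lemma fpow_finv: "(finv f ^^ n) ((f ^^ n) x) = x"
proof (induction n)
  case (Suc n)
  have "(finv f ^^ Suc n) ((f ^^ Suc n) x) = (finv f ^^ n) (finv f (f ((f ^^ n) x)))"
    by (simp add: funpow_swap1)
  then show ?case using Suc fI by simp
qed auto

lemma finv_fpow: "(f ^^ n) ((finv f ^^ n) x) = x"
proof (induction n)
  case (Suc n)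
  have "(f ^^ Suc n) ((finv f ^^ Suc n) x) = (f ^^ n) (f (finv f ((finv f ^^ n) x)))"
    by (simp add: funpow_swap1)
  then show ?case using Suc fI by simp
qed auto

lemma fpow_periodic: "(f ^^ n) x = x \<Longrightarrow> (f ^^ (n * k)) x = x"
  by (induction k) (auto simp: funpow_add)

lemma PerP_I: "x \<in> {0..<1} \<Longrightarrow> n > 0 \<Longrightarrow> (f ^^ n) x = x \<Longrightarrow> x \<in> PerP f"
  unfolding PerP_def by auto

text \<open>Shift the whole orbit left by \<open>e\<close>, the smallest distance of an orbit point
  to the break at or below it. No break is crossed on the way, so the shifted points follow the same
  itinerary with the same return times, and at least one of them is a break. Since 0 is a break, the
  shift stays inside the unit interval.\<close>

lemma periodic_hits_break:
  assumes D3: "breaks f D"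
    and x: "x \<in> PerP f"
  shows "\<exists>d \<in> D \<inter> PerP f. \<forall>n. (f ^^ n) d = d \<longleftrightarrow> (f ^^ n) x = x"
proof -
  note D = breaksD(1,2)[OF D3] D3
  obtain p where p: "p > 0" "(f ^^ p) x = x" "x \<in> {0..<1}" using x PerP_def by auto
  define Or where "Or = (\<lambda>i. (f ^^ i) x) ` {..<p}"
  have Or: "(f ^^ n) x \<in> Or" for n
    using funpow_mod_eq[OF p(2), of n] p(1) unfolding Or_def by (metis imageI lessThan_iff mod_less_divisor)
  have fOr: "finite Or" "Or \<noteq> {}" unfolding Or_def using p by auto
  define m where "m z = Max {d \<in> D. d \<le> z}" for z
  define e where "e = Min ((\<lambda>z. z - m z) ` Or)"
  have m: "m z \<in> D" "m z \<le> z" "\<And>d. d \<in> D \<Longrightarrow> d \<le> z \<Longrightarrow> d \<le> m z" if "z \<ge> 0" for z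
  proof -
    have "finite {d \<in> D. d \<le> z}" "{d \<in> D. d \<le> z} \<noteq> {}" using D that by auto
    from Max_in[OF this] Max_ge[OF this(1)] show "m z \<in> D" "m z \<le> z" "\<And>d. d \<in> D \<Longrightarrow> d \<le> z \<Longrightarrow> d \<le> m z"
      unfolding m_def by auto
  qed
  have e: "e \<le> z - m z" if "z \<in> Or" for z unfolding e_def using fOr that by auto
  have unit: "0 \<le> (f ^^ n) x" "(f ^^ n) x < 1" for n using fpow_unit[of n x] p(3) by auto
  have "e \<in> (\<lambda>z. z - m z) ` Or" unfolding e_def using fOr by (intro Min_in) auto
  then obtain i where i: "e = (f ^^ i) x - m ((f ^^ i) x)" unfolding Or_def by auto
  then have e0: "e \<ge> 0" using m unit by auto
  have sh: "(f ^^ n) (x - e) = (f ^^ n) x - e" for n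
  proof (induction n)
    case (Suc n)
    let ?z = "(f ^^ n) x"
    have ez: "e \<le> ?z - m ?z" using e Or by blast
    have "0 \<le> m ?z" using m(3)[of ?z 0] D unit by auto
    moreover have "D \<inter> {?z - e<..?z} = {}" using m(3)[of ?z] unit ez by force
    ultimately have "f ?z = f (?z - e) + (?z - (?z - e))" using unit ez e0 by (intro breaksD(3)[OF D(3)]) auto
    then show ?case using Suc by auto
  qed auto
  define d where "d = (f ^^ i) (x - e)"
  have d: "d = m ((f ^^ i) x)" unfolding d_def sh using i by auto
  have "d \<in> D" using d m unit by auto
  have eq: "(f ^^ n) d = d \<longleftrightarrow> (f ^^ n) x = x" for n
  proof -
    have "(f ^^ n) d = (f ^^ i) ((f ^^ n) (x - e))"
      unfolding d_def by (metis add.commute comp_apply funpow_add)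
    then show ?thesis unfolding d_def fpow_inj[of i] using sh[of n] fpow_inj by auto
  qed
  have "d \<ge> 0" "d < 1" using d m[OF unit(1)] D(2) unit[of i] by (auto intro: le_less_trans)
  then have "d \<in> PerP f" using eq p PerP_I by auto
  then show ?thesis using eq \<open>d \<in> D\<close> by blast
qed

lemma PerP_eq: "\<exists>N>0. PerP f = {x \<in> {0..<1}. (f ^^ N) x = x}"
proof -
  obtain D where D: "breaks f D" by (rule IET_breaks[OF fI])
  have "\<forall>d \<in> PerP f. \<exists>p>0. (f ^^ p) d = d" unfolding PerP_def by auto
  then obtain p where p: "\<And>d. d \<in> PerP f \<Longrightarrow> p d > 0 \<and> (f ^^ p d) d = d" by metis
  \<comment> \<open>A common multiple of periods of the finitely many periodic breaks. It works for
    all periodic points, as each has the return times of one of these breaks.\<close>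
  define N where "N = (\<Prod>d \<in> D \<inter> PerP f. p d)"
  have "N > 0" unfolding N_def using p by (auto intro!: prod_pos)
  moreover have "(f ^^ N) x = x" if x: "x \<in> PerP f" for x
  proof -
    obtain d where d: "d \<in> D \<inter> PerP f" "\<And>n. (f ^^ n) d = d \<longleftrightarrow> (f ^^ n) x = x"
      using periodic_hits_break[OF D x] by blast
    have "N = p d * (\<Prod>d \<in> D \<inter> PerP f - {d}. p d)" unfolding N_def using d breaksD(1)[OF D] by (subst prod.remove) auto
    then have "(f ^^ N) d = d" using p[of d] d(1) fpow_periodic by auto
    then show ?thesis using d(2) by auto
  qed
  ultimately show ?thesis using PerP_I by (intro exI[of _ N]) (auto simp: PerP_def)
qed

lemma hoi_fpow_fix: "hoi {x \<in> {0..<1}. (f ^^ n) x = x}"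
  by (rule hoi_filter[of "f ^^ n"]) (auto intro: IET_paff[OF IET_funpow[OF fI]])

section \<open>Invariant right-open subsets of the nonperiodic part\<close>

definition nonper :: "real set" where "nonper = {0..<1} - PerP f"

lemma hoi_PerP: "hoi (PerP f)"
  using PerP_eq hoi_fpow_fix by auto

lemma hoi_nonper: "hoi nonper"
  unfolding nonper_def using hoi_PerP by auto

lemma nonper_iff: "x \<in> nonper \<longleftrightarrow> x \<in> {0..<1} \<and> (\<forall>n>0. (f ^^ n) x \<noteq> x)"
  unfolding nonper_def PerP_def by blast

lemma f_unit: "f x \<in> {0..<1} \<longleftrightarrow> x \<in> {0..<1}"
  using IET_unit fI by blast

lemma nonper_f: "f x \<in> nonper \<longleftrightarrow> x \<in> nonper"
proof -
  have "(f ^^ n) (f x) = f x \<longleftrightarrow> (f ^^ n) x = x" for n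
    using IET_inj[OF fI] by (simp add: funpow_swap1[symmetric])
  then show ?thesis unfolding nonper_iff f_unit by blast
qed

lemma fpow_inv_set: "(\<And>x. f x \<in> U \<longleftrightarrow> x \<in> U) \<Longrightarrow> (f ^^ n) x \<in> U \<longleftrightarrow> x \<in> U"
  by (induction n) auto

lemma nonper_inj: "x \<in> nonper \<Longrightarrow> (f ^^ n) x = (f ^^ m) x \<Longrightarrow> n = m"
proof (induction n m rule: linorder_wlog)
  case (le n m)
  have "(f ^^ n) ((f ^^ (m - n)) x) = (f ^^ n) x"
    using le by (metis comp_apply funpow_add le_add_diff_inverse)
  then have "(f ^^ (m - n)) x = x" using fpow_inj by blast
  then have "\<not> m - n > 0" using le nonper_iff by blast
  then show ?case using le by auto
qed auto

lemma finite_invariant_empty: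
  assumes "finite Z" "Z \<subseteq> nonper" "\<And>z. z \<in> Z \<Longrightarrow> f z \<in> Z"
  shows "Z = {}"
proof (rule ccontr)
  assume "Z \<noteq> {}"
  then obtain z where z: "z \<in> Z" by auto
  have "(f ^^ n) z \<in> Z" for n using assms(3) z by (induction n) auto
  then have "(\<lambda>n. (f ^^ n) z) ` UNIV \<subseteq> Z" by auto
  moreover have "inj (\<lambda>n. (f ^^ n) z)" using nonper_inj z assms(2) by (auto intro!: injI)
  ultimately show False using assms(1) finite_imageD finite_subset infinite_UNIV_nat by blast
qed

text \<open>Iterating a nonperiodic right end forward must reach a run that meets a break, since
  otherwise its whole forward orbit would consist of right ends. There are finitely many such runs,
  and from each the backward path through right ends stops, by the same argument for the inverse.
  Right ends outside \<open>nonper\<close> are right ends of \<open>nonper\<close>, which is a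
  finite union of intervals.\<close>

lemma finite_right_ends:
  assumes U: "U \<subseteq> nonper" and inv: "\<And>x. f x \<in> U \<longleftrightarrow> x \<in> U"
  shows "finite (right_ends U)"
proof -
  let ?R = "right_ends U"
  have U1: "U \<subseteq> {0..<1}" using U nonper_def by auto
  obtain D where D: "breaks f D" by (rule IET_breaks[OF fI])
  define B where "B = {b \<in> ?R. D \<inter> {b - run_length U b<..b} \<noteq> {}}"
  have B: "finite B" using finite_runs_meeting[OF U1 breaksD(1)[OF D]] B_def by simp
  \<comment> \<open>The points that reach \<open>b'\<close> by a path running through right ends
    only.\<close>
  define Z where "Z b' = {b \<in> nonper. \<exists>n. (f ^^ n) b = b' \<and> (\<forall>i\<le>n. (f ^^ i) b \<in> ?R)}" for b'
  have "?R \<inter> nonper \<subseteq> (\<Union>b'\<in>B. Z b')"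
  proof
    fix b assume b: "b \<in> ?R \<inter> nonper"
    show "b \<in> (\<Union>b'\<in>B. Z b')"
    proof (rule ccontr)
      assume nb: "b \<notin> (\<Union>b'\<in>B. Z b')"
      have "\<forall>i\<le>n. (f ^^ i) b \<in> ?R" for n
      proof (induction n)
        case (Suc n)
        have "(f ^^ n) b \<notin> B" using nb b Suc unfolding Z_def by blast
        then have "D \<inter> {(f ^^ n) b - run_length U ((f ^^ n) b)<..(f ^^ n) b} = {}"
          using Suc unfolding B_def by blast
        moreover have "b \<in> {0..<1}" using b nonper_iff by blast
        then have "(f ^^ n) b < 1" using fpow_unit[of n b] by simp
        ultimately have "(f ^^ Suc n) b \<in> ?R"
          using right_ends_step[OF fI U1 inv D, of "(f ^^ n) b"] Suc by auto
        then show ?case using Suc by (auto simp: le_Suc_eq)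
      qed (use b in auto)
      moreover have "inj (\<lambda>n. (f ^^ n) b)" using nonper_inj b by (auto intro!: injI)
      ultimately show False using right_ends_no_infinite_orbit[OF fI U1 inv] by blast
    qed
  qed
  moreover have "finite (Z b')" if b': "b' \<in> B" for b'
  proof (rule ccontr)
    assume inf: "infinite (Z b')"
    then have "\<forall>b\<in>Z b'. \<exists>n. (f ^^ n) b = b' \<and> (\<forall>i\<le>n. (f ^^ i) b \<in> ?R)" unfolding Z_def by blast
    then obtain n where n: "\<And>b. b \<in> Z b' \<Longrightarrow> (f ^^ n b) b = b' \<and> (\<forall>i\<le>n b. (f ^^ i) b \<in> ?R)" by metis
    \<comment> \<open>The number of steps to \<open>b'\<close> determines the starting point, so an
      infinite \<open>Z b'\<close> contains arbitrarily long paths and all backward iterates of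
      \<open>b'\<close> are right ends.\<close>
    have "inj_on n (Z b')" using n fpow_inj by (metis inj_onI)
    then have infn: "infinite (n ` Z b')" using inf finite_imageD by blast
    obtain b0 where b0: "b0 \<in> Z b'" using inf by (metis ex_in_conv finite.emptyI)
    have np: "b' \<in> nonper" using b0 n[OF b0] fpow_inv_set[OF nonper_f] unfolding Z_def by blast
    have "(finv f ^^ m) b' \<in> ?R" for m
    proof -
      obtain b where b: "b \<in> Z b'" "m \<le> n b" using infn
        by (metis (no_types, lifting) finite_nat_set_iff_bounded imageE nat_le_linear not_less)
      have "b' = (f ^^ m) ((f ^^ (n b - m)) b)" using n[OF b(1)] b(2)
        by (metis comp_apply funpow_add le_add_diff_inverse)
      then have "(finv f ^^ m) b' = (f ^^ (n b - m)) b" using fpow_finv by auto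
      then show ?thesis using n[OF b(1)] by auto
    qed
    moreover have "inj (\<lambda>m. (finv f ^^ m) b')"
    proof (rule injI)
      fix i j assume eq: "(finv f ^^ i) b' = (finv f ^^ j) b'"
      have "(f ^^ (i + j)) ((finv f ^^ i) b') = (f ^^ j) b'"
        unfolding add.commute[of i j] by (simp add: funpow_add finv_fpow)
      moreover have "(f ^^ (i + j)) ((finv f ^^ j) b') = (f ^^ i) b'"
        by (simp add: funpow_add finv_fpow)
      ultimately show "i = j" using eq nonper_inj[OF np] by metis
    qed
    moreover have "finv f x \<in> U \<longleftrightarrow> x \<in> U" for x using inv[of "finv f x"] fI by auto
    ultimately show False using right_ends_no_infinite_orbit[OF IET_finv[OF fI] U1] by blast
  qed
  ultimately have "finite (?R \<inter> nonper)" using B finite_subset by blast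
  moreover have "?R - nonper \<subseteq> right_ends nonper" using U unfolding right_ends_def by blast
  then have "finite (?R - nonper)"
    using hoi_finite_right_ends[OF hoi_nonper] finite_subset unfolding right_ends_def by blast
  ultimately show ?thesis by (metis Un_Diff_Int finite_Un)
qed

text \<open>Finitely many right ends leave finitely many runs, but a run might lack its left end
  point. The nonperiodic points missing in this way form a finite forward invariant set, which is
  empty because nonperiodic orbits are infinite. Hence \<open>U\<close> is the union of its runs,
  each with its left end.\<close>

lemma invariant_right_open_hoi:
  assumes U: "U \<subseteq> nonper" and inv: "\<And>x. f x \<in> U \<longleftrightarrow> x \<in> U"
    and op: "\<And>u. u \<in> U \<Longrightarrow> \<exists>e>0. {u..<u+e} \<subseteq> U"
  shows "hoi U"
proof -
  let ?R = "right_ends U"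
  have U1: "U \<subseteq> {0..<1}" using U nonper_def by auto
  \<comment> \<open>Extends an interval in \<open>U\<close> to the right as far as possible; the
    limit point is a right end because \<open>U\<close>, being right-open, cannot contain
    it.\<close>
  have run: "\<exists>b\<in>?R. u < b \<and> b - run_length U b \<le> u" if u: "u < v" "{u<..<v} \<subseteq> U" for u v
  proof -
    define S where "S = {b. u < b \<and> {u<..<b} \<subseteq> U}"
    define b where "b = Sup S"
    have vS: "v \<in> S" using u S_def by auto
    have bdd: "bdd_above S"
    proof (rule bdd_aboveI[of _ 1])
      fix x assume x: "x \<in> S"
      show "x \<le> 1"
      proof (rule ccontr)
        assume "\<not> x \<le> 1"
        then have "(max u 1 + x)/2 \<in> {u<..<x}" using x S_def by (auto simp: max_def)
        moreover have "{u<..<x} \<subseteq> {0..<1}" using x U1 unfolding S_def by blast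
        ultimately have "(max u 1 + x)/2 \<in> {0..<1}" by blast
        then have "(max u 1 + x)/2 < 1" by simp
        then show False using \<open>\<not> x \<le> 1\<close> by (auto simp: max_def split: if_splits)
      qed
    qed
    have bv: "v \<le> b" unfolding b_def using vS bdd by (rule cSup_upper)
    have sub: "{u<..<b} \<subseteq> U"
    proof
      fix x assume x: "x \<in> {u<..<b}"
      then have "x < Sup S" using b_def by auto
      then obtain w where "w \<in> S" "x < w" by (rule less_cSupE) (use vS in auto)
      then show "x \<in> U" using x unfolding S_def by auto
    qed
    have "b \<notin> U"
    proof
      assume "b \<in> U"
      then obtain e where e: "e > 0" "{b..<b+e} \<subseteq> U" using op by blast
      have "{u<..<b+e} \<subseteq> {u<..<b} \<union> {b..<b+e}" by auto
      then have "b + e \<in> S" unfolding S_def using sub e bv u by auto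
      then have "b + e \<le> b" unfolding b_def using bdd by (intro cSup_upper)
      then show False using e by auto
    qed
    then have "b \<in> ?R" unfolding right_ends_def using sub bv u by (auto intro!: exI[of _ "b - u"])
    moreover have "b - u \<le> run_length U b" using run_length_ge[OF U1 calculation, of "b - u"] sub by auto
    ultimately show ?thesis using bv u by (intro bexI[of _ b]) auto
  qed
  define Z where "Z = {z \<in> nonper - U. \<exists>e>0. {z<..<z+e} \<subseteq> U}"
  have fZ: "finite Z"
  proof -
    have "Z \<subseteq> (\<lambda>b. b - run_length U b) ` ?R"
    proof
      fix z assume z: "z \<in> Z"
      then obtain e where e: "e > 0" "{z<..<z+e} \<subseteq> U" unfolding Z_def by auto
      obtain b where b: "b \<in> ?R" "z < b" "b - run_length U b \<le> z" using run[of z "z+e"] e by auto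
      have "z \<notin> {b - run_length U b<..<b}" using z run_length(2)[OF U1 b(1)] unfolding Z_def by auto
      then have "z = b - run_length U b" using b by auto
      then show "z \<in> (\<lambda>b. b - run_length U b) ` ?R" using b(1) by blast
    qed
    then show ?thesis using finite_right_ends[OF U inv] finite_subset by blast
  qed
  have "Z = {}"
  proof (rule finite_invariant_empty[OF fZ])
    fix z assume z: "z \<in> Z"
    then obtain e where e: "e > 0" "{z<..<z+e} \<subseteq> U" unfolding Z_def by auto
    have "z \<in> {0..<1}" using z Z_def nonper_def by auto
    then obtain d where d: "d > 0" "\<And>h. 0 \<le> h \<Longrightarrow> h < d \<Longrightarrow> f (z + h) = f z + h" using IET_right[OF fI] by metis
    have "{f z<..<f z + min d e} \<subseteq> U"
    proof
      fix y assume y: "y \<in> {f z<..<f z + min d e}"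
      have "z + (y - f z) \<in> U" using y e by auto
      then have "f (z + (y - f z)) \<in> U" using inv by auto
      then show "y \<in> U" using d(2)[of "y - f z"] y by auto
    qed
    moreover have "f z \<in> nonper - U" using z inv nonper_f unfolding Z_def by auto
    ultimately show "f z \<in> Z" unfolding Z_def using d(1) e(1) by (auto intro!: exI[of _ "min d e"])
  qed (auto simp: Z_def)
  have "U = (\<Union>b\<in>?R. {b - run_length U b..<b})"
  proof
    show "U \<subseteq> (\<Union>b\<in>?R. {b - run_length U b..<b})"
    proof
      fix u assume "u \<in> U"
      then obtain e where "e > 0" "{u..<u+e} \<subseteq> U" using op by blast
      then have "{u<..<u+e} \<subseteq> U" by auto
      then obtain b where "b\<in>?R" "u < b" "b - run_length U b \<le> u" using run[of u "u+e"] \<open>e > 0\<close> by auto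
      then show "u \<in> (\<Union>b\<in>?R. {b - run_length U b..<b})" by auto
    qed
    show "(\<Union>b\<in>?R. {b - run_length U b..<b}) \<subseteq> U"
    proof
      fix x assume "x \<in> (\<Union>b\<in>?R. {b - run_length U b..<b})"
      then obtain b where b: "b \<in> ?R" "b - run_length U b \<le> x" "x < b" by auto
      note r = run_length[OF U1 b(1)]
      show "x \<in> U"
      proof (rule ccontr)
        assume nx: "x \<notin> U"
        then have x: "x = b - run_length U b" using r b by force
        have sub: "{x<..<x + run_length U b} \<subseteq> U" using r x by auto
        \<comment> \<open>A point outside \<open>nonper\<close> has a right neighbourhood outside as
          well, whereas immediately to the right of \<open>x\<close> there is a run of
          \<open>U\<close>.\<close>
        have "x \<in> nonper"
        proof (rule ccontr)
          assume "x \<notin> nonper"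
          then obtain e where e: "e > 0" "{x..<x+e} \<inter> nonper = {}" using hoi_right_out[OF hoi_nonper] by blast
          have "x + min e (run_length U b) / 2 \<in> {x..<x+e} \<inter> {x<..<x + run_length U b}"
            using e r(1) by (auto simp: min_def)
          then show False using e sub U by blast
        qed
        then have "x \<in> Z" unfolding Z_def using nx sub r(1) by auto
        then show False using \<open>Z = {}\<close> by auto
      qed
    qed
  qed
  moreover have "hoi (\<Union>b\<in>?R. {b - run_length U b..<b})"
    using finite_right_ends[OF U inv] by (intro hoi_UN) auto
  ultimately show ?thesis by simp
qed


section \<open>Right closures of orbits are the minimal components\<close>

definition orb :: "real \<Rightarrow> real \<Rightarrow> bool" where
  "orb x y \<longleftrightarrow> (\<exists>m n. (f ^^ m) x = (f ^^ n) y)"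

lemma orb_refl [simp]: "orb x x"
  unfolding orb_def by blast

lemma orb_sym: "orb x y \<Longrightarrow> orb y x"
  unfolding orb_def by metis

lemma orb_trans: "orb x y \<Longrightarrow> orb y z \<Longrightarrow> orb x z"
  unfolding orb_def
proof (elim exE)
  fix m n k l assume a: "(f ^^ m) x = (f ^^ n) y" "(f ^^ k) y = (f ^^ l) z"
  have "(f ^^ (k + m)) x = (f ^^ (k + n)) y" using a by (simp add: funpow_add)
  also have "\<dots> = (f ^^ (n + l)) z" unfolding add.commute[of k n] using a by (simp add: funpow_add)
  finally show "\<exists>m n. (f ^^ m) x = (f ^^ n) z" by blast
qed

lemma orb_f [simp]: "orb x (f y) \<longleftrightarrow> orb x y"
proof -
  have "orb y (f y)" unfolding orb_def by (intro exI[of _ 1] exI[of _ 0]) simp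
  then show ?thesis using orb_trans orb_sym by blast
qed

lemma orb_invariant: "(\<And>x. f x \<in> U \<longleftrightarrow> x \<in> U) \<Longrightarrow> orb x y \<Longrightarrow> x \<in> U \<longleftrightarrow> y \<in> U"
  unfolding orb_def using fpow_inv_set by metis

lemma orb_cases: "orb x y \<Longrightarrow> (\<exists>n. y = (f ^^ n) x) \<or> (\<exists>n. x = (f ^^ n) y)"
  unfolding orb_def
proof (elim exE)
  fix m n assume a: "(f ^^ m) x = (f ^^ n) y"
  show ?thesis
  proof (cases "m \<le> n")
    case True
    then have "(f ^^ m) x = (f ^^ m) ((f ^^ (n - m)) y)"
      using a by (metis comp_apply funpow_add le_add_diff_inverse)
    then show ?thesis using fpow_inj by blast
  next
    case False
    then have "(f ^^ n) y = (f ^^ n) ((f ^^ (m - n)) x)"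
      using a by (metis comp_apply funpow_add le_add_diff_inverse nat_le_linear)
    then show ?thesis using fpow_inj by blast
  qed
qed

lemma full_orbit_iff: "y \<in> full_orbit f x \<longleftrightarrow> orb x y"
proof
  assume "orb x y"
  then show "y \<in> full_orbit f x"
    using orb_cases[of x y] fpow_finv[symmetric, of y] unfolding full_orbit_def by blast
next
  assume "y \<in> full_orbit f x"
  then consider n where "y = (f ^^ n) x" | n where "y = (finv f ^^ n) x" unfolding full_orbit_def by auto
  then show "orb x y"
  proof cases
    case 1
    then show ?thesis unfolding orb_def by (intro exI[of _ n] exI[of _ 0]) simp
  next
    case 2
    then have "(f ^^ n) y = x" using finv_fpow by simp
    then show ?thesis unfolding orb_def by (intro exI[of _ 0] exI[of _ n]) simp
  qed
qed

text \<open>Approximation is from the right only, because every interval exchange is a translation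
  on a right neighbourhood of each point. The ordinary closure would add points that are approached
  only from the left.\<close>

definition rcl :: "real \<Rightarrow> real set" where
  "rcl x = {y \<in> nonper. \<forall>e>0. \<exists>z\<in>{y..<y+e}. orb x z}"

lemma rcl_nonper: "rcl x \<subseteq> nonper" unfolding rcl_def by auto

lemma rcl_self: "x \<in> nonper \<Longrightarrow> x \<in> rcl x"
  unfolding rcl_def by (auto intro!: bexI[of _ x])

lemma centralizer_orb: "g \<in> centralizer f \<Longrightarrow> orb (g x) (g y) \<longleftrightarrow> orb x y"
  unfolding orb_def by (simp add: centralizer_funpow IET_inj[of g] centralizer_iff)

lemma centralizer_nonper:
  assumes g: "g \<in> centralizer f" shows "g x \<in> nonper \<longleftrightarrow> x \<in> nonper"
proof -
  have "g \<in> carrier IET" using g centralizer_iff by auto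
  then show ?thesis
    unfolding nonper_iff by (simp add: centralizer_funpow[OF g] IET_inj IET_unit del: atLeastLessThan_iff)
qed

lemma centralizer_rcl:
  assumes g: "g \<in> centralizer f" shows "g y \<in> rcl (g x) \<longleftrightarrow> y \<in> rcl x"
proof (cases "y \<in> nonper")
  case False
  then show ?thesis using centralizer_nonper[OF g] rcl_nonper by blast
next
  case True
  have "g \<in> carrier IET" using g centralizer_iff by auto
  then obtain d where d: "d > 0" "\<And>h. 0 \<le> h \<Longrightarrow> h < d \<Longrightarrow> g (y + h) = g y + h"
    using IET_right[of g y] True nonper_iff by blast
  have eq: "orb (g x) (g y + h) \<longleftrightarrow> orb x (y + h)" if "0 \<le> h" "h < d" for h
    using d(2)[OF that] centralizer_orb[OF g] by metis
  have small: "(\<forall>e>0. \<exists>z\<in>{w..<w+e}. orb v z) \<longleftrightarrow> (\<forall>e>0. \<exists>h. 0 \<le> h \<and> h < min e d \<and> orb v (w + h))" for w v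
  proof (intro iffI allI impI)
    fix e :: real assume a: "\<forall>e>0. \<exists>z\<in>{w..<w+e}. orb v z" "e > 0"
    then obtain z where z: "z \<in> {w..<w + min e d}" "orb v z" using d(1) by (meson min_less_iff_conj)
    then show "\<exists>h. 0 \<le> h \<and> h < min e d \<and> orb v (w + h)"
      by (intro exI[of _ "z - w"]) auto
  next
    fix e :: real assume a: "\<forall>e>0. \<exists>h. 0 \<le> h \<and> h < min e d \<and> orb v (w + h)" "e > 0"
    then obtain h where "0 \<le> h" "h < min e d" "orb v (w + h)" by blast
    then show "\<exists>z\<in>{w..<w+e}. orb v z" by (intro bexI[of _ "w + h"]) auto
  qed
  show ?thesis
    unfolding rcl_def mem_Collect_eq small centralizer_nonper[OF g] using eq by (metis min_less_iff_conj)
qed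

lemma f_cent: "f \<in> centralizer f" using fI by (simp add: centralizer_iff)

lemma rcl_orb: "orb x x' \<Longrightarrow> rcl x = rcl x'"
  unfolding rcl_def using orb_trans orb_sym by blast

lemma rcl_f: "f y \<in> rcl x \<longleftrightarrow> y \<in> rcl x"
  using centralizer_rcl[OF f_cent, of y x] rcl_orb[of x "f x"] by auto

text \<open>It is the complement in \<open>nonper\<close> that is visibly right-open, so the
  interval description is obtained for the complement first. Right-openness of \<open>rcl x\<close>
  itself is then a consequence.\<close>

lemma hoi_rcl: "hoi (rcl x)"
proof -
  have "hoi (nonper - rcl x)"
  proof (rule invariant_right_open_hoi)
    show "f y \<in> nonper - rcl x \<longleftrightarrow> y \<in> nonper - rcl x" for y using rcl_f nonper_f by auto
    fix u assume u: "u \<in> nonper - rcl x"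
    then obtain e where e: "e > 0" "\<And>z. z \<in> {u..<u+e} \<Longrightarrow> \<not> orb x z" unfolding rcl_def by blast
    obtain d where d: "d > 0" "{u..<u+d} \<subseteq> nonper" using hoi_right_in[OF hoi_nonper] u by blast
    have "v \<notin> rcl x" if v: "v \<in> {u..<u+min d e}" for v
    proof
      assume "v \<in> rcl x"
      moreover have "u + min d e - v > 0" using v by auto
      ultimately obtain z where z: "z \<in> {v..<v + (u + min d e - v)}" "orb x z" unfolding rcl_def by blast
      then have "z \<in> {u..<u+e}" using v by auto
      then show False using e z by blast
    qed
    moreover have "{u..<u+min d e} \<subseteq> {u..<u+d}" by auto
    ultimately have "{u..<u+min d e} \<subseteq> nonper - rcl x" using d(2) by blast
    then show "\<exists>e>0. {u..<u+e} \<subseteq> nonper - rcl x"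
      using d(1) e(1) by (intro exI[of _ "min d e"]) auto
  qed auto
  then have "hoi (nonper - (nonper - rcl x))" using hoi_Diff[OF hoi_nonper] by blast
  moreover have eq: "nonper - (nonper - rcl x) = rcl x" using rcl_nonper by blast
  ultimately show ?thesis unfolding eq by simp
qed

lemma rcl_mono: assumes "y \<in> rcl x" shows "rcl y \<subseteq> rcl x"
proof
  fix w assume w: "w \<in> rcl y"
  have "\<exists>z\<in>{w..<w+e}. orb x z" if e: "e > 0" for e
  proof -
    obtain z where z: "z \<in> {w..<w+e}" "orb y z" using w e unfolding rcl_def by blast
    then have "z \<in> rcl x" using orb_invariant[OF rcl_f] assms by blast
    moreover have "w + e - z > 0" using z by auto
    ultimately obtain z' where "z' \<in> {z..<z+(w + e - z)}" "orb x z'" unfolding rcl_def by blast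
    then show ?thesis using z by (intro bexI[of _ z']) auto
  qed
  then show "w \<in> rcl x" using w unfolding rcl_def by blast
qed

text \<open>Symmetry comes from right-openness: \<open>rcl y\<close> contains an interval starting
  at \<open>y\<close>, the orbit of \<open>x\<close> enters it, and invariance brings
  \<open>x\<close> into \<open>rcl y\<close>.\<close>

lemma rcl_eq: assumes "y \<in> rcl x" shows "rcl y = rcl x"
proof -
  have "y \<in> rcl y" using assms rcl_nonper rcl_self by blast
  then obtain e where e: "e > 0" "{y..<y+e} \<subseteq> rcl y" using hoi_right_in[OF hoi_rcl] by blast
  then obtain z where "z \<in> {y..<y+e}" "orb x z" using assms unfolding rcl_def by blast
  then have "x \<in> rcl y" using e orb_invariant[OF rcl_f] by blast
  then show ?thesis using rcl_mono assms by blast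
qed

end

lemma hoi_nat: "hoi J \<longleftrightarrow> (\<exists>(a::nat \<Rightarrow> real) b n. J = (\<Union>i<n. {a i..<b i}))"
proof
  assume "hoi J"
  then obtain P where P: "finite P" "J = (\<Union>(a,b)\<in>P. {a..<b})" using hoi_def by auto
  obtain h where "bij_betw h {0..<card P} P" using ex_bij_betw_nat_finite[OF P(1)] by blast
  then have "P = h ` {..<card P}" by (metis bij_betw_imp_surj_on lessThan_atLeast0)
  then obtain n where "P = h ` {..<n}" by (rule that)
  then have "J = (\<Union>i<n. {fst (h i)..<snd (h i)})" unfolding P(2) by (simp add: split_beta)
  then show "\<exists>(a::nat \<Rightarrow> real) b n. J = (\<Union>i<n. {a i..<b i})"
    by (intro exI[of _ "\<lambda>i. fst (h i)"] exI[of _ "\<lambda>i. snd (h i)"] exI[of _ n])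
next
  assume "\<exists>(a::nat \<Rightarrow> real) b n. J = (\<Union>i<n. {a i..<b i})"
  then show "hoi J" by (auto intro!: hoi_UN)
qed

lemma hoi_Inf:
  assumes "hoi J" "J \<noteq> {}" "bdd_below J" shows "Inf J \<in> J"
proof (rule ccontr)
  assume "Inf J \<notin> J"
  then obtain e where e: "e > 0" "{Inf J..<Inf J+e} \<inter> J = {}" using hoi_right_out[OF assms(1)] by blast
  then obtain x where "x \<in> J" "x < Inf J + e" using assms cInf_lessD[of J "Inf J + e"] by auto
  then show False using e cInf_lower[OF _ assms(3)] by (metis IntI atLeastLessThan_iff empty_iff)
qed

lemma breaks_left:
  assumes D: "breaks g D" and x: "x \<in> {0..<1}" "x \<notin> D"
  shows "\<exists>e>0. \<forall>t. 0 \<le> t \<longrightarrow> t < e \<longrightarrow> 0 \<le> x - t \<and> g (x - t) = g x - t"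
proof -
  note d = breaksD[OF D]
  define m where "m = Max {d \<in> D. d < x}"
  have "0 \<in> {d \<in> D. d < x}" using d(2) x by (cases "x = 0") auto
  then have "m \<in> {d \<in> D. d < x}" unfolding m_def using d(1) by (intro Max_in) auto
  moreover have m3: "d \<le> m" if "d \<in> D" "d < x" for d
    unfolding m_def using d(1) that by (intro Max_ge) auto
  ultimately have m: "m < x" "m \<ge> 0" "\<And>d. d \<in> D \<Longrightarrow> d < x \<Longrightarrow> d \<le> m"
    using \<open>0 \<in> {d \<in> D. d < x}\<close> by auto
  show ?thesis
  proof (intro exI[of _ "x - m"] conjI allI impI)
    fix t assume t: "0 \<le> t" "t < x - m"
    show t0: "0 \<le> x - t" using m t by auto
    have "D \<inter> {x - t<..x} = {}" using m(3) x(2) t by force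
    then have "g x = g (x - t) + (x - (x - t))" using t x t0 by (intro d(3)) auto
    then show "g (x - t) = g x - t" by auto
  qed (use m in auto)
qed

context iet begin

lemma rcl_min_comp: assumes "x \<in> nonper" shows "min_comp f (rcl x)"
  unfolding min_comp_def
proof (intro conjI ballI)
  show "rcl x \<noteq> {}" using rcl_self assms by blast
  show "rcl x \<subseteq> {0..<1}" using rcl_nonper nonper_def by blast
  show "\<exists>(a::nat \<Rightarrow> real) b n. rcl x = (\<Union>i<n. {a i..<b i})" using hoi_rcl hoi_nat by blast
  have "finv f y \<in> rcl x" if "y \<in> rcl x" for y using rcl_f[of "finv f y"] fI that by auto
  then show "f ` rcl x = rcl x" using rcl_f fI by (metis IET_finv_right image_subset_iff imageI subsetI subset_antisym)
  fix y assume y: "y \<in> rcl x"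
  show "rcl x \<subseteq> closure (full_orbit f y)"
  proof
    fix z assume "z \<in> rcl x"
    then have "z \<in> rcl y" using rcl_eq y by blast
    show "z \<in> closure (full_orbit f y)"
      unfolding closure_approachable
    proof (intro allI impI)
      fix e :: real assume "e > 0"
      then obtain w where "w \<in> {z..<z+e}" "orb y w" using \<open>z \<in> rcl y\<close> unfolding rcl_def by blast
      then show "\<exists>w\<in>full_orbit f y. dist w z < e"
        by (intro bexI[of _ w]) (auto simp: full_orbit_iff dist_real_def)
    qed
  qed
qed

text \<open>Two-sided density becomes density from the right by approximating the midpoint of a
  short interval of \<open>J\<close> that starts at \<open>y\<close>. A periodic point has a finite
  orbit, and the space between it and the next orbit point on its right contradicts this
  density.\<close>

lemma min_comp_nonper_dense:
  assumes J: "min_comp f J" "x \<in> J"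
  shows "x \<in> nonper" "y \<in> J \<Longrightarrow> e > 0 \<Longrightarrow> \<exists>z\<in>{y..<y+e}. orb x z"
proof -
  have J': "J \<subseteq> {0..<1}" "hoi J" "f ` J = J" "\<And>x. x \<in> J \<Longrightarrow> J \<subseteq> closure (full_orbit f x)"
    using J hoi_nat unfolding min_comp_def by blast+
  show dense: "\<exists>z\<in>{y..<y+e}. orb x z" if y: "y \<in> J" and e: "e > 0" for y e
  proof -
    obtain d where d: "d > 0" "{y..<y+d} \<subseteq> J" using hoi_right_in[OF J'(2) y] by blast
    define m where "m = min d e / 2"
    have m: "m > 0" "y + m \<in> J" "2 * m \<le> e" unfolding m_def using d e by auto
    then have "y + m \<in> closure (full_orbit f x)" using J'(4) J(2) by blast
    then obtain z where "z \<in> full_orbit f x" "dist z (y + m) < m"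
      using closure_approachable m(1) by blast
    then show ?thesis using m full_orbit_iff by (intro bexI[of _ z]) (auto simp: dist_real_def)
  qed
  show "x \<in> nonper"
  proof (rule ccontr)
    assume "x \<notin> nonper"
    then obtain p where p: "p > 0" "(f ^^ p) x = x" using J'(1) J(2) nonper_iff by blast
    define Or where "Or = (\<lambda>i. (f ^^ i) x) ` {..<p}"
    have Or: "(f ^^ n) x \<in> Or" for n
      using funpow_mod_eq[OF p(2), of n] p(1) unfolding Or_def by (metis imageI lessThan_iff mod_less_divisor)
    have orbOr: "z \<in> Or" if z: "orb x z" for z
    proof -
      consider n where "z = (f ^^ n) x" | n where "x = (f ^^ n) z" using orb_cases[OF z] by blast
      then show ?thesis
      proof cases
        case 2
        \<comment> \<open>A backward iterate of a periodic point is a forward iterate: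
          \<open>z\<close> is reached from \<open>x\<close> in \<open>(p - 1) * n\<close>
          steps.\<close>
        have "(f ^^ (p * n)) x = x" using fpow_periodic p by blast
        moreover have "p * n = n + (p - 1) * n" using p by (cases p) auto
        ultimately have "(f ^^ n) ((f ^^ ((p-1)*n)) x) = (f ^^ n) z" using 2 by (simp add: funpow_add)
        then show ?thesis using fpow_inj Or by metis
      qed (use Or in auto)
    qed
    have fin: "finite Or" unfolding Or_def by auto
    define q where "q = Min (insert (x+1) {z \<in> Or. z > x})"
    have q: "q > x" unfolding q_def using fin by auto
    obtain d where d: "d > 0" "{x..<x+d} \<subseteq> J" using hoi_right_in[OF J'(2) J(2)] by blast
    define h where "h = min d (q - x) / 2"
    have h: "h > 0" "x + h \<in> J" "x + h + h \<le> q" unfolding h_def using d q by auto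
    obtain z where z: "z \<in> {x+h..<x+h+h}" "orb x z" using dense[OF h(2) h(1)] by blast
    then have "z \<in> insert (x+1) {z \<in> Or. z > x}" using orbOr h by auto
    then have "q \<le> z" unfolding q_def using fin by (intro Min_le) auto
    then show False using z h by auto
  qed
qed

lemma min_comp_rcl: assumes J: "min_comp f J" "x \<in> J" shows "x \<in> nonper \<and> J = rcl x"
proof -
  have J': "J \<subseteq> {0..<1}" "hoi J" "f ` J = J" using J hoi_nat unfolding min_comp_def by blast+
  have Jf: "f y \<in> J \<longleftrightarrow> y \<in> J" for y using J'(3) IET_inj[OF fI] by (metis imageE imageI)
  have np: "x \<in> nonper" using min_comp_nonper_dense[OF J] by blast
  have "J \<subseteq> rcl x" unfolding rcl_def using min_comp_nonper_dense[OF J] min_comp_nonper_dense(1)[OF J(1)] by blast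
  moreover have "rcl x \<subseteq> J"
  proof
    fix z assume z: "z \<in> rcl x"
    show "z \<in> J"
    proof (rule ccontr)
      assume "z \<notin> J"
      then obtain e where e: "e > 0" "{z..<z+e} \<inter> J = {}" using hoi_right_out[OF J'(2)] by blast
      then obtain w where "w \<in> {z..<z+e}" "orb x w" using z unfolding rcl_def by blast
      then show False using e orb_invariant[OF Jf] J(2) by blast
    qed
  qed
  ultimately show ?thesis using np by blast
qed

lemma min_comps_eq: "min_comps f = rcl ` nonper"
proof
  show "min_comps f \<subseteq> rcl ` nonper"
  proof
    fix J assume "J \<in> min_comps f"
    then have J: "min_comp f J" unfolding min_comps_def by simp
    then obtain x where "x \<in> J" unfolding min_comp_def by blast
    then show "J \<in> rcl ` nonper" using min_comp_rcl[OF J] by blast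
  qed
  show "rcl ` nonper \<subseteq> min_comps f" using rcl_min_comp unfolding min_comps_def by blast
qed

lemma min_comps_hoi: "J \<in> min_comps f \<Longrightarrow> hoi J"
  using min_comps_eq hoi_rcl by auto

lemma min_comps_ne: "J \<in> min_comps f \<Longrightarrow> J \<noteq> {}"
  using min_comps_eq rcl_self by auto

lemma min_comps_f: "J \<in> min_comps f \<Longrightarrow> f x \<in> J \<longleftrightarrow> x \<in> J"
  using min_comps_eq rcl_f by auto

lemma min_comps_nonper: "J \<in> min_comps f \<Longrightarrow> J \<subseteq> nonper"
  using min_comps_eq rcl_nonper by auto

lemma min_comps_unit: "J \<in> min_comps f \<Longrightarrow> J \<subseteq> {0..<1}"
  using min_comps_nonper nonper_def by blast

lemma min_comps_Union: "\<Union>(min_comps f) = nonper"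
  using min_comps_eq rcl_self rcl_nonper by blast

lemma min_comps_disj: "J \<in> min_comps f \<Longrightarrow> J' \<in> min_comps f \<Longrightarrow> x \<in> J \<Longrightarrow> x \<in> J' \<Longrightarrow> J = J'"
  using min_comps_eq rcl_eq by (metis imageE)

lemma min_comps_dense:
  assumes "J \<in> min_comps f" "x \<in> J" "y \<in> J" "e > 0" shows "\<exists>z\<in>{y..<y+e}. orb x z"
  using min_comp_nonper_dense(2) assms unfolding min_comps_def by blast

text \<open>Without a break in \<open>J\<close>, \<open>f\<close> would be a translation on the left
  of each point of \<open>J\<close> too, so the finite set \<open>L\<close> of left boundary points
  would be forward invariant and hence empty; yet the infimum of \<open>J\<close> belongs to it. As
  components are disjoint, there are at most as many of them as breaks.\<close>

lemma min_comps_meet_breaks: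
  assumes D: "breaks f D" and J: "J \<in> min_comps f"
  shows "J \<inter> D \<noteq> {}"
proof
  assume JD: "J \<inter> D = {}"
  define L where "L = {x \<in> J. \<exists>e>0. {x-e<..<x} \<inter> J = {}}"
  have J1: "J \<subseteq> {0..<1}" "hoi J" "J \<noteq> {}" using min_comps_unit min_comps_hoi min_comps_ne J by auto
  \<comment> \<open>The complement is taken in \<open>[-1, 1)\<close> so that 0, if it is in
    \<open>L\<close>, has a left neighbourhood in the complement as well.\<close>
  have "L \<subseteq> {b. b \<notin> {-1..<1} - J \<and> (\<exists>e>0. {b-e<..<b} \<subseteq> {-1..<1} - J)}"
  proof
    fix x assume x: "x \<in> L"
    then obtain e where e: "e > 0" "{x-e<..<x} \<inter> J = {}" and xJ: "x \<in> J" unfolding L_def by auto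
    have "x \<in> {0..<1}" using xJ J1 by blast
    then have "{x - min e 1<..<x} \<subseteq> {-1..<1}" by auto
    moreover have "{x - min e 1<..<x} \<subseteq> {x-e<..<x}" by auto
    ultimately have "{x - min e 1<..<x} \<subseteq> {-1..<1} - J" using e(2) by blast
    moreover have "min e 1 > 0" using e by auto
    ultimately show "x \<in> {b. b \<notin> {-1..<1} - J \<and> (\<exists>e>0. {b-e<..<b} \<subseteq> {-1..<1} - J)}" using xJ by blast
  qed
  then have fin: "finite L"
    by (rule finite_subset) (rule hoi_finite_right_ends, use J1 in simp)
  have bdd: "bdd_below J" using J1(1) by (intro bdd_belowI[of _ 0]) auto
  have "L = {}"
  proof (rule finite_invariant_empty[OF fin])
    show "L \<subseteq> nonper" using min_comps_nonper[OF J] unfolding L_def by blast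
    fix x assume x: "x \<in> L"
    then obtain e where e: "e > 0" "{x-e<..<x} \<inter> J = {}" and xJ: "x \<in> J" unfolding L_def by auto
    obtain d where d: "d > 0" "\<And>t. 0 \<le> t \<Longrightarrow> t < d \<Longrightarrow> f (x - t) = f x - t"
      using breaks_left[OF D, of x] xJ JD J1(1) by blast
    have "y \<notin> J" if y: "y \<in> {f x - min d e<..<f x}" for y
    proof -
      have "y = f (x - (f x - y))" using d(2)[of "f x - y"] y by auto
      moreover have "x - (f x - y) \<in> {x-e<..<x}" using y by auto
      then have "x - (f x - y) \<notin> J" using e by blast
      ultimately show ?thesis using min_comps_f[OF J] by metis
    qed
    then have "{f x - min d e<..<f x} \<inter> J = {}" by blast
    moreover have "min d e > 0" "f x \<in> J" using d e xJ min_comps_f[OF J] by auto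
    ultimately show "f x \<in> L" unfolding L_def by blast
  qed
  moreover have "Inf J \<in> L"
  proof -
    have "{Inf J - 1<..<Inf J} \<inter> J = {}" using cInf_lower[OF _ bdd] by fastforce
    then show ?thesis unfolding L_def using hoi_Inf[OF J1(2,3) bdd] zero_less_one by blast
  qed
  ultimately show False by blast
qed

lemma finite_min_comps: "finite (min_comps f)"
proof -
  obtain D where D: "breaks f D" by (rule IET_breaks[OF fI])
  have "\<forall>J\<in>min_comps f. \<exists>d. d \<in> J \<inter> D" using min_comps_meet_breaks[OF D] by blast
  then obtain d where d: "\<And>J. J \<in> min_comps f \<Longrightarrow> d J \<in> J \<inter> D" by metis
  have "inj_on d (min_comps f)" using d min_comps_disj by (metis IntD1 inj_onI)
  moreover have "d ` min_comps f \<subseteq> D" using d by blast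
  ultimately show ?thesis using breaksD(1)[OF D] finite_imageD finite_subset by blast
qed

lemma centralizer_min_comp:
  assumes g: "g \<in> centralizer f" and J: "J \<in> min_comps f"
  shows "g ` J \<in> min_comps f"
proof -
  obtain x where x: "x \<in> nonper" "J = rcl x" using J min_comps_eq by auto
  have gI: "g \<in> carrier IET" using g centralizer_iff by auto
  have "g ` rcl x = rcl (g x)"
  proof
    show "g ` rcl x \<subseteq> rcl (g x)" using centralizer_rcl[OF g] by blast
    show "rcl (g x) \<subseteq> g ` rcl x"
    proof
      fix y assume "y \<in> rcl (g x)"
      then have "finv g y \<in> rcl x" using centralizer_rcl[OF g, of "finv g y" x] gI by simp
      then show "y \<in> g ` rcl x" using gI by (metis IET_finv_right imageI)
    qed
  qed
  then show ?thesis using x centralizer_nonper[OF g] min_comps_eq by auto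
qed

lemma restrict_centralizer:
  assumes W: "hoi W" "W \<subseteq> {0..<1}" and fW: "\<And>x. f x \<in> W \<longleftrightarrow> x \<in> W"
    and g: "g \<in> centralizer f" and gW: "\<And>x. g x \<in> W \<longleftrightarrow> x \<in> W"
  shows "(\<lambda>x. if x \<in> W then g x else x) \<in> centralizer f \<inter> E_supp W" (is "?h \<in> _")
proof -
  have gI: "g \<in> carrier IET" and gc: "\<And>x. f (g x) = g (f x)" using g centralizer_iff by auto
  have "?h \<in> carrier IET"
  proof (rule glue_IET[where I="{()}" and W="\<lambda>_. W" and \<pi>=id])
    have "bij_betw ?h W W"
    proof (rule bij_betw_byWitness[where f'="finv g"])
      have "finv g x \<in> W" if "x \<in> W" for x using gW[of "finv g x"] gI that by simp
      then show "finv g ` W \<subseteq> W" "\<forall>x\<in>W. ?h (finv g x) = x" using gI by auto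
      show "?h ` W \<subseteq> W" using gW by auto
    qed (use gI in simp)
    moreover have "paff 1 ?h W" by (rule paff_cong[OF IET_paff[OF gI W]]) simp
    ultimately show "W \<subseteq> {0..<1} \<and> bij_betw ?h W (W) \<and> paff 1 ?h W" using W by blast
  qed (auto simp: disjoint_family_on_def)
  then show ?thesis using gc gW fW by (auto simp: centralizer_iff E_supp_iff)
qed

end

section \<open>Left limits and adjacency\<close>

text \<open>The left limit of \<open>g\<close> at \<open>y\<close>, that is, the place to which the
  left germ at \<open>y\<close> is carried. The domain is \<open>(0, 1]\<close>: there is a left
  germ of the unit interval at 1 and none at 0. Describing the limit by the displacement near
  \<open>y\<close> keeps topology out of the proofs.\<close>

definition lm :: "(real \<Rightarrow> real) \<Rightarrow> real \<Rightarrow> real" where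
  "lm g y = (if y \<in> {0<..1} then y + (THE c. \<exists>e>0. \<forall>z\<in>{y-e<..<y}. g z = z + c) else y)"

lemma lm_eqI:
  assumes "y \<in> {0<..1}" "e > 0" "\<And>t. 0 < t \<Longrightarrow> t < e \<Longrightarrow> g (y - t) = y + c - t"
  shows "lm g y = y + c"
proof -
  have c: "\<forall>z\<in>{y-e<..<y}. g z = z + c"
  proof
    fix z assume "z \<in> {y-e<..<y}"
    then show "g z = z + c" using assms(3)[of "y - z"] by auto
  qed
  have "(THE c. \<exists>e>0. \<forall>z\<in>{y-e<..<y}. g z = z + c) = c"
  proof (rule the_equality)
    show "\<exists>e>0. \<forall>z\<in>{y-e<..<y}. g z = z + c" using assms(2) c by blast
    fix c' assume "\<exists>e>0. \<forall>z\<in>{y-e<..<y}. g z = z + c'"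
    then obtain e' where e': "e' > 0" "\<forall>z\<in>{y-e'<..<y}. g z = z + c'" by blast
    have "y - min e e' / 2 \<in> {y-e<..<y}" "y - min e e' / 2 \<in> {y-e'<..<y}" using assms(2) e'(1) by auto
    then have "y - min e e' / 2 + c = y - min e e' / 2 + c'" using c e'(2) by metis
    then show "c' = c" by simp
  qed
  then show ?thesis unfolding lm_def using assms(1) by simp
qed

lemma lm_germ:
  assumes g: "g \<in> carrier IET" and y: "y \<in> {0<..1}"
  shows "lm g y \<in> {0<..1}"
    "\<exists>e>0. \<forall>t. 0 < t \<longrightarrow> t < e \<longrightarrow> y - t \<in> {0..<1} \<and> g (y - t) = lm g y - t"
proof -
  obtain D where D: "breaks g D" using IET_breaks[OF g] .
  note d = breaksD[OF D]
  define m where "m = Max {d \<in> D. d < y}"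
  have D0: "0 \<in> {d \<in> D. d < y}" using d(2) y by auto
  then have "m \<in> {d \<in> D. d < y}" unfolding m_def using d(1) by (intro Max_in) auto
  moreover have m3: "d \<le> m" if "d \<in> D" "d < y" for d
    unfolding m_def using d(1) that by (intro Max_ge) auto
  ultimately have m: "m < y" "m \<ge> 0" using D0 by auto
  define w where "w = (m + y)/2"
  have w: "m < w" "w < y" unfolding w_def using m by auto
  have gz: "g z = z + (g w - w)" if z: "m < z" "z < y" for z
  proof (cases "w \<le> z")
    case True
    have "D \<inter> {w<..z} = {}" using m3 w z by force
    then show ?thesis using d(3)[of w z] True w m z y by auto
  next
    case False
    have "D \<inter> {z<..w} = {}" using m3 w z by force
    then show ?thesis using d(3)[of z w] False w m z y by auto
  qed
  define c where "c = g w - w"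
  have germ: "y - t \<in> {0..<1} \<and> g (y - t) = y + c - t" if t: "0 < t" "t < y - m" for t
    using gz[of "y - t"] t m y unfolding c_def by auto
  have lm: "lm g y = y + c"
    by (rule lm_eqI[OF y, of "y - m"]) (use m germ in auto)
  show "\<exists>e>0. \<forall>t. 0 < t \<longrightarrow> t < e \<longrightarrow> y - t \<in> {0..<1} \<and> g (y - t) = lm g y - t"
    unfolding lm using m germ by (intro exI[of _ "y - m"]) auto
  have unit: "y + c - t \<in> {0..<1}" if t: "0 < t" "t < y - m" for t
    using germ[OF t] IET_unit[OF g, of "y - t"] by auto
  have "y + c > 0" using unit[of "(y - m)/2"] m by auto
  moreover have "y + c \<le> 1"
  proof (rule ccontr)
    assume n: "\<not> y + c \<le> 1"
    \<comment> \<open>If the left limit exceeded 1, points immediately left of \<open>y\<close>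
      would be sent to 1 or beyond.\<close>
    define t where "t = min (y + c - 1) ((y - m)/2)"
    have "0 < t" "t \<le> (y - m)/2" "t \<le> y + c - 1" unfolding t_def using n m by (simp_all only: min.cobounded1 min.cobounded2) auto
    then have "0 < t" "t < y - m" "t \<le> y + c - 1" using m by auto
    then show False using unit[of t] by auto
  qed
  ultimately show "lm g y \<in> {0<..1}" unfolding lm by auto
qed

lemma lm_out: "y \<notin> {0<..1} \<Longrightarrow> lm g y = y" unfolding lm_def by auto

lemma lm_comp:
  assumes g: "g \<in> carrier IET" and h: "h \<in> carrier IET"
  shows "lm (g \<circ> h) y = lm g (lm h y)"
proof (cases "y \<in> {0<..1}")
  case True
  obtain e where e: "e > 0" "\<And>t. 0 < t \<Longrightarrow> t < e \<Longrightarrow> h (y - t) = lm h y - t"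
    using lm_germ(2)[OF h True] by blast
  obtain d where d: "d > 0" "\<And>t. 0 < t \<Longrightarrow> t < d \<Longrightarrow> g (lm h y - t) = lm g (lm h y) - t"
    using lm_germ(2)[OF g lm_germ(1)[OF h True]] by blast
  have "lm (g \<circ> h) y = y + (lm g (lm h y) - y)"
    by (rule lm_eqI[OF True, of "min d e"]) (use d e in auto)
  then show ?thesis by simp
next
  case False
  then show ?thesis by (simp add: lm_out)
qed

lemma lm_id [simp]: "lm id y = y"
proof (cases "y \<in> {0<..1}")
  case True
  have "lm id y = y + 0" by (rule lm_eqI[OF True, of 1]) auto
  then show ?thesis by simp
qed (simp add: lm_out)

lemma lm_finv:
  assumes "g \<in> carrier IET"
  shows "lm (finv g) (lm g y) = y" "lm g (lm (finv g) y) = y"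
proof -
  have "finv g \<circ> g = id" "g \<circ> finv g = id" using assms by (auto simp: fun_eq_iff)
  then show "lm (finv g) (lm g y) = y" "lm g (lm (finv g) y) = y"
    using lm_comp[of "finv g" g y] lm_comp[of g "finv g" y] assms by simp_all
qed

lemma lm_inj: "g \<in> carrier IET \<Longrightarrow> lm g x = lm g y \<longleftrightarrow> x = y"
  using lm_finv(1) by metis

lemma lm_funpow: "g \<in> carrier IET \<Longrightarrow> lm (g ^^ n) y = (lm g ^^ n) y"
proof (induction n)
  case (Suc n)
  have "lm (g ^^ Suc n) y = lm g (lm (g ^^ n) y)"
    using lm_comp[OF Suc.prems IET_funpow[OF Suc.prems], of n y] by (simp only: funpow.simps)
  also have "\<dots> = lm g ((lm g ^^ n) y)" using Suc.IH[OF Suc.prems] by simp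
  also have "\<dots> = (lm g ^^ Suc n) y" by simp
  finally show ?case .
qed (simp add: lm_id[unfolded id_def] id_def)

text \<open>Off the breaks the two germs at a point travel together; this is how information passes
  between \<open>g\<close> and its left limits.\<close>

lemma lm_eq:
  assumes "breaks g D" "x \<in> {0..<1}" "x \<notin> D" shows "lm g x = g x"
proof -
  obtain e where e: "e > 0" "\<And>t. 0 \<le> t \<Longrightarrow> t < e \<Longrightarrow> g (x - t) = g x - t"
    using breaks_left[OF assms] by blast
  have "x \<noteq> 0" using assms(3) breaksD(2)[OF assms(1)] by auto
  then have "x \<in> {0<..1}" using assms(2) by auto
  then have "lm g x = x + (g x - x)" by (rule lm_eqI[OF _ e(1)]) (use e(2) in auto)
  then show ?thesis by simp
qed

lemma lm_centralizer:
  assumes f: "f \<in> carrier IET" and g: "g \<in> centralizer f"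
  shows "lm f (lm g y) = lm g (lm f y)"
proof -
  have "f \<circ> g = g \<circ> f" "g \<in> carrier IET" using g unfolding centralizer_def by auto
  then show ?thesis using lm_comp f by metis
qed

lemma lm_centralizer_funpow:
  assumes f: "f \<in> carrier IET" and g: "g \<in> centralizer f"
  shows "(lm f ^^ n) (lm g y) = lm g ((lm f ^^ n) y)"
  by (induction n) (auto simp: lm_centralizer[OF assms])

text \<open>The places of left germs of \<open>W\<close>; a nonempty \<open>[a, b)\<close> gives
  \<open>(a, b]\<close>.\<close>

definition left_pts :: "real set \<Rightarrow> real set" where
  "left_pts W = {y. \<exists>e>0. {y-e<..<y} \<subseteq> W}"

lemma hoi_finite_left_boundary: "hoi W \<Longrightarrow> finite (W - left_pts W)"
proof -
  assume "hoi W"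
  then obtain P where P: "finite P" "W = (\<Union>(a,b)\<in>P. {a..<b})" using hoi_def by auto
  have "W - left_pts W \<subseteq> fst ` P"
  proof
    fix x assume x: "x \<in> W - left_pts W"
    then obtain p where p: "p \<in> P" "fst p \<le> x" "x < snd p" using P by auto
    have "x = fst p"
    proof (rule ccontr)
      assume "x \<noteq> fst p"
      then have "x - fst p > 0" "{x - (x - fst p)<..<x} \<subseteq> {fst p..<snd p}" using p by auto
      moreover have "{fst p..<snd p} \<subseteq> W" unfolding P(2) using p(1) by force
      ultimately have "x \<in> left_pts W" unfolding left_pts_def by blast
      then show False using x by blast
    qed
    then show "x \<in> fst ` P" using p by blast
  qed
  then show ?thesis using P(1) finite_subset by blast
qed

lemma hoi_finite_right_boundary: "hoi W \<Longrightarrow> finite (left_pts W - W)"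
  by (rule finite_subset[OF _ hoi_finite_right_ends]) (auto simp: left_pts_def)

lemma left_pts_unit: assumes "W \<subseteq> {0..<1}" shows "left_pts W \<subseteq> {0<..1}"
proof
  fix y assume "y \<in> left_pts W"
  then obtain e where e: "e > 0" "{y-e<..<y} \<subseteq> {0..<1}" unfolding left_pts_def using assms by blast
  have "y - e/2 \<in> {y-e<..<y}" using e by auto
  then have "y - e/2 \<in> {0..<1}" using e by blast
  moreover have "y \<le> 1"
  proof (rule ccontr)
    assume "\<not> y \<le> 1"
    then have "y - min (e/2) (y - 1) \<in> {y-e<..<y}" using e by auto
    then have "y - min (e/2) (y - 1) \<in> {0..<1}" using e by blast
    then show False by auto
  qed
  ultimately show "y \<in> {0<..1}" using e by auto
qed

section \<open>Adjacency of germs on one minimal component\<close>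

locale iet_component = iet +
  fixes J assumes JM: "J \<in> min_comps f"
begin

lemma J_unit: "J \<subseteq> {0..<1}" using min_comps_unit JM by blast
lemma J_hoi: "hoi J" using min_comps_hoi JM by blast
lemma J_nonper: "J \<subseteq> nonper" using min_comps_nonper JM by blast
lemma J_f: "f x \<in> J \<longleftrightarrow> x \<in> J" using min_comps_f JM by blast

definition C where "C = centralizer f \<inter> E_supp J"

lemma C_cent: "g \<in> C \<Longrightarrow> g \<in> centralizer f" and C_IET: "g \<in> C \<Longrightarrow> g \<in> carrier IET"
  and C_out: "g \<in> C \<Longrightarrow> x \<notin> J \<Longrightarrow> g x = x"
  unfolding C_def by (auto simp: centralizer_iff E_supp_iff)

lemma C_J: "g \<in> C \<Longrightarrow> g x \<in> J \<longleftrightarrow> x \<in> J"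
  using C_out[of g] C_IET[of g] IET_inj[of g] by metis

lemma C_I:
  assumes "g \<in> carrier IET" "\<And>x. x \<in> J \<Longrightarrow> f (g x) = g (f x)" "\<And>x. x \<notin> J \<Longrightarrow> g x = x"
  shows "g \<in> C"
proof -
  have "f (g x) = g (f x)" for x using assms(2,3) J_f by (cases "x \<in> J") auto
  then show ?thesis unfolding C_def using assms by (auto simp: centralizer_iff E_supp_iff)
qed

lemma group_C: "group (subgrp C)"
  unfolding C_def using group_centralizer_supp[OF fI] .

text \<open>The disjunction covers \<open>f\<close> itself, whose support may go beyond
  \<open>J\<close>, together with the elements of \<open>C\<close>.\<close>

lemma left_f:
  assumes g: "g \<in> C \<or> g = f" shows "lm g y \<in> left_pts J \<longleftrightarrow> y \<in> left_pts J"
proof (cases "y \<in> {0<..1}")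
  case True
  have gI: "g \<in> carrier IET" using g C_IET fI by auto
  have gJ: "g x \<in> J \<longleftrightarrow> x \<in> J" for x using g C_J J_f by auto
  obtain e where e: "e > 0" "\<And>t. 0 < t \<Longrightarrow> t < e \<Longrightarrow> g (y - t) = lm g y - t"
    using lm_germ(2)[OF gI True] by blast
  have eq: "lm g y - t \<in> J \<longleftrightarrow> y - t \<in> J" if "0 < t" "t < e" for t using e(2)[OF that] gJ by metis
  have small: "w \<in> left_pts J \<longleftrightarrow> (\<exists>d>0. d \<le> e \<and> (\<forall>t. 0 < t \<longrightarrow> t < d \<longrightarrow> w - t \<in> J))" for w
  proof
    assume "w \<in> left_pts J"
    then obtain d where d: "d > 0" "{w-d<..<w} \<subseteq> J" unfolding left_pts_def by blast
    have "\<forall>t. 0 < t \<longrightarrow> t < min d e \<longrightarrow> w - t \<in> J" using d by auto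
    then show "\<exists>d>0. d \<le> e \<and> (\<forall>t. 0 < t \<longrightarrow> t < d \<longrightarrow> w - t \<in> J)"
      using d(1) e(1) by (intro exI[of _ "min d e"]) auto
  next
    assume "\<exists>d>0. d \<le> e \<and> (\<forall>t. 0 < t \<longrightarrow> t < d \<longrightarrow> w - t \<in> J)"
    then obtain d where d: "d > 0" "\<And>t. 0 < t \<Longrightarrow> t < d \<Longrightarrow> w - t \<in> J" by blast
    have "{w-d<..<w} \<subseteq> J"
    proof
      fix z assume "z \<in> {w-d<..<w}"
      then show "z \<in> J" using d(2)[of "w - z"] by auto
    qed
    then show "w \<in> left_pts J" unfolding left_pts_def using d(1) by blast
  qed
  show ?thesis unfolding small using eq by (meson less_le_trans)
next
  case False
  then show ?thesis using left_pts_unit[OF J_unit] by (simp add: lm_out)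
qed

lemma left_fpow: "(lm f ^^ n) y \<in> left_pts J \<longleftrightarrow> y \<in> left_pts J"
  by (induction n) (auto simp: left_f)

lemma lpow_inj: "(lm f ^^ n) x = (lm f ^^ n) y \<longleftrightarrow> x = y"
  using lm_inj[OF IET_funpow[OF fI]] lm_funpow[OF fI] by metis

lemma eventually_avoid:
  assumes "x \<in> nonper" "finite D" shows "\<exists>N. \<forall>n\<ge>N. (f ^^ n) x \<notin> D"
proof -
  have "inj (\<lambda>n. (f ^^ n) x)" using nonper_inj assms(1) by (auto intro!: injI)
  then have "finite ((\<lambda>n. (f ^^ n) x) -` D)" using finite_vimageI assms(2) by blast
  then obtain N where "\<forall>n \<in> (\<lambda>n. (f ^^ n) x) -` D. n < N" using finite_nat_set_iff_bounded by blast
  then show ?thesis by (metis not_less vimageI)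
qed

text \<open>A power of \<open>f\<close> fixing the left germ at \<open>y\<close> would fix all
  points just left of \<open>y\<close>, and those lie in \<open>J\<close>, where nothing is
  periodic.\<close>

lemma left_nonper:
  assumes y: "y \<in> left_pts J" "(lm f ^^ n) y = (lm f ^^ m) y" shows "n = m"
  using y(2)
proof (induction n m rule: linorder_wlog)
  case (le n m)
  define k where "k = m - n"
  have "(lm f ^^ n) ((lm f ^^ k) y) = (lm f ^^ n) y"
    using le unfolding k_def by (metis comp_apply funpow_add le_add_diff_inverse)
  then have "lm (f ^^ k) y = y" using lpow_inj lm_funpow[OF fI] by metis
  moreover have "y \<in> {0<..1}" using y(1) left_pts_unit[OF J_unit] by blast
  ultimately obtain e where e: "e > 0" "\<And>t. 0 < t \<Longrightarrow> t < e \<Longrightarrow> (f ^^ k) (y - t) = y - t"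
    using lm_germ(2)[OF IET_funpow[OF fI, of k], of y] by auto
  obtain d where d: "d > 0" "{y-d<..<y} \<subseteq> J" using y(1) unfolding left_pts_def by blast
  define t where "t = min d e / 2"
  have t: "0 < t" "t < e" "y - t \<in> {y-d<..<y}" unfolding t_def using d e by auto
  then have "y - t \<in> nonper" using d(2) J_nonper by blast
  moreover have "(f ^^ k) (y - t) = y - t" using e(2) t by blast
  ultimately have "k = 0" using nonper_iff by blast
  then show ?case using le k_def by auto
qed auto

lemma left_eventually_avoid:
  assumes "y \<in> left_pts J" "finite D" shows "\<exists>N. \<forall>n\<ge>N. (lm f ^^ n) y \<notin> D"
proof -
  have "inj (\<lambda>n. (lm f ^^ n) y)" using left_nonper assms(1) by (auto intro!: injI)
  then have "finite ((\<lambda>n. (lm f ^^ n) y) -` D)" using finite_vimageI assms(2) by blast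
  then obtain N where "\<forall>n \<in> (\<lambda>n. (lm f ^^ n) y) -` D. n < N" using finite_nat_set_iff_bounded by blast
  then show ?thesis by (metis not_less vimageI)
qed

definition adj :: "real \<Rightarrow> real \<Rightarrow> bool" where
  "adj x y \<longleftrightarrow> (\<exists>N. \<forall>n\<ge>N. (f ^^ n) x = (lm f ^^ n) y)"

lemma adj_unique_left: assumes "adj x y" "adj x y'" shows "y = y'"
proof -
  obtain N M where "\<forall>n\<ge>N. (f ^^ n) x = (lm f ^^ n) y" "\<forall>n\<ge>M. (f ^^ n) x = (lm f ^^ n) y'"
    using assms unfolding adj_def by blast
  then have "(lm f ^^ (max N M)) y = (lm f ^^ (max N M)) y'" by (metis max.cobounded1 max.cobounded2)
  then show ?thesis using lpow_inj by blast
qed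

lemma adj_unique_right: assumes "adj x y" "adj x' y" shows "x = x'"
proof -
  obtain N M where "\<forall>n\<ge>N. (f ^^ n) x = (lm f ^^ n) y" "\<forall>n\<ge>M. (f ^^ n) x' = (lm f ^^ n) y"
    using assms unfolding adj_def by blast
  then have "(f ^^ (max N M)) x = (f ^^ (max N M)) x'" by (metis max.cobounded1 max.cobounded2)
  then show ?thesis using fpow_inj by blast
qed

text \<open>After the last visit to a break the right and the left germ at a point move alike, so a
  single coincidence at time \<open>N\<close> persists.\<close>

lemma adjI:
  assumes D: "breaks f D" and x: "x \<in> {0..<1}" and av: "\<And>n. n \<ge> N \<Longrightarrow> (f ^^ n) x \<notin> D"
    and N: "(f ^^ N) x = (lm f ^^ N) y"
  shows "adj x y"
proof -
  have "(f ^^ (N + k)) x = (lm f ^^ (N + k)) y" for k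
  proof (induction k)
    case (Suc k)
    have "lm f ((f ^^ (N + k)) x) = f ((f ^^ (N + k)) x)"
      by (rule lm_eq[OF D]) (use x fpow_unit av in \<open>auto simp del: atLeastLessThan_iff\<close>)
    then show ?case using Suc by simp
  qed (use N in simp)
  then show ?thesis unfolding adj_def by (metis le_add_diff_inverse)
qed

lemma lpow_inverse: "(lm f ^^ n) ((lm (finv f) ^^ n) y) = y"
proof (induction n)
  case (Suc n)
  have "(lm f ^^ Suc n) ((lm (finv f) ^^ Suc n) y) = (lm f ^^ n) (lm f (lm (finv f) ((lm (finv f) ^^ n) y)))"
    by (simp add: funpow_swap1)
  then show ?case using Suc lm_finv fI by simp
qed simp

text \<open>Move \<open>x\<close> forward until its orbit is clear of the breaks and of the left
  boundary of \<open>J\<close>, pass there from the right germ to the left germ at the same point,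
  and go back equally many steps under the inverse of \<open>lm f\<close>.\<close>

lemma adj_ex_left: assumes x: "x \<in> J" shows "\<exists>y\<in>left_pts J. adj x y"
proof -
  obtain D where D: "breaks f D" using IET_breaks[OF fI] .
  have "finite (D \<union> (J - left_pts J))" using breaksD(1)[OF D] hoi_finite_left_boundary[OF J_hoi] by auto
  then obtain N where N: "\<And>n. n \<ge> N \<Longrightarrow> (f ^^ n) x \<notin> D \<union> (J - left_pts J)"
    using eventually_avoid x J_nonper by blast
  define y where "y = (lm (finv f) ^^ N) ((f ^^ N) x)"
  have y: "(lm f ^^ N) y = (f ^^ N) x" unfolding y_def by (rule lpow_inverse)
  have "adj x y" by (rule adjI[OF D]) (use x J_unit N y in auto)
  moreover have "(f ^^ N) x \<in> J" using x fpow_inv_set[OF J_f] by blast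
  then have "(f ^^ N) x \<in> left_pts J" using N[of N] by blast
  then have "y \<in> left_pts J" using left_fpow[of N y] y by simp
  ultimately show ?thesis by blast
qed

lemma adj_ex_right: assumes y: "y \<in> left_pts J" shows "\<exists>x\<in>J. adj x y"
proof -
  obtain D where D: "breaks f D" using IET_breaks[OF fI] .
  have "finite (D \<union> (left_pts J - J))" using breaksD(1)[OF D] hoi_finite_right_boundary[OF J_hoi] by auto
  then obtain N where N: "\<And>n. n \<ge> N \<Longrightarrow> (lm f ^^ n) y \<notin> D \<union> (left_pts J - J)"
    using left_eventually_avoid y by blast
  define x where "x = (finv f ^^ N) ((lm f ^^ N) y)"
  have x: "(f ^^ N) x = (lm f ^^ N) y" unfolding x_def by (rule finv_fpow)
  have inJ: "(lm f ^^ n) y \<in> J" if "n \<ge> N" for n using N[OF that] left_fpow y by blast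
  have "(f ^^ (N + k)) x = (lm f ^^ (N + k)) y" for k
  proof (induction k)
    case (Suc k)
    have "lm f ((lm f ^^ (N + k)) y) = f ((lm f ^^ (N + k)) y)"
      by (rule lm_eq[OF D]) (use inJ[of "N+k"] J_unit N[of "N+k"] in auto)
    then show ?case using Suc by simp
  qed (use x in simp)
  then have "adj x y" unfolding adj_def by (metis le_add_diff_inverse)
  moreover have "x \<in> J" using x inJ[of N] fpow_inv_set[OF J_f, of N x] by simp
  ultimately show ?thesis by blast
qed

lemma adj_left: "x \<in> J \<Longrightarrow> adj x y \<Longrightarrow> y \<in> left_pts J"
  using adj_ex_left adj_unique_left by blast

text \<open>However \<open>g\<close> cuts \<open>J\<close> at \<open>x\<close>, late iterates of
  \<open>x\<close> avoid the breaks of \<open>g\<close>, and there \<open>g\<close> and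
  \<open>lm g\<close> have the same value. Commutation transports this back to time 0.\<close>

lemma adj_equivariant:
  assumes g: "g \<in> centralizer f" and x: "x \<in> J" and a: "adj x y"
  shows "adj (g x) (lm g y)"
proof -
  have gI: "g \<in> carrier IET" using g centralizer_iff by blast
  obtain D where D: "breaks g D" using IET_breaks[OF gI] .
  obtain N where N: "\<And>n. n \<ge> N \<Longrightarrow> (f ^^ n) x \<notin> D"
    using eventually_avoid[OF _ breaksD(1)[OF D]] x J_nonper by blast
  obtain M where M: "\<And>n. n \<ge> M \<Longrightarrow> (f ^^ n) x = (lm f ^^ n) y" using a unfolding adj_def by blast
  have "(f ^^ n) (g x) = (lm f ^^ n) (lm g y)" if n: "n \<ge> max N M" for n
  proof -
    have "(f ^^ n) (g x) = g ((f ^^ n) x)" using centralizer_funpow[OF g] .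
    also have "\<dots> = lm g ((f ^^ n) x)"
      by (rule lm_eq[OF D, symmetric]) (use fpow_unit x J_unit N n in \<open>auto simp del: atLeastLessThan_iff\<close>)
    also have "\<dots> = lm g ((lm f ^^ n) y)" using M n by simp
    also have "\<dots> = (lm f ^^ n) (lm g y)" using lm_centralizer_funpow[OF fI g] by simp
    finally show ?thesis .
  qed
  then show ?thesis unfolding adj_def by blast
qed

text \<open>Agreement at \<open>d\<close> spreads along its orbit, which approaches \<open>x\<close>
  from the right, where both maps are translations. It is stated for piecewise translations of
  \<open>J\<close> so that the flow can be compared with the identity before it is known to be an
  interval exchange.\<close>

lemma dense_agree:
  assumes g: "paff 1 g J" "\<And>x. x \<in> J \<Longrightarrow> f (g x) = g (f x)"
    and h: "paff 1 h J" "\<And>x. x \<in> J \<Longrightarrow> f (h x) = h (f x)"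
    and d: "d \<in> J" "g d = h d" and x: "x \<in> J"
  shows "g x = h x"
proof -
  have pow: "(f ^^ n) (k z) = k ((f ^^ n) z)" if "z \<in> J" "\<And>x. x \<in> J \<Longrightarrow> f (k x) = k (f x)" for k n z
    using that fpow_inv_set[OF J_f] by (induction n) auto
  obtain e1 where e1: "e1 > 0" "{x..<x+e1} \<subseteq> J" "\<And>t. 0 \<le> t \<Longrightarrow> t < e1 \<Longrightarrow> g (x + t) = g x + 1 * t"
    using paff_right[OF g(1) x] by blast
  obtain e2 where e2: "e2 > 0" "\<And>t. 0 \<le> t \<Longrightarrow> t < e2 \<Longrightarrow> h (x + t) = h x + 1 * t"
    using paff_right[OF h(1) x] by blast
  obtain z where z: "z \<in> {x..<x + min e1 e2}" "orb d z"
    using min_comps_dense[OF JM d(1) x, of "min e1 e2"] e1(1) e2(1) by auto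
  then have zJ: "z \<in> J" using orb_invariant[OF J_f] d(1) by blast
  obtain m n where "(f ^^ m) d = (f ^^ n) z" using z(2) orb_def by blast
  then have "(f ^^ n) (g z) = (f ^^ n) (h z)"
    using pow[of z g n] pow[of z h n] pow[of d g m] pow[of d h m] zJ g(2) h(2) d by metis
  then have "g z = h z" using fpow_inj by blast
  then show ?thesis using e1(3)[of "z - x"] e2(2)[of "z - x"] z by auto
qed

lemma centralizer_agree:
  assumes g: "g \<in> centralizer f" and h: "h \<in> centralizer f" and d: "d \<in> J" "g d = h d" and x: "x \<in> J"
  shows "g x = h x"
  by (rule dense_agree[of g h d x])
     (use d x g h IET_paff[OF _ J_hoi J_unit] in \<open>auto simp: centralizer_iff\<close>)

definition fJ where "fJ x = (if x \<in> J then f x else x)"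

lemma fJ_C: "fJ \<in> C"
  unfolding C_def fJ_def using J_hoi J_unit J_f f_cent by (intro restrict_centralizer)

lemma fJ_pow: "x \<in> J \<Longrightarrow> (fJ ^^ n) x = (f ^^ n) x"
  using fpow_inv_set[OF J_f] by (induction n) (auto simp: fJ_def)

lemma C_pow: "(fJ ^^ n) \<in> C"
proof (induction n)
  case 0
  then show ?case by (auto intro!: C_I simp: id_def[symmetric])
next
  case (Suc n)
  then show ?case using fJ_C unfolding C_def by (auto simp: centralizer_comp[OF fI] E_supp_comp simp del: comp_apply)
qed

lemma infinite_C: "infinite C"
proof
  assume "finite C"
  obtain d where d: "d \<in> J" using min_comps_ne[OF JM] by blast
  have "inj (\<lambda>n. fJ ^^ n)"
  proof (rule injI)
    fix n m assume "fJ ^^ n = fJ ^^ m"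
    then have "(f ^^ n) d = (f ^^ m) d" using fJ_pow[OF d] by metis
    then show "n = m" using nonper_inj d J_nonper by blast
  qed
  moreover have "range (\<lambda>n. fJ ^^ n) \<subseteq> C" using C_pow by blast
  ultimately show False using \<open>finite C\<close> finite_imageD finite_subset infinite_UNIV_nat by blast
qed

definition S where "S = {x \<in> J. \<not> adj x x}"

text \<open>Modulo powers of \<open>f\<close> on \<open>J\<close>, an element \<open>g\<close> is
  determined by the orbit of \<open>g d0\<close>, and this orbit is one of the finitely many that
  contain infinitely many points of \<open>S\<close>.\<close>

lemma virtually_cyclic_C:
  assumes inf: "infinite S" shows "virtually_cyclic (subgrp C)"
proof -
  define cls where "cls d = {y. orb d y}" for d
  have cls_eq: "cls d = cls d' \<longleftrightarrow> orb d d'" for d d'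
    unfolding cls_def using orb_trans orb_sym orb_refl by blast
  obtain D where D: "breaks f D" using IET_breaks[OF fI] .
  \<comment> \<open>An orbit through a point \<open>y\<close> of \<open>S\<close> contains a break:
    otherwise the two germs at \<open>y\<close> would never be separated and \<open>y\<close> would
    be adjacent to itself.\<close>
  have hit: "\<exists>d\<in>D. orb d y" if y: "y \<in> S" for y
  proof (rule ccontr)
    assume n: "\<not> (\<exists>d\<in>D. orb d y)"
    have "(f ^^ n) y \<notin> D" for n
    proof
      assume "(f ^^ n) y \<in> D"
      moreover have "orb ((f ^^ n) y) y" unfolding orb_def by (intro exI[of _ 0] exI[of _ n]) simp
      ultimately show False using n by blast
    qed
    then have "adj y y" using adjI[OF D, of y 0 y] y J_unit unfolding S_def by auto
    then show False using y S_def by blast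
  qed
  define B where "B = {d \<in> J. infinite {y \<in> S. orb d y}}"
  have fin: "finite (cls ` B)"
  proof -
    have "cls ` B \<subseteq> cls ` D"
    proof (rule image_subsetI)
      fix b assume b: "b \<in> B"
      then have "{y \<in> S. orb b y} \<noteq> {}" unfolding B_def by fastforce
      then obtain y where y: "y \<in> S" "orb b y" by blast
      then obtain d where "d \<in> D" "orb d y" using hit by blast
      then have "cls b = cls d" using cls_eq y orb_trans orb_sym by blast
      then show "cls b \<in> cls ` D" using \<open>d \<in> D\<close> by blast
    qed
    then show ?thesis using breaksD(1)[OF D] finite_subset by blast
  qed
  obtain d0 where d0: "d0 \<in> B"
  proof -
    have "S \<subseteq> (\<Union>d\<in>D. {y \<in> S. orb d y})" using hit by blast
    then obtain d where d: "d \<in> D" "infinite {y \<in> S. orb d y}"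
      using inf breaksD(1)[OF D] finite_subset by (metis (no_types, lifting) finite_UN)
    then obtain y where y: "y \<in> S" "orb d y" by (metis (no_types, lifting) empty_Collect_eq finite.emptyI)
    have "{z \<in> S. orb y z} = {z \<in> S. orb d z}" using y orb_trans orb_sym by blast
    then have "y \<in> B" unfolding B_def using d y S_def by auto
    then show thesis by (rule that)
  qed
  have gB: "g d0 \<in> B" if g: "g \<in> C" for g
  proof -
    obtain Dg where Dg: "breaks g Dg" using IET_breaks[OF C_IET[OF g]] .
    \<comment> \<open>Off its breaks \<open>g\<close> carries both germs at \<open>y\<close> to
      germs at \<open>g y\<close>, so self-adjacency of \<open>g y\<close> would pull back to
      \<open>y\<close>. Only the finitely many points of \<open>Dg\<close> are lost.\<close>
    have "g ` ({y \<in> S. orb d0 y} - Dg) \<subseteq> {y \<in> S. orb (g d0) y}"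
    proof (rule image_subsetI)
      fix y assume y: "y \<in> {y \<in> S. orb d0 y} - Dg"
      then have yJ: "y \<in> J" "\<not> adj y y" unfolding S_def by auto
      obtain y' where y': "adj y y'" using adj_ex_left yJ(1) by blast
      have "\<not> adj (g y) (g y)"
      proof
        assume "adj (g y) (g y)"
        moreover have "adj (g y) (lm g y')" using adj_equivariant[OF C_cent[OF g] yJ(1) y'] .
        ultimately have "g y = lm g y'" using adj_unique_left by blast
        moreover have "lm g y = g y" using lm_eq[OF Dg] y yJ J_unit by auto
        ultimately have "y = y'" using lm_inj[OF C_IET[OF g]] by metis
        then show False using y' yJ by blast
      qed
      then show "g y \<in> {y \<in> S. orb (g d0) y}"
        using yJ y centralizer_orb[OF C_cent[OF g]] C_J[OF g] unfolding S_def by auto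
    qed
    moreover have "infinite (g ` ({y \<in> S. orb d0 y} - Dg))"
    proof -
      have "infinite ({y \<in> S. orb d0 y} - Dg)" using d0 breaksD(1)[OF Dg] unfolding B_def by auto
      moreover have "inj_on g ({y \<in> S. orb d0 y} - Dg)" using IET_inj[OF C_IET[OF g]] by (auto intro: inj_onI)
      ultimately show ?thesis using finite_imageD by blast
    qed
    ultimately have "infinite {y \<in> S. orb (g d0) y}" using finite_subset by blast
    then show ?thesis unfolding B_def using d0 C_J[OF g] B_def by auto
  qed
  let ?G = "subgrp C" and ?H = "generate (subgrp C) {fJ}"
  interpret G: group ?G using group_C .
  have sH: "subgroup ?H ?G" using fJ_C by (intro G.generate_is_subgroup) auto
  have pow: "fJ ^^ n \<in> ?H" for n
  proof (induction n)
    case 0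
    then show ?case using generate.one[of ?G "{fJ}"] by (simp add: id_def)
  next
    case (Suc n)
    have "fJ \<otimes>\<^bsub>?G\<^esub> (fJ ^^ n) \<in> ?H" using Suc by (intro generate.eng) (auto intro: generate.incl)
    then show ?case by (simp only: funpow.simps subgrp_simps)
  qed
  \<comment> \<open>By rigidity it suffices to compare \<open>h\<close> with the power of
    \<open>fJ\<close> after \<open>g\<close> at the single point \<open>d0\<close>.\<close>
  have step: "?H #>\<^bsub>?G\<^esub> g = ?H #>\<^bsub>?G\<^esub> h" if gh: "g \<in> C" "h \<in> C" "h d0 = (f ^^ n) (g d0)" for g h n
  proof -
    have d0J: "d0 \<in> J" using d0 B_def by blast
    have "h x = (fJ ^^ n \<circ> g) x" for x
    proof (cases "x \<in> J")
      case True
      have "(fJ ^^ n \<circ> g) \<in> centralizer f"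
        using centralizer_comp[OF fI C_cent[OF C_pow] C_cent[OF gh(1)]] .
      moreover have "h d0 = (fJ ^^ n \<circ> g) d0" using gh fJ_pow C_J[OF gh(1)] d0J by simp
      ultimately show ?thesis using centralizer_agree[OF C_cent[OF gh(2)] _ d0J _ True] by blast
    next
      case False
      then show ?thesis using C_out[OF gh(1)] C_out[OF gh(2)] C_out[OF C_pow] by simp
    qed
    then have "h = fJ ^^ n \<otimes>\<^bsub>?G\<^esub> g" by auto
    then have "h \<in> ?H #>\<^bsub>?G\<^esub> g" using pow unfolding r_coset_def by blast
    then show ?thesis using G.repr_independence sH gh by simp
  qed
  have coset: "?H #>\<^bsub>?G\<^esub> g = ?H #>\<^bsub>?G\<^esub> h" if gh: "g \<in> C" "h \<in> C" "cls (g d0) = cls (h d0)" for g h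
  proof -
    have "orb (g d0) (h d0)" using gh cls_eq by blast
    then show ?thesis using orb_cases step gh by metis
  qed
  have "finite ((\<lambda>g. ?H #>\<^bsub>?G\<^esub> g) ` C)"
  proof -
    let ?c = "\<lambda>g. cls (g d0)"
    have "(\<lambda>g. ?H #>\<^bsub>?G\<^esub> g) ` C \<subseteq> (\<lambda>k. ?H #>\<^bsub>?G\<^esub> (inv_into C ?c k)) ` (?c ` C)"
    proof (rule image_subsetI)
      fix g assume g: "g \<in> C"
      have "inv_into C ?c (?c g) \<in> C" "?c (inv_into C ?c (?c g)) = ?c g"
        using inv_into_into[of "?c g" ?c C] f_inv_into_f[of "?c g" ?c C] g by simp_all
      then have "?H #>\<^bsub>?G\<^esub> g = ?H #>\<^bsub>?G\<^esub> (inv_into C ?c (?c g))" using coset g by metis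
      then show "?H #>\<^bsub>?G\<^esub> g \<in> (\<lambda>k. ?H #>\<^bsub>?G\<^esub> (inv_into C ?c k)) ` (?c ` C)" using g by blast
    qed
    moreover have "?c ` C \<subseteq> cls ` B" using gB by blast
    ultimately show ?thesis using fin finite_subset finite_imageI by metis
  qed
  then have "finite (rcosets\<^bsub>?G\<^esub> ?H)" unfolding RCOSETS_def by (simp add: UNION_singleton_eq_range)
  then show ?thesis unfolding virtually_cyclic_def using fJ_C by auto
qed


section \<open>Finite S: cutting J into parts and moving along the glued circles\<close>

definition part_ends where "part_ends = S \<union> (left_pts J - J)"

definition next_end where "next_end x = Min {e \<in> part_ends. x < e}"

text \<open>The point at which a motion to the right continues on arriving at the left germ at
  \<open>e\<close>.\<close>

definition jump where "jump e = (THE x. x \<in> J \<and> adj x e)"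

end

locale iet_finite_component = iet_component +
  assumes finS: "finite S"
begin

lemma finite_part_ends: "finite part_ends"
  unfolding part_ends_def using finS hoi_finite_right_boundary[OF J_hoi] by auto

text \<open>The interval of \<open>J\<close> to the right of \<open>x\<close> stops at some
  \<open>z\<close> outside \<open>J\<close>, which is a left point and thus a part end. The next
  part end is therefore defined and is reached without leaving \<open>J\<close>.\<close>

lemma next_end:
  assumes x: "x \<in> J"
  shows "next_end x \<in> part_ends" "x < next_end x" "{x..<next_end x} \<subseteq> J"
    "\<And>e. e \<in> part_ends \<Longrightarrow> x < e \<Longrightarrow> next_end x \<le> e"
proof -
  define z where "z = Inf {z. x \<le> z \<and> z \<notin> J}"
  have one: "1 \<in> {z. x \<le> z \<and> z \<notin> J}" using x J_unit by auto
  have bdd: "bdd_below {z. x \<le> z \<and> z \<notin> J}" by (rule bdd_belowI[of _ x]) auto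
  have low: "y \<in> J" if "x \<le> y" "y < z" for y
    using that cInf_lower[OF _ bdd, of y] unfolding z_def by force
  obtain e where e: "e > 0" "{x..<x+e} \<subseteq> J" using hoi_right_in[OF J_hoi x] by blast
  have "x + e \<le> z" unfolding z_def
  proof (rule cInf_greatest)
    fix y assume y: "y \<in> {z. x \<le> z \<and> z \<notin> J}"
    show "x + e \<le> y"
    proof (rule ccontr)
      assume "\<not> x + e \<le> y"
      then have "y \<in> {x..<x+e}" using y by auto
      then show False using e y by blast
    qed
  qed (use one in auto)
  then have xz: "x < z" using e by auto
  have "z \<notin> J"
  proof
    assume "z \<in> J"
    then obtain d where d: "d > 0" "{z..<z+d} \<subseteq> J" using hoi_right_in[OF J_hoi] by blast
    have "z < z + d" using d by auto
    then obtain y where y: "y \<in> {z. x \<le> z \<and> z \<notin> J}" "y < z + d"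
      using cInf_lessD[of "{z. x \<le> z \<and> z \<notin> J}" "z + d"] one unfolding z_def by blast
    have "z \<le> y" unfolding z_def by (rule cInf_lower[OF y(1) bdd])
    then show False using y d by (metis atLeastLessThan_iff in_mono mem_Collect_eq)
  qed
  moreover have "{z - (z - x)<..<z} \<subseteq> J" using low by auto
  then have "z \<in> left_pts J" unfolding left_pts_def using xz by (auto intro!: exI[of _ "z - x"])
  ultimately have zE: "z \<in> {e \<in> part_ends. x < e}" unfolding part_ends_def using xz by auto
  have fin: "finite {e \<in> part_ends. x < e}" using finite_part_ends by auto
  have "next_end x \<in> {e \<in> part_ends. x < e}" unfolding next_end_def using fin zE by (intro Min_in) auto
  then show "next_end x \<in> part_ends" "x < next_end x" by auto
  show min: "next_end x \<le> e" if "e \<in> part_ends" "x < e" for e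
    unfolding next_end_def using fin that by (intro Min_le) auto
  have "next_end x \<le> z" using min zE by auto
  then show "{x..<next_end x} \<subseteq> J" using low by auto
qed

lemma next_end_same:
  assumes x: "x \<in> J" and z: "x \<le> z" "z < next_end x"
  shows "next_end z = next_end x"
proof -
  have "z \<in> J" using next_end(3)[OF x] z by auto
  show ?thesis
  proof (rule antisym)
    show "next_end z \<le> next_end x" using next_end(4)[OF \<open>z \<in> J\<close>] next_end(1)[OF x] z by blast
    show "next_end x \<le> next_end z"
      using next_end(4)[OF x next_end(1)[OF \<open>z \<in> J\<close>]] next_end(2)[OF \<open>z \<in> J\<close>] z by auto
  qed
qed

lemma next_end_left: "x \<in> J \<Longrightarrow> next_end x \<in> left_pts J"
  unfolding left_pts_def using next_end(2,3)[of x]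
  by (auto intro!: exI[of _ "next_end x - x"])

lemma adj_self: "x \<in> J \<Longrightarrow> x \<notin> S \<Longrightarrow> adj x x" unfolding S_def by blast

lemma J_S_left: "x \<in> J \<Longrightarrow> x \<notin> S \<Longrightarrow> x \<in> left_pts J"
  using adj_self adj_left by blast

text \<open>The run of \<open>J\<close> through \<open>x\<close> has a left end \<open>w\<close>
  that is no left point of \<open>J\<close>. Adjacent left germs always sit at left points, so
  \<open>w\<close> is not adjacent to itself and belongs to \<open>S\<close>; the last point of
  \<open>S\<close> up to \<open>x\<close> then starts the part of \<open>x\<close>.\<close>

lemma part_start:
  assumes x: "x \<in> J" shows "\<exists>s\<in>S. s \<le> x \<and> x < next_end s"
proof -
  define A where "A = {w. w \<le> x \<and> {w..x} \<subseteq> J}"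
  define w where "w = Inf A"
  have xA: "x \<in> A" unfolding A_def using x by auto
  have bdd: "bdd_below A"
  proof (rule bdd_belowI[of _ 0])
    fix y assume "y \<in> A"
    then have "y \<in> J" unfolding A_def by auto
    then show "0 \<le> y" using J_unit by auto
  qed
  have wx: "w \<le> x" unfolding w_def using cInf_lower[OF xA bdd] .
  have up: "y \<in> J" if y: "w < y" "y \<le> x" for y
  proof -
    obtain u where "u \<in> A" "u < y" using cInf_lessD[of A y] y xA unfolding w_def by blast
    then show ?thesis using y unfolding A_def by auto
  qed
  have wJ: "w \<in> J"
  proof (rule ccontr)
    assume n: "w \<notin> J"
    then obtain d where d: "d > 0" "{w..<w+d} \<inter> J = {}" using hoi_right_out[OF J_hoi] by blast
    have "w < x" using n x wx by (cases "w = x") auto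
    define y where "y = min x (w + d/2)"
    have y: "w < y" "y \<le> x" "y \<in> {w..<w+d}" unfolding y_def using \<open>w < x\<close> d(1) by auto
    then have "y \<in> J" using up by blast
    then show False using y d by blast
  qed
  have wS: "w \<in> S"
  proof (rule ccontr)
    assume "w \<notin> S"
    then obtain d where d: "d > 0" "{w-d<..<w} \<subseteq> J" using J_S_left[OF wJ] unfolding left_pts_def by blast
    have "{w - d/2..x} \<subseteq> {w-d<..<w} \<union> {w} \<union> {w<..x}" using d by auto
    then have "{w - d/2..x} \<subseteq> J" using d(2) wJ up by auto
    then have "w - d/2 \<in> A" unfolding A_def using wx d by auto
    then have "w \<le> w - d/2" unfolding w_def using cInf_lower[OF _ bdd] by blast
    then show False using d by auto
  qed
  define s where "s = Max {s \<in> S. s \<le> x}"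
  have fin: "finite {s \<in> S. s \<le> x}" using finS by auto
  have "s \<in> {s \<in> S. s \<le> x}" unfolding s_def using fin wS wx by (intro Max_in) auto
  then have s: "s \<in> S" "s \<le> x" by auto
  have smax: "s' \<le> s" if "s' \<in> S" "s' \<le> x" for s' unfolding s_def using fin that by (intro Max_ge) auto
  have ws: "w \<le> s" using smax wS wx by blast
  have sJ: "s \<in> J" using s S_def by blast
  have "x < next_end s"
  proof (rule ccontr)
    assume n: "\<not> x < next_end s"
    have "w < next_end s" using ws next_end(2)[OF sJ] by auto
    then have "next_end s \<in> J" using up n by auto
    then have "next_end s \<in> S" using next_end(1)[OF sJ] unfolding part_ends_def by blast
    then show False using smax n next_end(2)[OF sJ] by force
  qed
  then show ?thesis using s by blast
qed

text \<open>The target is again in \<open>S\<close>: a target adjacent to itself would, by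
  uniqueness of the left germ, be the part end itself, and a part end lying in \<open>J\<close> is
  in \<open>S\<close>.\<close>

lemma jump:
  assumes x: "x \<in> J" shows "jump (next_end x) \<in> S" "adj (jump (next_end x)) (next_end x)"
proof -
  obtain y where y: "y \<in> J" "adj y (next_end x)" using adj_ex_right[OF next_end_left[OF x]] by blast
  have "jump (next_end x) = y" unfolding jump_def
    by (rule the_equality) (use y adj_unique_right in blast)+
  moreover have "y \<in> S"
  proof (rule ccontr)
    assume "y \<notin> S"
    then have "adj y y" using adj_self y by blast
    then have "next_end x = y" using adj_unique_left y by blast
    then show False using next_end(1)[OF x] y \<open>y \<notin> S\<close> unfolding part_ends_def by auto
  qed
  ultimately show "jump (next_end x) \<in> S" "adj (jump (next_end x)) (next_end x)" using y by auto
qed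

text \<open>Unit speed motion to the right, crossing each left limit point to the point adjacent to it.\<close>
definition upath :: "(real \<Rightarrow> real) \<Rightarrow> real \<Rightarrow> bool" where
  "upath w t \<longleftrightarrow> (\<forall>u. 0 \<le> u \<longrightarrow> u \<le> t \<longrightarrow> w u \<in> J) \<and>
     (\<forall>u. 0 \<le> u \<longrightarrow> u < t \<longrightarrow> (\<exists>d>0. u + d \<le> t \<and> (\<forall>h. 0 \<le> h \<longrightarrow> h < d \<longrightarrow> w (u + h) = w u + h))) \<and>
     (\<forall>u. 0 < u \<longrightarrow> u \<le> t \<longrightarrow> (\<exists>y d. d > 0 \<and> d \<le> u \<and> (\<forall>h. 0 < h \<longrightarrow> h < d \<longrightarrow> w (u - h) = y - h) \<and> adj (w u) y))"

definition reach :: "real \<Rightarrow> real \<Rightarrow> real \<Rightarrow> bool" where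
  "reach x t y \<longleftrightarrow> 0 \<le> t \<and> (\<exists>w. upath w t \<and> w 0 = x \<and> w t = y)"

lemma upathD:
  assumes "upath w t"
  shows "0 \<le> u \<Longrightarrow> u \<le> t \<Longrightarrow> w u \<in> J"
    "0 \<le> u \<Longrightarrow> u < t \<Longrightarrow> \<exists>d>0. u + d \<le> t \<and> (\<forall>h. 0 \<le> h \<longrightarrow> h < d \<longrightarrow> w (u + h) = w u + h)"
    "0 < u \<Longrightarrow> u \<le> t \<Longrightarrow> \<exists>y d. d > 0 \<and> d \<le> u \<and> (\<forall>h. 0 < h \<longrightarrow> h < d \<longrightarrow> w (u - h) = y - h) \<and> adj (w u) y"
  using assms unfolding upath_def by auto

lemma reach_J: "reach x t y \<Longrightarrow> x \<in> J \<and> y \<in> J"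
  unfolding reach_def using upathD(1) by (metis order_refl)

text \<open>At the infimum \<open>u\<close> of the times of disagreement both paths arrive with the
  same left germ, so adjacency gives the same point, and motion at unit speed extends the agreement
  beyond \<open>u\<close>.\<close>

lemma reach_unique:
  assumes "reach x t y" "reach x t y'" shows "y = y'"
proof (rule ccontr)
  assume ne: "y \<noteq> y'"
  obtain w where w: "upath w t" "w 0 = x" "w t = y" using assms unfolding reach_def by blast
  obtain v where v: "upath v t" "v 0 = x" "v t = y'" using assms unfolding reach_def by blast
  have t: "0 \<le> t" using assms unfolding reach_def by blast
  define A where "A = {u. 0 \<le> u \<and> u \<le> t \<and> w u \<noteq> v u}"
  define u where "u = Inf A"
  have tA: "t \<in> A" unfolding A_def using ne w v t by auto
  have bdd: "bdd_below A" by (rule bdd_belowI[of _ 0]) (auto simp: A_def)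
  have u0: "0 \<le> u" unfolding u_def using tA by (intro cInf_greatest) (auto simp: A_def)
  have ut: "u \<le> t" unfolding u_def using cInf_lower[OF tA bdd] .
  have below: "w r = v r" if "0 \<le> r" "r < u" for r
  proof (rule ccontr)
    assume "w r \<noteq> v r"
    then have "r \<in> A" unfolding A_def using that ut by auto
    then have "u \<le> r" unfolding u_def by (rule cInf_lower[OF _ bdd])
    then show False using that by auto
  qed
  have equ: "w u = v u"
  proof (cases "u = 0")
    case False
    then have up: "0 < u" using u0 by auto
    obtain y1 d1 where 1: "d1 > 0" "d1 \<le> u" "\<And>h. 0 < h \<Longrightarrow> h < d1 \<Longrightarrow> w (u - h) = y1 - h" "adj (w u) y1"
      using upathD(3)[OF w(1) up ut] by blast
    obtain y2 d2 where 2: "d2 > 0" "d2 \<le> u" "\<And>h. 0 < h \<Longrightarrow> h < d2 \<Longrightarrow> v (u - h) = y2 - h" "adj (v u) y2"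
      using upathD(3)[OF v(1) up ut] by blast
    define h where "h = min d1 d2 / 2"
    have h: "0 < h" "h < d1" "h < d2" unfolding h_def using 1(1) 2(1) by auto
    then have "w (u - h) = v (u - h)" using 1(2) by (intro below) auto
    then have "y1 = y2" using 1(3)[OF h(1,2)] 2(3)[OF h(1,3)] by simp
    then show ?thesis using 1(4) 2(4) adj_unique_right by blast
  qed (use w v in simp)
  then have "u \<noteq> t" using tA A_def by auto
  then have "u < t" using ut by auto
  obtain d1 where 1: "d1 > 0" "\<And>h. 0 \<le> h \<Longrightarrow> h < d1 \<Longrightarrow> w (u + h) = w u + h"
    using upathD(2)[OF w(1) u0 \<open>u < t\<close>] by blast
  obtain d2 where 2: "d2 > 0" "\<And>h. 0 \<le> h \<Longrightarrow> h < d2 \<Longrightarrow> v (u + h) = v u + h"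
    using upathD(2)[OF v(1) u0 \<open>u < t\<close>] by blast
  have "u + min d1 d2 \<le> Inf A"
  proof (rule cInf_greatest)
    fix r assume r: "r \<in> A"
    show "u + min d1 d2 \<le> r"
    proof (rule ccontr)
      assume "\<not> u + min d1 d2 \<le> r"
      then have r': "r - u < d1" "r - u < d2" by auto
      have "u \<le> r" unfolding u_def by (rule cInf_lower[OF r bdd])
      then have "w r = v r" using 1(2)[of "r - u"] 2(2)[of "r - u"] r' equ by auto
      then show False using r A_def by auto
    qed
  qed (use tA in auto)
  then show False using 1(1) 2(1) unfolding u_def[symmetric] by auto
qed

lemma reach_trans:
  assumes "reach x s y" "reach y t z" shows "reach x (s + t) z"
proof -
  obtain w where w: "upath w s" "w 0 = x" "w s = y" using assms(1) unfolding reach_def by blast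
  obtain v where v: "upath v t" "v 0 = y" "v t = z" using assms(2) unfolding reach_def by blast
  have st: "0 \<le> s" "0 \<le> t" using assms unfolding reach_def by auto
  define c where "c u = (if u \<le> s then w u else v (u - s))" for u
  have cv: "c u = v (u - s)" if "s \<le> u" for u using that w v by (auto simp: c_def)
  have "upath c (s + t)"
    unfolding upath_def
  proof (intro conjI allI impI)
    fix u assume u: "0 \<le> u" "u \<le> s + t"
    then show "c u \<in> J" unfolding c_def using upathD(1)[OF w(1), of u] upathD(1)[OF v(1), of "u - s"] by auto
  next
    fix u assume u: "0 \<le> u" "u < s + t"
    show "\<exists>d>0. u + d \<le> s + t \<and> (\<forall>h. 0 \<le> h \<longrightarrow> h < d \<longrightarrow> c (u + h) = c u + h)"
    proof (cases "u < s")
      case True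
      obtain d where d: "d > 0" "u + d \<le> s" "\<And>h. 0 \<le> h \<Longrightarrow> h < d \<Longrightarrow> w (u + h) = w u + h"
        using upathD(2)[OF w(1) u(1) True] by blast
      then show ?thesis using st True by (intro exI[of _ d]) (auto simp: c_def)
    next
      case False
      obtain d where d: "d > 0" "u - s + d \<le> t" "\<And>h. 0 \<le> h \<Longrightarrow> h < d \<Longrightarrow> v (u - s + h) = v (u - s) + h"
        using upathD(2)[OF v(1), of "u - s"] u False by auto
      have "c (u + h) = c u + h" if "0 \<le> h" "h < d" for h
        using cv[of u] cv[of "u + h"] d(3)[OF that] that False by (simp add: algebra_simps)
      then show ?thesis using d by (intro exI[of _ d]) auto
    qed
  next
    fix u assume u: "0 < u" "u \<le> s + t"
    show "\<exists>y d. d > 0 \<and> d \<le> u \<and> (\<forall>h. 0 < h \<longrightarrow> h < d \<longrightarrow> c (u - h) = y - h) \<and> adj (c u) y"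
    proof (cases "u \<le> s")
      case True
      obtain y d where d: "d > 0" "d \<le> u" "\<And>h. 0 < h \<Longrightarrow> h < d \<Longrightarrow> w (u - h) = y - h" "adj (w u) y"
        using upathD(3)[OF w(1) u(1) True] by blast
      then show ?thesis using True by (intro exI[of _ y] exI[of _ d]) (auto simp: c_def)
    next
      case False
      obtain y d where d: "d > 0" "d \<le> u - s" "\<And>h. 0 < h \<Longrightarrow> h < d \<Longrightarrow> v (u - s - h) = y - h" "adj (v (u - s)) y"
        using upathD(3)[OF v(1), of "u - s"] u False by auto
      have "c (u - h) = y - h" if "0 < h" "h < d" for h
        using cv[of "u - h"] d(2) d(3)[OF that] that by (simp add: algebra_simps)
      then show ?thesis using d st False cv[of u] by (intro exI[of _ y] exI[of _ d]) auto
    qed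
  qed
  moreover have "c 0 = x" "c (s + t) = z" using w v st cv[of "s + t"] by (auto simp: c_def)
  ultimately show ?thesis unfolding reach_def using st by auto
qed

text \<open>Paths are described by germs and adjacency, with no mention of \<open>S\<close> or of
  the parts; so \<open>g\<close> takes paths to paths even if it cuts the parts.\<close>

lemma reach_equivariant:
  assumes g: "g \<in> C" and r: "reach x t y" shows "reach (g x) t (g y)"
proof -
  obtain w where w: "upath w t" "w 0 = x" "w t = y" "0 \<le> t" using r unfolding reach_def by blast
  have gI: "g \<in> carrier IET" using C_IET[OF g] .
  have "upath (\<lambda>u. g (w u)) t"
    unfolding upath_def
  proof (intro conjI allI impI)
    fix u assume "0 \<le> u" "u \<le> t"
    then show "g (w u) \<in> J" using upathD(1)[OF w(1)] C_J[OF g] by blast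
  next
    fix u assume u: "0 \<le> u" "u < t"
    obtain d where d: "d > 0" "u + d \<le> t" "\<And>h. 0 \<le> h \<Longrightarrow> h < d \<Longrightarrow> w (u + h) = w u + h"
      using upathD(2)[OF w(1) u] by blast
    have "w u \<in> {0..<1}" using upathD(1)[OF w(1), of u] u J_unit by auto
    then obtain e where e: "e > 0" "\<And>h. 0 \<le> h \<Longrightarrow> h < e \<Longrightarrow> g (w u + h) = g (w u) + h"
      using IET_right[OF gI] by blast
    show "\<exists>d>0. u + d \<le> t \<and> (\<forall>h. 0 \<le> h \<longrightarrow> h < d \<longrightarrow> g (w (u + h)) = g (w u) + h)"
      by (rule exI[of _ "min d e"]) (use d e in auto)
  next
    fix u assume u: "0 < u" "u \<le> t"
    obtain y d where d: "d > 0" "d \<le> u" "\<And>h. 0 < h \<Longrightarrow> h < d \<Longrightarrow> w (u - h) = y - h" "adj (w u) y"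
      using upathD(3)[OF w(1) u] by blast
    have wu: "w u \<in> J" using upathD(1)[OF w(1), of u] u by auto
    then have "y \<in> {0<..1}" using adj_left d(4) left_pts_unit[OF J_unit] by blast
    then obtain e where e: "e > 0" "\<And>h. 0 < h \<Longrightarrow> h < e \<Longrightarrow> g (y - h) = lm g y - h"
      using lm_germ(2)[OF gI] by blast
    have "adj (g (w u)) (lm g y)" using adj_equivariant[OF C_cent[OF g] wu d(4)] .
    then show "\<exists>y d. d > 0 \<and> d \<le> u \<and> (\<forall>h. 0 < h \<longrightarrow> h < d \<longrightarrow> g (w (u - h)) = y - h) \<and> adj (g (w u)) y"
      using d e by (intro exI[of _ "lm g y"] exI[of _ "min d e"]) auto
  qed
  then show ?thesis unfolding reach_def using w by auto
qed

lemma reach_within: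
  assumes x: "x \<in> J" and t: "0 \<le> t" "x + t < next_end x" shows "reach x t (x + t)"
proof -
  have J: "x + u \<in> J" if "0 \<le> u" "u \<le> t" for u using next_end(3)[OF x] that t by auto
  have "upath (\<lambda>u. x + u) t"
    unfolding upath_def
  proof (intro conjI allI impI)
    fix u assume u: "0 < u" "u \<le> t"
    have "x + u \<notin> S" using next_end(4)[OF x, of "x + u"] u t unfolding part_ends_def by auto
    then have "adj (x + u) (x + u)" using adj_self J u by auto
    then show "\<exists>y d. d > 0 \<and> d \<le> u \<and> (\<forall>h. 0 < h \<longrightarrow> h < d \<longrightarrow> x + (u - h) = y - h) \<and> adj (x + u) y"
      using u by (intro exI[of _ "x + u"] exI[of _ u]) auto
  next
    fix u assume u: "0 \<le> u" "u < t"
    then show "\<exists>d>0. u + d \<le> t \<and> (\<forall>h. 0 \<le> h \<longrightarrow> h < d \<longrightarrow> x + (u + h) = x + u + h)"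
      by (intro exI[of _ "t - u"]) auto
  qed (use J in auto)
  then show ?thesis unfolding reach_def using t by (auto intro!: exI[of _ "\<lambda>u. x + u"])
qed

lemma reach_end:
  assumes x: "x \<in> J" shows "reach x (next_end x - x) (jump (next_end x))"
proof -
  let ?t = "next_end x - x"
  define w where "w u = (if u < ?t then x + u else jump (next_end x))" for u
  have t: "?t > 0" using next_end(2)[OF x] by auto
  have J: "x + u \<in> J" if "0 \<le> u" "u < ?t" for u using next_end(3)[OF x] that by auto
  have "upath w ?t"
    unfolding upath_def
  proof (intro conjI allI impI)
    fix u assume u: "0 \<le> u" "u \<le> ?t"
    then show "w u \<in> J" using J jump(1)[OF x] unfolding w_def S_def by auto
  next
    fix u assume u: "0 < u" "u \<le> ?t"
    show "\<exists>y d. d > 0 \<and> d \<le> u \<and> (\<forall>h. 0 < h \<longrightarrow> h < d \<longrightarrow> w (u - h) = y - h) \<and> adj (w u) y"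
    proof (cases "u < ?t")
      case True
      have "x + u \<notin> S" using next_end(4)[OF x, of "x + u"] u True unfolding part_ends_def by auto
      then have "adj (x + u) (x + u)" using adj_self J u True by auto
      then show ?thesis
        using u True by (intro exI[of _ "x + u"] exI[of _ u]) (auto simp: w_def)
    next
      case False
      then show ?thesis
        using u jump(2)[OF x] by (intro exI[of _ "next_end x"] exI[of _ u]) (auto simp: w_def)
    qed
  next
    fix u assume u: "0 \<le> u" "u < ?t"
    then show "\<exists>d>0. u + d \<le> ?t \<and> (\<forall>h. 0 \<le> h \<longrightarrow> h < d \<longrightarrow> w (u + h) = w u + h)"
      by (intro exI[of _ "?t - u"]) (auto simp: w_def)
  qed
  then show ?thesis unfolding reach_def using t by (auto intro!: exI[of _ w] simp: w_def)
qed

end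

section \<open>The translation flow\<close>

context iet_finite_component begin

lemma S_J: "s \<in> S \<Longrightarrow> s \<in> J" unfolding S_def by blast

lemma S_ne: "S \<noteq> {}"
  using part_start min_comps_ne[OF JM] by blast

text \<open>The shortest part. It bounds the number of jumps in a given time and keeps the periods
  of the flow away from 0.\<close>

definition gap where "gap = Min ((\<lambda>s. next_end s - s) ` S)"

lemma gap: "gap > 0" "s \<in> S \<Longrightarrow> s + gap \<le> next_end s"
proof -
  have fin: "finite ((\<lambda>s. next_end s - s) ` S)" "(\<lambda>s. next_end s - s) ` S \<noteq> {}" using finS S_ne by auto
  then have "gap \<in> (\<lambda>s. next_end s - s) ` S" unfolding gap_def by (rule Min_in)
  then show "gap > 0" using next_end(2) S_J by auto
  show "s + gap \<le> next_end s" if "s \<in> S"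
    using Min_le[OF fin(1), of "next_end s - s"] that unfolding gap_def by auto
qed

text \<open>Crossing a part from its start takes time at least \<open>gap\<close>, so
  \<open>k\<close> bounds the number of parts still to be entered.\<close>

lemma reach_ex_S:
  "s \<in> S \<Longrightarrow> 0 \<le> t \<Longrightarrow> t < real k * gap \<Longrightarrow> \<exists>y. reach s t y"
proof (induction k arbitrary: s t)
  case (Suc k)
  have sJ: "s \<in> J" using S_J Suc by blast
  show ?case
  proof (cases "s + t < next_end s")
    case True
    then show ?thesis using reach_within sJ Suc by blast
  next
    case False
    have "t - (next_end s - s) < real k * gap" using gap(2)[OF Suc.prems(1)] Suc.prems(3) by (auto simp: algebra_simps)
    then obtain y where "reach (jump (next_end s)) (t - (next_end s - s)) y"
      using Suc.IH[OF jump(1)[OF sJ], of "t - (next_end s - s)"] False by auto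
    from reach_trans[OF reach_end[OF sJ] this] show ?thesis by auto
  qed
qed auto

lemma reach_ex:
  assumes x: "x \<in> J" and t: "0 \<le> t" shows "\<exists>y. reach x t y"
proof (cases "x + t < next_end x")
  case True
  then show ?thesis using reach_within assms by blast
next
  case False
  obtain k where "t - (next_end x - x) < real k * gap"
    using reals_Archimedean3[OF gap(1)] by blast
  then obtain y where "reach (jump (next_end x)) (t - (next_end x - x)) y"
    using reach_ex_S[OF jump(1)[OF x], of "t - (next_end x - x)" k] False by auto
  from reach_trans[OF reach_end[OF x] this] show ?thesis by auto
qed

definition flow :: "real \<Rightarrow> real \<Rightarrow> real" where
  "flow t x = (if x \<in> J then THE y. reach x t y else x)"

lemma flow_eqI: "reach x t y \<Longrightarrow> flow t x = y"
  unfolding flow_def using reach_J reach_unique by (auto intro!: the_equality)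

lemma flow_reach: "x \<in> J \<Longrightarrow> 0 \<le> t \<Longrightarrow> reach x t (flow t x)"
  using reach_ex flow_eqI by blast

lemma flow_J: "0 \<le> t \<Longrightarrow> flow t x \<in> J \<longleftrightarrow> x \<in> J"
  using flow_reach reach_J unfolding flow_def by metis

lemma flow_out: "x \<notin> J \<Longrightarrow> flow t x = x" unfolding flow_def by auto

lemma flow_add: "0 \<le> s \<Longrightarrow> 0 \<le> t \<Longrightarrow> flow (s + t) x = flow t (flow s x)"
proof (cases "x \<in> J")
  case True
  assume st: "0 \<le> s" "0 \<le> t"
  have "reach x (s + t) (flow t (flow s x))"
    by (rule reach_trans[OF flow_reach flow_reach]) (use st True flow_J in auto)
  then show ?thesis by (rule flow_eqI)
qed (auto simp: flow_out)

lemma flow_within: "x \<in> J \<Longrightarrow> 0 \<le> t \<Longrightarrow> x + t < next_end x \<Longrightarrow> flow t x = x + t"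
  using reach_within flow_eqI by blast

lemma flow_0 [simp]: "flow 0 x = x"
  using flow_within[of x 0] next_end(2)[of x] flow_out by (cases "x \<in> J") auto

lemma flow_C: "g \<in> C \<Longrightarrow> 0 \<le> t \<Longrightarrow> flow t (g x) = g (flow t x)"
proof (cases "x \<in> J")
  case True
  assume "g \<in> C" "0 \<le> t"
  then show ?thesis using reach_equivariant flow_reach[OF True] flow_eqI by blast
qed (auto simp: flow_out C_out)

lemma flow_f: assumes "0 \<le> t" "x \<in> J" shows "f (flow t x) = flow t (f x)"
  using flow_C[OF fJ_C assms(1), of x] assms flow_J unfolding fJ_def by auto

text \<open>In time less than \<open>gap\<close> a point makes at most one jump, so it is enough to
  cut each part once, at distance \<open>t\<close> from its end. Longer times are then divided into
  equal short steps.\<close>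

lemma flow_paff_small:
  assumes t: "0 \<le> t" "t < gap" shows "paff 1 (flow t) J"
proof -
  have J_eq: "J = (\<Union>s\<in>S. {s..<next_end s - t} \<union> {next_end s - t..<next_end s})"
  proof
    show "J \<subseteq> (\<Union>s\<in>S. {s..<next_end s - t} \<union> {next_end s - t..<next_end s})"
    proof
      fix x assume "x \<in> J"
      then obtain s where "s \<in> S" "s \<le> x" "x < next_end s" using part_start by blast
      then show "x \<in> (\<Union>s\<in>S. {s..<next_end s - t} \<union> {next_end s - t..<next_end s})"
        by (intro UN_I[of s]) auto
    qed
    show "(\<Union>s\<in>S. {s..<next_end s - t} \<union> {next_end s - t..<next_end s}) \<subseteq> J"
    proof (rule UN_least)
      fix s assume s: "s \<in> S"
      have "{s..<next_end s - t} \<union> {next_end s - t..<next_end s} \<subseteq> {s..<next_end s}"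
        using gap(2)[OF s] t by auto
      then show "{s..<next_end s - t} \<union> {next_end s - t..<next_end s} \<subseteq> J"
        using next_end(3)[OF S_J[OF s]] by blast
    qed
  qed
  have 1: "paff 1 (flow t) {s..<next_end s - t}" if s: "s \<in> S" for s
  proof (rule paff_interval)
    fix x assume x: "s \<le> x" "x < next_end s - t"
    have "x < next_end s" using x t by auto
    then have "x \<in> J" "next_end x = next_end s"
      using next_end(3)[OF S_J[OF s]] next_end_same[OF S_J[OF s] x(1)] x(1) by auto
    then show "flow t x = 1 * x + t" using flow_within x t by auto
  qed
  have 2: "paff 1 (flow t) {next_end s - t..<next_end s}" if s: "s \<in> S" for s
  proof (rule paff_interval)
    fix x assume x: "next_end s - t \<le> x" "x < next_end s"
    have sx: "s \<le> x" using x gap(2)[OF s] t by auto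
    have xJ: "x \<in> J" and ne: "next_end x = next_end s"
      using next_end(3)[OF S_J[OF s]] next_end_same[OF S_J[OF s] sx] x sx by auto
    let ?j = "jump (next_end s)"
    have j: "?j \<in> S" using jump(1)[OF S_J[OF s]] .
    have "reach x (next_end s - x) ?j" using reach_end[OF xJ] ne by simp
    moreover have "reach ?j (t - (next_end s - x)) (?j + (t - (next_end s - x)))"
      by (rule reach_within) (use S_J[OF j] gap(2)[OF j] x t in auto)
    ultimately have "reach x (next_end s - x + (t - (next_end s - x))) (?j + (t - (next_end s - x)))"
      by (rule reach_trans)
    then have "flow (next_end s - x + (t - (next_end s - x))) x = ?j + (t - (next_end s - x))" by (rule flow_eqI)
    then show "flow t x = 1 * x + (?j + t - next_end s)" by simp
  qed
  have "paff 1 (flow t) (\<Union>s\<in>S. {s..<next_end s - t} \<union> {next_end s - t..<next_end s})"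
    by (rule paff_UN[OF finS], rule paff_Un) (rule 1 2, assumption)+
  then show ?thesis using J_eq by simp
qed

lemma flow_paff:
  assumes t: "0 \<le> t" shows "paff 1 (flow t) J"
proof -
  have mult: "paff 1 (flow (real n * r)) J" if r: "0 \<le> r" "r < gap" for n r
  proof (induction n)
    case 0
    then show ?case using J_hoi by (auto intro: paff_id)
  next
    case (Suc n)
    have im: "flow (real n * r) ` J \<subseteq> J" using flow_J r by auto
    have "paff (1 * 1) (flow r \<circ> flow (real n * r)) J"
      by (rule paff_comp[OF Suc flow_paff_small[OF r]]) (use im in auto)
    moreover have "flow (real (Suc n) * r) x = (flow r \<circ> flow (real n * r)) x" for x
      using flow_add[of "real n * r" r x] r by (simp add: algebra_simps)
    ultimately show ?case using paff_cong by fastforce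
  qed
  obtain n where n: "t < real n * gap" using reals_Archimedean3[OF gap(1)] by blast
  then have "n > 0" using t by (cases n) auto
  then have "t / real n < gap" "t = real n * (t / real n)" using n by (auto simp: field_simps)
  then show ?thesis using mult[of "t / real n" n] t by auto
qed

text \<open>Rigidity applied to the flow and the identity. This is why all circles have the same
  length.\<close>

lemma flow_fix_all:
  assumes "0 \<le> t" "x \<in> J" "flow t x = x" "y \<in> J" shows "flow t y = y"
  by (rule dense_agree[where h="\<lambda>y. y" and d=x])
     (use assms flow_paff flow_f J_hoi in \<open>auto intro: paff_id\<close>)

text \<open>Following the jumps never leaves the finite set \<open>S\<close>, so a point of
  \<open>S\<close> recurs after a positive time, and a return time of one point is a period for
  all.\<close>

lemma ex_period: "\<exists>t>0. \<forall>x\<in>J. flow t x = x"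
proof -
  obtain s where s: "s \<in> S" using S_ne by blast
  define q where "q k = ((\<lambda>s. jump (next_end s)) ^^ k) s" for k
  have qS: "q k \<in> S" for k unfolding q_def using s jump(1) S_J by (induction k) auto
  have step: "\<exists>t. t > 0 \<and> flow t (q k) = q (Suc k)" for k
    using flow_eqI[OF reach_end[OF S_J[OF qS[of k]]]] next_end(2)[OF S_J[OF qS[of k]]]
    by (intro exI[of _ "next_end (q k) - q k"]) (auto simp: q_def)
  have walk: "\<exists>t. t > 0 \<and> flow t (q i) = q (Suc (i + d))" for i d
  proof (induction d)
    case (Suc d)
    obtain t where t: "t > 0" "flow t (q i) = q (Suc (i + d))" using Suc by blast
    obtain r where r: "r > 0" "flow r (q (Suc (i + d))) = q (Suc (Suc (i + d)))" using step by blast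
    then show ?case using t flow_add[of t r "q i"] by (intro exI[of _ "t + r"]) auto
  qed (use step in simp)
  have "\<not> inj q" using finS qS finite_imageD[of q UNIV] by (metis finite_subset image_subsetI infinite_UNIV_nat)
  then obtain i j where "i < j" "q i = q j" unfolding inj_def by (metis linorder_neqE_nat)
  moreover obtain d where "j = Suc (i + d)" using \<open>i < j\<close> less_iff_Suc_add by auto
  ultimately obtain t where t: "t > 0" "flow t (q i) = q i" using walk[of i d] by auto
  then show ?thesis using flow_fix_all[of t "q i"] S_J[OF qS[of i]] by (intro exI[of _ t]) auto
qed

definition periods where "periods = {t. t > 0 \<and> (\<forall>x\<in>J. flow t x = x)}"

definition per where "per = Inf periods"

lemma periods_gap: assumes "t \<in> periods" shows "gap \<le> t"
proof (rule ccontr)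
  assume n: "\<not> gap \<le> t"
  obtain s where s: "s \<in> S" using S_ne by blast
  have "flow t s = s + t" using flow_within[OF S_J[OF s], of t] gap(2)[OF s] n assms unfolding periods_def by auto
  moreover have "flow t s = s" using assms S_J[OF s] unfolding periods_def by blast
  ultimately show False using assms unfolding periods_def by auto
qed

lemma periods_diff: "t \<in> periods \<Longrightarrow> r \<in> periods \<Longrightarrow> r < t \<Longrightarrow> t - r \<in> periods"
  using flow_add[of r "t - r"] unfolding periods_def by auto

text \<open>The infimum is attained: otherwise there would be two distinct periods closer than
  \<open>gap\<close>, and their difference would be a period below \<open>gap\<close>.\<close>

lemma per: "per \<in> periods" "t \<in> periods \<Longrightarrow> per \<le> t"
proof -
  have ne: "periods \<noteq> {}" using ex_period unfolding periods_def by blast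
  have bdd: "bdd_below periods" by (rule bdd_belowI[of _ gap]) (rule periods_gap)
  show low: "per \<le> t" if "t \<in> periods" for t unfolding per_def using that bdd by (rule cInf_lower)
  obtain t where t: "t \<in> periods" "t < per + gap"
    using cInf_lessD[OF ne, of "per + gap"] gap(1) unfolding per_def by auto
  show "per \<in> periods"
  proof (rule ccontr)
    assume "per \<notin> periods"
    then have "per < t" using low[OF t(1)] t(1) by (cases "per = t") auto
    then obtain r where r: "r \<in> periods" "r < t"
      using cInf_lessD[OF ne, of t] unfolding per_def by auto
    then have "gap \<le> t - r" using periods_gap periods_diff t(1) by blast
    then show False using low[OF r(1)] t(2) by auto
  qed
qed

lemma per_pos: "per > 0" using per(1) unfolding periods_def by auto

lemma flow_per: "flow per x = x"
  using per(1) flow_out unfolding periods_def by (cases "x \<in> J") auto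

lemma flow_per_nat: "flow (real n * per) x = x"
proof (induction n)
  case (Suc n)
  have "flow (real (Suc n) * per) x = flow per (flow (real n * per) x)"
    using flow_add[of "real n * per" per x] per_pos by (simp add: algebra_simps)
  then show ?case using Suc flow_per by simp
qed simp

lemma flow_frac: assumes "0 \<le> v" shows "flow (frac v * per) x = flow (v * per) x"
proof -
  define n where "n = nat \<lfloor>v\<rfloor>"
  have "v = real n + frac v" unfolding n_def frac_def using assms by simp
  then have "v * per = real n * per + frac v * per" by (metis distrib_right)
  then show ?thesis using flow_add[of "real n * per" "frac v * per" x] flow_per_nat per_pos by simp
qed

text \<open>The flow runs in nonnegative time only; a large multiple of the period minus
  \<open>t\<close> plays the role of \<open>-t\<close>.\<close>

lemma flow_inverse: assumes "0 \<le> t" shows "\<exists>r\<ge>0. \<forall>x. flow r (flow t x) = x \<and> flow t (flow r x) = x"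
proof -
  obtain n where "t < real n * per" using reals_Archimedean3[OF per_pos] by blast
  then have "real n * per - t \<ge> 0" by auto
  moreover have "flow (real n * per - t) (flow t x) = x" for x
    using flow_add[of t "real n * per - t" x] assms calculation flow_per_nat by simp
  moreover have "flow t (flow (real n * per - t) x) = x" for x
    using flow_add[of "real n * per - t" t x] assms calculation(1) flow_per_nat by simp
  ultimately show ?thesis by blast
qed

lemma flow_in_C: assumes t: "0 \<le> t" shows "flow t \<in> C"
proof (rule C_I)
  obtain r where r: "r \<ge> 0" "\<And>x. flow r (flow t x) = x" "\<And>x. flow t (flow r x) = x"
    using flow_inverse[OF t] by blast
  show "flow t \<in> carrier IET"
  proof (rule glue_IET[where I="{()}" and W="\<lambda>_. J" and \<pi>=id])
    have "bij_betw (flow t) J J"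
      by (rule bij_betw_byWitness[where f'="flow r"]) (use r t flow_J in auto)
    then show "J \<subseteq> {0..<1} \<and> bij_betw (flow t) J J \<and> paff 1 (flow t) J"
      using J_unit flow_paff[OF t] by blast
  qed (auto simp: disjoint_family_on_def flow_out)
qed (use t flow_f flow_out in auto)

lemma flow_time_unique:
  assumes x: "x \<in> J" and ab: "0 \<le> a" "a < per" "0 \<le> b" "b < per" and eq: "flow a x = flow b x"
  shows "a = b"
proof -
  have no: False if "0 \<le> a" "a < b" "b < per" "flow a x = flow b x" for a b
  proof -
    have "flow (b - a) (flow a x) = flow a x" using flow_add[of a "b - a" x] that by simp
    then have "\<forall>y\<in>J. flow (b - a) y = y" using flow_fix_all[of "b - a" "flow a x"] that x flow_J by auto
    then have "b - a \<in> periods" unfolding periods_def using that by auto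
    then show False using per(2) that by fastforce
  qed
  show ?thesis using no[of a b] no[of b a] ab eq by (cases a b rule: linorder_cases) auto
qed

definition forb where "forb x y \<longleftrightarrow> (\<exists>t\<ge>0. flow t x = y)"

lemma forb_refl: "forb x x" unfolding forb_def by (intro exI[of _ 0]) auto

lemma forb_sym: "forb x y \<Longrightarrow> forb y x"
  unfolding forb_def using flow_inverse by metis

lemma forb_trans: "forb x y \<Longrightarrow> forb y z \<Longrightarrow> forb x z"
  unfolding forb_def
proof (elim exE conjE)
  fix s t assume "0 \<le> s" "flow s x = y" "0 \<le> t" "flow t y = z"
  then show "\<exists>t\<ge>0. flow t x = z" using flow_add[of s t x] by (intro exI[of _ "s + t"]) auto
qed

lemma forb_C: "g \<in> C \<Longrightarrow> forb (g x) (g y) \<longleftrightarrow> forb x y"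
  unfolding forb_def using flow_C[of g] IET_inj[OF C_IET] by metis

lemma forb_time:
  assumes "forb x y" shows "\<exists>v. v \<in> {0..<1} \<and> y = flow (v * per) x"
proof -
  obtain t where t: "t \<ge> 0" "flow t x = y" using assms unfolding forb_def by blast
  have "flow (frac (t / per) * per) x = flow (t / per * per) x" using flow_frac t per_pos by simp
  then show ?thesis using t per_pos by (intro exI[of _ "frac (t / per)"]) (auto simp: frac_lt_1)
qed

text \<open>Each circle gets a base point \<open>p i\<close>, and a point of \<open>J\<close> gets
  as coordinates its circle and the time from the base point in units of \<open>per\<close>. As an
  element of \<open>C\<close> commutes with the flow, its effect on a circle is given by the
  coordinates of the image of the base point.\<close>

lemma torus_embedding:
  "\<exists>m \<ge> 1. \<exists>\<psi>. \<psi> \<in> hom (subgrp C) (torus_wreath m) \<and> inj_on \<psi> C \<and> diagonal m \<subseteq> \<psi> ` C"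
proof -
  define cls where "cls x = {y. forb x y}" for x
  have cls_eq: "cls x = cls y \<longleftrightarrow> forb x y" for x y
    unfolding cls_def using forb_trans forb_sym forb_refl by blast
  have "cls ` J \<subseteq> cls ` S"
  proof (rule image_subsetI)
    fix x assume "x \<in> J"
    then obtain s where s: "s \<in> S" "s \<le> x" "x < next_end s" using part_start by blast
    then have "flow (x - s) s = x" using flow_within[OF S_J] by auto
    then have "forb s x" unfolding forb_def using s by (intro exI[of _ "x - s"]) auto
    then show "cls x \<in> cls ` S" using cls_eq s by blast
  qed
  then have fin: "finite (cls ` J)" using finS finite_subset by blast
  define m where "m = card (cls ` J)"
  have m: "m \<ge> 1" unfolding m_def using fin min_comps_ne[OF JM] by (simp add: Suc_le_eq card_gt_0_iff)
  obtain b where b: "bij_betw b {1..m} (cls ` J)"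
    using ex_bij_betw_nat_finite_1[OF fin] unfolding m_def by blast
  have "\<forall>i\<in>{1..m}. \<exists>x\<in>J. cls x = b i" using bij_betwE[OF b] by (metis imageE)
  then obtain p where p: "\<And>i. i \<in> {1..m} \<Longrightarrow> p i \<in> J \<and> cls (p i) = b i" by metis
  have p_unique: "i = j" if "i \<in> {1..m}" "j \<in> {1..m}" "forb (p i) (p j)" for i j
    using that p cls_eq bij_betw_imp_inj_on[OF b] by (metis inj_onD)
  have p_ex: "\<exists>i v. i \<in> {1..m} \<and> v \<in> {0..<1} \<and> x = flow (v * per) (p i)" if x: "x \<in> J" for x
  proof -
    have "cls x \<in> b ` {1..m}" using x bij_betw_imp_surj_on[OF b] by blast
    then obtain i where i: "i \<in> {1..m}" "cls (p i) = cls x" using p by force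
    then show ?thesis using forb_time cls_eq by blast
  qed
  then obtain idx pos where ip: "\<And>x. x \<in> J \<Longrightarrow> idx x \<in> {1..m} \<and> pos x \<in> {0..<1} \<and> x = flow (pos x * per) (p (idx x))"
    by metis
  have ip_unique: "idx x = i \<and> pos x = v" if x: "i \<in> {1..m}" "v \<in> {0..<1}" "x = flow (v * per) (p i)" for x i v
  proof -
    have xJ: "x \<in> J" using x p flow_J per_pos by auto
    note a = ip[OF xJ]
    have "forb (p i) x" "forb (p (idx x)) x"
      unfolding forb_def using x(2,3) a per_pos by (metis atLeastLessThan_iff less_imp_le mult_nonneg_nonneg)+
    then have idx: "idx x = i" using p_unique a x forb_trans forb_sym by blast
    have "v * per = pos x * per"
      by (rule flow_time_unique[of "p i"]) (use x a p idx per_pos in auto)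
    then show ?thesis using idx per_pos by simp
  qed
  define \<sigma> where "\<sigma> g i = (if i \<in> {1..m} then idx (g (p i)) else i)" for g i
  have gp: "g (p i) = flow (pos (g (p i)) * per) (p (\<sigma> g i))" "pos (g (p i)) \<in> {0..<1}" "\<sigma> g i \<in> {1..m}"
    if "g \<in> C" "i \<in> {1..m}" for g i
    using ip[of "g (p i)"] p[OF that(2)] C_J[OF that(1)] that unfolding \<sigma>_def by auto
  have \<sigma>_perm: "\<sigma> g permutes {1..m}" if g: "g \<in> C" for g
  proof (rule bij_imp_permutes)
    have "inj_on (\<sigma> g) {1..m}"
    proof (rule inj_onI)
      fix i j assume ij: "i \<in> {1..m}" "j \<in> {1..m}" "\<sigma> g i = \<sigma> g j"
      have "forb (p (\<sigma> g i)) (g (p i))" "forb (p (\<sigma> g j)) (g (p j))"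
        unfolding forb_def using gp[OF g ij(1)] gp[OF g ij(2)] per_pos
        by (metis atLeastLessThan_iff less_imp_le mult_nonneg_nonneg)+
      then have "forb (g (p i)) (g (p j))" using ij forb_sym forb_trans by metis
      then show "i = j" using forb_C[OF g] p_unique ij by blast
    qed
    moreover have "\<sigma> g ` {1..m} \<subseteq> {1..m}" using gp(3)[OF g] by blast
    ultimately show "bij_betw (\<sigma> g) {1..m} {1..m}"
      by (simp add: bij_betw_def endo_inj_surj)
  qed (auto simp: \<sigma>_def)
  have mult: "\<sigma> (g \<circ> h) i = \<sigma> g (\<sigma> h i) \<and>
      pos ((g \<circ> h) (p i)) = frac (pos (g (p (\<sigma> h i))) + pos (h (p i)))"
    if gh: "g \<in> C" "h \<in> C" and i: "i \<in> {1..m}" for g h i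
  proof -
    note a = gp[OF gh(2) i] and b = gp[OF gh(1) gp(3)[OF gh(2) i]]
    let ?a = "pos (h (p i))" and ?b = "pos (g (p (\<sigma> h i)))"
    have "(g \<circ> h) (p i) = g (flow (?a * per) (p (\<sigma> h i)))" using a(1) by simp
    also have "\<dots> = flow (?a * per) (g (p (\<sigma> h i)))" using flow_C[OF gh(1)] a(2) per_pos by simp
    also have "\<dots> = flow (?a * per) (flow (?b * per) (p (\<sigma> g (\<sigma> h i))))" using b(1) by simp
    also have "\<dots> = flow ((?b + ?a) * per) (p (\<sigma> g (\<sigma> h i)))"
      using flow_add[of "?b * per" "?a * per"] a(2) b(2) per_pos by (simp add: distrib_right)
    also have "\<dots> = flow (frac (?b + ?a) * per) (p (\<sigma> g (\<sigma> h i)))" using flow_frac a(2) b(2) by simp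
    finally have "idx ((g \<circ> h) (p i)) = \<sigma> g (\<sigma> h i) \<and> pos ((g \<circ> h) (p i)) = frac (?b + ?a)"
      by (intro ip_unique) (use b(3) in \<open>auto simp: frac_lt_1\<close>)
    then show ?thesis using i unfolding \<sigma>_def by simp
  qed
  \<comment> \<open>Coordinate \<open>j\<close> is the rotation with which \<open>g\<close> arrives
    on circle \<open>j\<close>, coming from the circle with index
    \<open>finv (\<sigma> g) j\<close>. Indexing by the target matches the action
    \<open>(s.w)(i) = w(s^-1 i)\<close> in the torus group.\<close>
  define \<psi> where "\<psi> g = ((\<lambda>j\<in>{1..m}. pos (g (p (finv (\<sigma> g) j)))), \<sigma> g)" for g
  have inv_in: "finv (\<sigma> g) j \<in> {1..m}" if "g \<in> C" "j \<in> {1..m}" for g j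
    using permutes_in_image[OF permutes_inv[OF \<sigma>_perm[OF that(1)]]] that(2) by blast
  have hom: "\<psi> \<in> hom (subgrp C) (torus_wreath m)"
  proof (rule homI)
    fix g assume "g \<in> carrier (subgrp C)"
    then have g: "g \<in> C" by simp
    show "\<psi> g \<in> carrier (torus_wreath m)"
      unfolding torus_wreath_def \<psi>_def sym_group_def using \<sigma>_perm[OF g] gp(2)[OF g inv_in[OF g]] by auto
  next
    fix g h assume "g \<in> carrier (subgrp C)" "h \<in> carrier (subgrp C)"
    then have gh: "g \<in> C" "h \<in> C" by auto
    have ghC: "g \<circ> h \<in> C" using monoid.m_closed[OF group.is_monoid[OF group_C], of g h] gh by simp
    have s: "\<sigma> (g \<circ> h) = \<sigma> g \<circ> \<sigma> h"
    proof
      fix i show "\<sigma> (g \<circ> h) i = (\<sigma> g \<circ> \<sigma> h) i"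
        using mult[OF gh, of i] by (cases "i \<in> {1..m}") (auto simp: \<sigma>_def)
    qed
    have "pos ((g \<circ> h) (p (finv (\<sigma> (g \<circ> h)) j))) =
        frac (pos (g (p (finv (\<sigma> g) j))) + pos (h (p (finv (\<sigma> h) (finv (\<sigma> g) j)))))"
      if j: "j \<in> {1..m}" for j
    proof -
      let ?i = "finv (\<sigma> h) (finv (\<sigma> g) j)"
      have i: "?i \<in> {1..m}" using inv_in gh j by blast
      have "finv (\<sigma> (g \<circ> h)) j = ?i"
        unfolding s using permutes_bij[OF \<sigma>_perm[OF gh(1)]] permutes_bij[OF \<sigma>_perm[OF gh(2)]]
        by (simp add: o_inv_distrib)
      moreover have "\<sigma> h ?i = finv (\<sigma> g) j" using permutes_inverses(1)[OF \<sigma>_perm[OF gh(2)]] by simp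
      ultimately show ?thesis using mult[OF gh i] by simp
    qed
    then show "\<psi> (g \<otimes>\<^bsub>subgrp C\<^esub> h) = \<psi> g \<otimes>\<^bsub>torus_wreath m\<^esub> \<psi> h"
      unfolding torus_wreath_def \<psi>_def using inv_in[OF gh(1)] by (auto simp: s restrict_def fun_eq_iff simp del: comp_apply)
  qed
  have inj: "inj_on \<psi> C"
  proof (rule inj_onI)
    fix g h assume gh: "g \<in> C" "h \<in> C" "\<psi> g = \<psi> h"
    then have s: "\<sigma> g = \<sigma> h" unfolding \<psi>_def by simp
    have v: "pos (g (p (finv (\<sigma> g) j))) = pos (h (p (finv (\<sigma> g) j)))" if j: "j \<in> {1..m}" for j
    proof -
      have "fst (\<psi> g) j = fst (\<psi> h) j" using gh(3) by simp
      then show ?thesis using j unfolding \<psi>_def by (simp add: s)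
    qed
    \<comment> \<open>A single base point is enough here: rigidity extends equality at
      \<open>p 1\<close> to all of \<open>J\<close>, including the other circles.\<close>
    have 1: "1 \<in> {1..m}" using m by auto
    have "pos (g (p 1)) = pos (h (p 1))"
      using v[OF gp(3)[OF gh(1) 1]] permutes_inverses(2)[OF \<sigma>_perm[OF gh(1)]] by simp
    then have "g (p 1) = h (p 1)" using gp(1)[OF gh(1) 1] gp(1)[OF gh(2) 1] s by metis
    then have "g x = h x" if "x \<in> J" for x
      using centralizer_agree[OF C_cent[OF gh(1)] C_cent[OF gh(2)] _ _ that] p[OF 1] by blast
    then show "g = h" using C_out[OF gh(1)] C_out[OF gh(2)] by (metis ext)
  qed
  have diag: "diagonal m \<subseteq> \<psi> ` C"
  proof
    fix z assume "z \<in> diagonal m"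
    then obtain t where t: "z = ((\<lambda>i\<in>{1..m}. t), id)" "t \<in> {0..<1}" unfolding diagonal_def by blast
    \<comment> \<open>The flow preserves every circle and advances all base points by the same
      fraction of the period.\<close>
    let ?g = "flow (t * per)"
    have g: "?g \<in> C" using flow_in_C t per_pos by auto
    have u: "idx (?g (p i)) = i \<and> pos (?g (p i)) = t" if "i \<in> {1..m}" for i
      using ip_unique[OF that t(2)] by blast
    then have "\<sigma> ?g = id" unfolding \<sigma>_def by auto
    then have "\<psi> ?g = z" unfolding \<psi>_def t(1) using u by (auto simp: restrict_def)
    then show "z \<in> \<psi> ` C" using g by blast
  qed
  show ?thesis using m hom inj diag by blast
qed

end

lemma (in iet_component) component_dichotomy:
  "(infinite C \<and> virtually_cyclic (subgrp C)) \<or>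
   (\<exists>m \<ge> 1. \<exists>\<psi>. \<psi> \<in> hom (subgrp C) (torus_wreath m) \<and> inj_on \<psi> C \<and> diagonal m \<subseteq> \<psi> ` C)"
proof (cases "finite S")
  case True
  then interpret iet_finite_component f J by unfold_locales
  show ?thesis using torus_embedding by blast
next
  case False
  then show ?thesis using infinite_C virtually_cyclic_C by blast
qed

section \<open>The periodic part\<close>

text \<open>A length-preserving rearrangement into one interval; \<open>l = 0\<close> accounts for
  the empty set.\<close>

definition stackable :: "real set \<Rightarrow> bool" where
  "stackable W \<longleftrightarrow> (\<exists>l\<ge>0. \<exists>\<alpha>. paff 1 \<alpha> W \<and> bij_betw \<alpha> W {0..<l})"

lemma stackable_interval: "stackable {a..<b}"
proof (cases "a \<le> b")
  case True
  have "paff 1 (\<lambda>x. x - a) {a..<b}" by (rule paff_interval[where c="-a"]) auto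
  moreover have "bij_betw (\<lambda>x. x - a) {a..<b} {0..<b-a}"
    by (rule bij_betw_byWitness[where f'="\<lambda>y. y + a"]) auto
  ultimately show ?thesis unfolding stackable_def using True by (intro exI[of _ "b - a"]) auto
next
  case False
  then show ?thesis unfolding stackable_def by (intro exI[of _ 0]) auto
qed

lemma stackable_Un:
  assumes "stackable A" "stackable B" "A \<inter> B = {}" shows "stackable (A \<union> B)"
proof -
  obtain l \<alpha> where a: "0 \<le> l" "paff 1 \<alpha> A" "bij_betw \<alpha> A {0..<l}" using assms(1) stackable_def by blast
  obtain k \<beta> where b: "0 \<le> k" "paff 1 \<beta> B" "bij_betw \<beta> B {0..<k}" using assms(2) stackable_def by blast
  define \<gamma> where "\<gamma> x = (if x \<in> A then \<alpha> x else l + \<beta> x)" for x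
  have "bij_betw \<gamma> A {0..<l}" using a(3) by (rule bij_betw_cong[THEN iffD1, rotated]) (simp add: \<gamma>_def)
  moreover have "bij_betw (\<lambda>y. l + y) {0..<k} {l..<l+k}"
    by (rule bij_betw_byWitness[where f'="\<lambda>y. y - l"]) auto
  from bij_betw_trans[OF b(3) this] have "bij_betw \<gamma> B {l..<l+k}"
    by (rule bij_betw_cong[THEN iffD1, rotated]) (use assms(3) in \<open>auto simp: \<gamma>_def\<close>)
  ultimately have "bij_betw \<gamma> (A \<union> B) ({0..<l} \<union> {l..<l+k})" by (rule bij_betw_combine) auto
  moreover have "{0..<l} \<union> {l..<l+k} = {0..<l+k}" using a b by auto
  moreover have "paff 1 \<gamma> A" by (rule paff_cong[OF a(2)]) (simp add: \<gamma>_def)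
  moreover have "paff 1 (\<lambda>y. l + y) {0..<k}" by (rule paff_interval[where c=l]) auto
  then have "paff (1*1) ((\<lambda>y. l + y) \<circ> \<beta>) B"
    by (rule paff_comp[OF b(2)]) (use bij_betw_imp_surj_on[OF b(3)] in auto)
  then have "paff 1 ((\<lambda>y. l + y) \<circ> \<beta>) B" by simp
  then have "paff 1 \<gamma> B" by (rule paff_cong) (use assms(3) in \<open>auto simp: \<gamma>_def\<close>)
  ultimately show ?thesis unfolding stackable_def using a(1) b(1)
    by (intro exI[of _ "l + k"]) auto
qed

text \<open>Removing an interval from an interval leaves two disjoint intervals, so describing a set
  by what is removed yields disjoint pieces without any sorting. The recursion enters both
  remainders, hence the generalisation over \<open>a\<close> and \<open>b\<close>.\<close>

lemma stackable_interval_Diff: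
  assumes "finite P" shows "stackable ({a..<b} - (\<Union>(c,d)\<in>P. {c..<d}))"
  using assms
proof (induction P arbitrary: a b rule: finite_induct)
  case empty
  then show ?case using stackable_interval by simp
next
  case (insert q P)
  obtain c d where q: "q = (c,d)" by (cases q)
  let ?U = "\<Union>(c,d)\<in>P. {c..<d}"
  show ?case
  proof (cases "c < d")
    case True
    have "{a..<b} - (\<Union>(c,d)\<in>insert q P. {c..<d}) = ({a..<b} - {c..<d}) - ?U" unfolding q by auto
    also have "{a..<b} - {c..<d} = {a..<min b c} \<union> {max a d..<b}" using True by auto
    also have "\<dots> - ?U = ({a..<min b c} - ?U) \<union> ({max a d..<b} - ?U)" by blast
    finally have eq: "{a..<b} - (\<Union>(c,d)\<in>insert q P. {c..<d}) = \<dots>" .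
    have "{a..<min b c} \<inter> {max a d..<b} = {}" using True by auto
    then have "({a..<min b c} - ?U) \<inter> ({max a d..<b} - ?U) = {}" by blast
    then show ?thesis unfolding eq using insert.IH by (intro stackable_Un)
  next
    case False
    then show ?thesis using insert.IH[of a b] unfolding q by auto
  qed
qed

lemma hoi_rescale:
  assumes E: "hoi E" "E \<subseteq> {0..<1}" "E \<noteq> {}" and c: "c > 0"
  shows "\<exists>k>0. \<exists>\<alpha>. paff k \<alpha> E \<and> bij_betw \<alpha> E {0..<c}"
proof -
  \<comment> \<open>Complementing twice presents \<open>E\<close> as an interval with finitely many
    intervals removed.\<close>
  obtain P where P: "finite P" "{0..<1} - E = (\<Union>(a,b)\<in>P. {a..<b})"
    using hoi_Diff[OF hoi_interval E(1), of 0 1] hoi_def by auto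
  have "E = {0..<1} - (\<Union>(a,b)\<in>P. {a..<b})" using E(2) P(2)[symmetric] by blast
  then have "stackable E" using stackable_interval_Diff[OF P(1), of 0 1] by simp
  then obtain l \<alpha> where a: "0 \<le> l" "paff 1 \<alpha> E" "bij_betw \<alpha> E {0..<l}" using stackable_def by blast
  have "l > 0" using a E(3) bij_betw_imp_surj_on[OF a(3)] by (cases "l = 0") auto
  define k where "k = c / l"
  have k: "k > 0" "c = k * l" unfolding k_def using \<open>l > 0\<close> c by auto
  have "bij_betw (\<lambda>y. k * y) {0..<l} {0..<c}"
    by (rule bij_betw_byWitness[where f'="\<lambda>y. y / k"]) (use k in \<open>auto simp: field_simps\<close>)
  from bij_betw_trans[OF a(3) this] have "bij_betw ((\<lambda>y. k * y) \<circ> \<alpha>) E {0..<c}" .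
  moreover have "paff k (\<lambda>y. k * y) {0..<l}" by (rule paff_interval[where c=0]) auto
  then have "paff (k * 1) ((\<lambda>y. k * y) \<circ> \<alpha>) E"
    by (rule paff_comp[OF a(2)]) (use bij_betw_imp_surj_on[OF a(3)] in auto)
  ultimately show ?thesis using k(1) by auto
qed

context iet begin

section \<open>Points of exact period p as a rescaled rotation\<close>

definition min_per :: "nat \<Rightarrow> real set" where
  "min_per p = {x \<in> {0..<1}. (f ^^ p) x = x \<and> (\<forall>q. 0 < q \<longrightarrow> q < p \<longrightarrow> (f ^^ q) x \<noteq> x)}"

lemma min_per_unit: "min_per p \<subseteq> {0..<1}" unfolding min_per_def by blast

lemma min_per_hoi: "hoi (min_per p)"
proof -
  have "min_per p = {x \<in> {0..<1}. (f ^^ p) x = x} - (\<Union>q\<in>{0<..<p}. {x \<in> {0..<1}. (f ^^ q) x = x})"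
    unfolding min_per_def by auto
  moreover have "hoi \<dots>" by (intro hoi_Diff hoi_UN hoi_fpow_fix) auto
  ultimately show ?thesis by simp
qed

text \<open>The periods are taken positive because \<open>min_per 0\<close> is the whole unit
  interval.\<close>

lemma min_per_disj: "0 < p \<Longrightarrow> 0 < q \<Longrightarrow> x \<in> min_per p \<Longrightarrow> x \<in> min_per q \<Longrightarrow> p = q"
  unfolding min_per_def by (metis (mono_tags, lifting) linorder_neqE_nat mem_Collect_eq)

lemma centralizer_min_per:
  assumes g: "g \<in> centralizer f" shows "g x \<in> min_per p \<longleftrightarrow> x \<in> min_per p"
proof -
  have "g \<in> carrier IET" using g centralizer_iff by blast
  then show ?thesis unfolding min_per_def
    by (simp add: centralizer_funpow[OF g] IET_inj IET_unit del: atLeastLessThan_iff)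
qed

lemma min_per_fpow: "(f ^^ n) x \<in> min_per p \<longleftrightarrow> x \<in> min_per p"
  using fpow_inv_set centralizer_min_per[OF f_cent] .

lemma min_per_inj:
  assumes "x \<in> min_per p" "i < p" "j < p" "(f ^^ i) x = (f ^^ j) x" shows "i = j"
proof -
  have no: False if "i < j" "j < p" "(f ^^ i) x = (f ^^ j) x" for i j
  proof -
    have "(f ^^ i) ((f ^^ (j - i)) x) = (f ^^ i) x"
      using that by (metis add_diff_inverse_nat comp_apply funpow_add less_imp_not_less)
    then have "(f ^^ (j - i)) x = x" using fpow_inj by blast
    then show False using assms(1) that unfolding min_per_def by auto
  qed
  show ?thesis using no[of i j] no[of j i] assms by (cases i j rule: linorder_cases) auto
qed

definition fund :: "nat \<Rightarrow> real set" where
  "fund p = {x \<in> min_per p. \<forall>i<p. x \<le> (f ^^ i) x}"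

text \<open>Whether \<open>x\<close> is at most its \<open>i\<close>-th iterate depends only on the
  displacement under that power, so each comparison selects whole pieces.\<close>

lemma fund_hoi: assumes "p > 0" shows "hoi (fund p)"
proof -
  have "fund p = (\<Inter>i\<in>{..<p}. {x \<in> min_per p. x \<le> (f ^^ i) x})" unfolding fund_def using assms by auto
  moreover have "hoi {x \<in> min_per p. x \<le> (f ^^ i) x}" for i
    by (rule hoi_filter[of "f ^^ i"]) (use IET_paff[OF IET_funpow[OF fI] min_per_hoi min_per_unit] in auto)
  then have "hoi (\<Inter>i\<in>{..<p}. {x \<in> min_per p. x \<le> (f ^^ i) x})" using assms by (intro hoi_INT) auto
  ultimately show ?thesis by simp
qed

lemma fund_ex:
  assumes p: "p > 0" and x: "x \<in> min_per p" shows "\<exists>i e. i < p \<and> e \<in> fund p \<and> x = (f ^^ i) e"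
proof -
  define Or where "Or = (\<lambda>i. (f ^^ i) x) ` {..<p}"
  have per: "(f ^^ p) x = x" using x unfolding min_per_def by blast
  have Or: "(f ^^ n) x \<in> Or" for n
    using funpow_mod_eq[OF per, of n] p unfolding Or_def by (metis imageI lessThan_iff mod_less_divisor)
  have fin: "finite Or" "Or \<noteq> {}" unfolding Or_def using p by auto
  have "Min Or \<in> Or" using fin by (rule Min_in)
  then obtain j where j: "j < p" "Min Or = (f ^^ j) x" unfolding Or_def by auto
  define e where "e = (f ^^ j) x"
  have "e \<le> (f ^^ i) e" for i
  proof -
    have "(f ^^ i) e = (f ^^ (i + j)) x" unfolding e_def by (simp add: funpow_add)
    then show ?thesis using Min_le[OF fin(1) Or, of "i + j"] j e_def by simp
  qed
  moreover have eA: "e \<in> min_per p" unfolding e_def using min_per_fpow x by blast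
  ultimately have "e \<in> fund p" unfolding fund_def by blast
  \<comment> \<open>The \<open>mod\<close> takes care of \<open>j = 0\<close>, where
    \<open>p - j\<close> equals \<open>p\<close> and is not a legal exponent.\<close>
  moreover have "x = (f ^^ ((p - j) mod p)) e"
  proof -
    have "(f ^^ p) e = e" using eA unfolding min_per_def by blast
    then have "(f ^^ ((p - j) mod p)) e = (f ^^ (p - j)) e" by (rule funpow_mod_eq)
    also have "\<dots> = (f ^^ (p - j + j)) x" unfolding e_def by (simp add: funpow_add)
    finally show ?thesis using j per by simp
  qed
  ultimately show ?thesis using p by (metis mod_less_divisor)
qed

text \<open>Two orbit minima on the same orbit are each at most the other, hence equal; then the
  exponents agree because the period is exact.\<close>

lemma fund_unique:
  assumes p: "p > 0" and e: "e \<in> fund p" "e' \<in> fund p" and i: "i < p" "i' < p" and eq: "(f ^^ i) e = (f ^^ i') e'"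
  shows "i = i' \<and> e = e'"
proof -
  have le: "e \<le> e'" if e: "e \<in> fund p" "e' \<in> fund p" and i: "i < p" "i' < p" and eq: "(f ^^ i) e = (f ^^ i') e'" for e e' i i'
  proof -
    have pe: "(f ^^ p) e = e" "(f ^^ p) e' = e'" using e unfolding fund_def min_per_def by blast+
    have "(f ^^ (p - i' + i)) e = (f ^^ (p - i' + i')) e'" using eq by (simp add: funpow_add)
    then have "(f ^^ (p - i' + i)) e = e'" using i pe by simp
    then have "e' = (f ^^ ((p - i' + i) mod p)) e" using funpow_mod_eq[OF pe(1)] by metis
    then show ?thesis using e(1) p unfolding fund_def by auto
  qed
  have "e = e'" using le[OF e i eq] le[OF e(2,1) i(2,1) eq[symmetric]] by simp
  then show ?thesis using min_per_inj[of e p i i'] e i eq unfolding fund_def by auto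
qed

text \<open>The orbit minima are rearranged and rescaled onto \<open>[0, 1/p)\<close>, and their
  \<open>i\<close>-th iterates are placed on \<open>[i/p, (i+1)/p)\<close>. Applying
  \<open>f\<close> raises the level by one and wraps around on the last level, which is the rotation
  by \<open>1/p\<close>.\<close>

lemma min_per_model:
  assumes p: "p > 0" and ne: "min_per p \<noteq> {}"
  shows "\<exists>k>0. \<exists>\<theta>. paff k \<theta> (min_per p) \<and> bij_betw \<theta> (min_per p) {0..<1} \<and>
     (\<forall>x\<in>min_per p. \<theta> (f x) = rot (1 / real p) (\<theta> x))"
proof -
  have E: "hoi (fund p)" "fund p \<subseteq> {0..<1}" "fund p \<noteq> {}"
    using fund_hoi[OF p] min_per_unit ne fund_ex[OF p] unfolding fund_def by blast+
  obtain k \<alpha> where k: "k > 0" "paff k \<alpha> (fund p)" "bij_betw \<alpha> (fund p) {0..<1 / real p}"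
    using hoi_rescale[OF E, of "1 / real p"] p by auto
  have "\<forall>x\<in>min_per p. \<exists>i e. i < p \<and> e \<in> fund p \<and> x = (f ^^ i) e" using fund_ex[OF p] by blast
  then obtain I e where Ie: "\<And>x. x \<in> min_per p \<Longrightarrow> I x < p \<and> e x \<in> fund p \<and> x = (f ^^ I x) (e x)" by metis
  define \<theta> where "\<theta> x = \<alpha> (e x) + real (I x) / real p" for x
  have pow_in: "(f ^^ i) y \<in> min_per p" if "y \<in> fund p" for i y using that min_per_fpow unfolding fund_def by blast
  have \<theta>: "\<theta> ((f ^^ i) y) = \<alpha> y + real i / real p" if iy: "i < p" "y \<in> fund p" for i y
  proof -
    note a = Ie[OF pow_in[OF iy(2), of i]]
    have "I ((f ^^ i) y) = i \<and> e ((f ^^ i) y) = y"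
      using fund_unique[OF p, of "e ((f ^^ i) y)" y "I ((f ^^ i) y)" i] a iy by metis
    then show ?thesis unfolding \<theta>_def by simp
  qed
  have \<alpha>: "\<alpha> y \<in> {0..<1 / real p}" if "y \<in> fund p" for y using bij_betwE[OF k(3)] that by blast
  have cover: "min_per p = (\<Union>i\<in>{..<p}. (f ^^ i) ` fund p)"
  proof
    show "min_per p \<subseteq> (\<Union>i\<in>{..<p}. (f ^^ i) ` fund p)" using Ie by blast
    show "(\<Union>i\<in>{..<p}. (f ^^ i) ` fund p) \<subseteq> min_per p" using pow_in by blast
  qed
  have "paff k \<theta> (\<Union>i\<in>{..<p}. (f ^^ i) ` fund p)"
  proof (rule paff_UN)
    fix i assume i: "i \<in> {..<p}"
    let ?g = "f ^^ i"
    have gI: "?g \<in> carrier IET" using fI by simp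
    have "paff (1/1) (finv ?g) (?g ` fund p)"
      by (rule paff_inverse[OF IET_paff[OF gI E(1,2)]]) (simp_all add: IET_finv_left[OF gI])
    moreover have "finv ?g ` (?g ` fund p) \<subseteq> fund p" using IET_finv_left[OF gI] by auto
    ultimately have 1: "paff (k * (1/1)) (\<alpha> \<circ> finv ?g) (?g ` fund p)" using k(2) by (intro paff_comp) auto
    have 2: "paff 1 (\<lambda>y. y + real i / real p) {0..<1 / real p}"
      by (rule paff_interval[where c="real i / real p"]) auto
    have 3: "(\<alpha> \<circ> finv ?g) ` (?g ` fund p) \<subseteq> {0..<1 / real p}"
      using IET_finv_left[OF gI] \<alpha> by (auto simp del: atLeastLessThan_iff)
    have "paff (1 * (k * (1/1))) ((\<lambda>y. y + real i / real p) \<circ> (\<alpha> \<circ> finv ?g)) (?g ` fund p)"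
      by (rule paff_comp[OF 1 2 _ 3]) (use k(1) in simp)
    then have "paff k ((\<lambda>y. y + real i / real p) \<circ> (\<alpha> \<circ> finv ?g)) (?g ` fund p)" by simp
    then show "paff k \<theta> (?g ` fund p)"
      by (rule paff_cong) (use i \<theta> IET_finv_left[OF gI] in auto)
  qed auto
  then have paff: "paff k \<theta> (min_per p)" using cover by simp
  have bij: "bij_betw \<theta> (min_per p) {0..<1}"
    unfolding bij_betw_def
  proof
    \<comment> \<open>The level \<open>i\<close> can be recovered from the value of
      \<open>\<theta>\<close>, which separates the images of different levels.\<close>
    have fl: "\<lfloor>real p * (a + real i / real p)\<rfloor> = int i" if "a \<in> {0..<1 / real p}" for a i
    proof -
      have "0 \<le> real p * a" "real p * a < 1" using that p by (auto simp: field_simps)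
      moreover have "real p * (a + real i / real p) = real p * a + real i" using p by (simp add: field_simps)
      ultimately show ?thesis by (intro floor_unique) auto
    qed
    show "inj_on \<theta> (min_per p)"
    proof (rule inj_onI)
      fix x y assume xy: "x \<in> min_per p" "y \<in> min_per p" "\<theta> x = \<theta> y"
      note a = Ie[OF xy(1)] and b = Ie[OF xy(2)]
      have "int (I x) = int (I y)" using xy(3) fl[OF \<alpha>, of "e x" "I x"] fl[OF \<alpha>, of "e y" "I y"] a b
        unfolding \<theta>_def by metis
      then have I: "I x = I y" by simp
      then have "\<alpha> (e x) = \<alpha> (e y)" using xy(3) unfolding \<theta>_def by simp
      then have "e x = e y" using bij_betw_imp_inj_on[OF k(3)] a b by (meson inj_onD)
      then show "x = y" using a b I by metis
    qed
    show "\<theta> ` min_per p = {0..<1}"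
    proof
      show "\<theta> ` min_per p \<subseteq> {0..<1}"
      proof (rule image_subsetI)
        fix x assume x: "x \<in> min_per p"
        note a = Ie[OF x]
        have b: "0 \<le> \<alpha> (e x)" "\<alpha> (e x) < 1 / real p" using \<alpha>[of "e x"] a by auto
        have "real (I x) + 1 \<le> real p" using a by linarith
        then have "(real (I x) + 1) / real p \<le> 1" using p by simp
        then have "\<alpha> (e x) + real (I x) / real p < 1" using b by (simp add: add_divide_distrib)
        then show "\<theta> x \<in> {0..<1}" unfolding \<theta>_def using b by simp
      qed
      show "{0..<1} \<subseteq> \<theta> ` min_per p"
      proof
        fix y :: real assume y: "y \<in> {0..<1}"
        define i where "i = nat \<lfloor>real p * y\<rfloor>"
        have i0: "real i \<le> real p * y" "real p * y < real i + 1" unfolding i_def using y p by auto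
        have "real p * y < real p" using y p by simp
        then have ip: "i < p" using i0 by linarith
        have "real i / real p \<le> y" "y < (real i + 1) / real p"
          using i0 p by (simp_all add: divide_le_eq less_divide_eq mult.commute)
        then have "y - real i / real p \<in> {0..<1 / real p}" by (simp add: add_divide_distrib)
        then obtain z where z: "z \<in> fund p" "\<alpha> z = y - real i / real p" using bij_betw_imp_surj_on[OF k(3)] by (metis imageE)
        then have "\<theta> ((f ^^ i) z) = y" using \<theta>[OF ip z(1)] by simp
        then show "y \<in> \<theta> ` min_per p" using pow_in[OF z(1)] by (metis imageI)
      qed
    qed
  qed
  have "\<theta> (f x) = rot (1 / real p) (\<theta> x)" if x: "x \<in> min_per p" for x
  proof -
    note a = Ie[OF x]
    have unit: "\<theta> z \<in> {0..<1}" if "z \<in> min_per p" for z using bij_betwE[OF bij] that by blast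
    have fx: "f x \<in> min_per p" using x centralizer_min_per[OF f_cent] by blast
    have fe: "f x = (f ^^ Suc (I x)) (e x)" using a by simp
    have tx: "\<theta> x + 1 / real p = \<alpha> (e x) + real (Suc (I x)) / real p" unfolding \<theta>_def by (simp add: add_divide_distrib)
    have "frac (\<theta> x + 1 / real p) = \<theta> (f x)"
    proof (cases "Suc (I x) < p")
      case True
      then have "\<theta> (f x) = \<theta> x + 1 / real p" using \<theta>[OF True, of "e x"] a fe tx by metis
      then show ?thesis using unit[OF fx] by (metis atLeastLessThan_iff frac_eq)
    next
      case False
      then have "Suc (I x) = p" using a by auto
      moreover have "(f ^^ p) (e x) = e x" using a unfolding fund_def min_per_def by blast
      ultimately have "f x = e x" "\<theta> x + 1 / real p = \<alpha> (e x) + 1" using fe tx p by auto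
      moreover have "\<theta> (e x) = \<alpha> (e x)" using \<theta>[of 0 "e x"] a p by simp
      ultimately have "\<theta> x + 1 / real p = \<theta> (f x) + 1" by simp
      then have "frac (\<theta> x + 1 / real p) = frac (\<theta> (f x))" by (simp add: frac_1_eq)
      then show ?thesis using unit[OF fx] by (simp add: frac_eq)
    qed
    then show ?thesis unfolding rot_def using unit[OF x] by simp
  qed
  then show ?thesis using k(1) paff bij by blast
qed

lemma PerP_min_per: "x \<in> PerP f \<longleftrightarrow> (\<exists>p>0. x \<in> min_per p)"
proof
  assume x: "x \<in> PerP f"
  then have ex: "\<exists>n. 0 < n \<and> (f ^^ n) x = x" unfolding PerP_def by blast
  define p where "p = (LEAST n. 0 < n \<and> (f ^^ n) x = x)"
  have "0 < p \<and> (f ^^ p) x = x" unfolding p_def using ex by (rule LeastI_ex)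
  moreover have "\<not> (0 < q \<and> (f ^^ q) x = x)" if "q < p" for q using not_less_Least that unfolding p_def by blast
  ultimately show "\<exists>p>0. x \<in> min_per p" using x unfolding min_per_def PerP_def by blast
next
  assume "\<exists>p>0. x \<in> min_per p"
  then show "x \<in> PerP f" unfolding PerP_def min_per_def by blast
qed

lemma FixP_min_per: "FixP f = min_per 1"
  unfolding FixP_def min_per_def by auto

lemma finite_min_pers: "finite {p. 0 < p \<and> min_per p \<noteq> {}}"
proof -
  obtain N where N: "N > 0" "PerP f = {x \<in> {0..<1}. (f ^^ N) x = x}" using PerP_eq by blast
  have "p \<le> N" if p: "0 < p" "min_per p \<noteq> {}" for p
  proof (rule ccontr)
    assume n: "\<not> p \<le> N"
    obtain x where x: "x \<in> min_per p" using p by blast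
    then have "x \<in> PerP f" using PerP_min_per p by blast
    then have "(f ^^ N) x = x" using N by blast
    then show False using x n N(1) unfolding min_per_def by auto
  qed
  then have "{p. 0 < p \<and> min_per p \<noteq> {}} \<subseteq> {..N}" by blast
  then show ?thesis using finite_subset by blast
qed

text \<open>Conjugation by \<open>\<theta> j\<close> turns the restriction to one stratum into a map
  commuting with the rotation by \<open>1 / ms j\<close>. The slopes \<open>k j\<close> and
  \<open>1 / k j\<close> cancel, so the result is a piecewise translation again. Only periods from 2
  on occur, as those of period 1 make up Fix(f).\<close>

lemma periodic_iso:
  "\<exists>(s::nat) (ms::nat \<Rightarrow> nat). (\<forall>j<s. ms j \<ge> 1) \<and>
     subgrp (centralizer f \<inter> E_supp (PerP f - FixP f)) \<cong> product_group {..<s} (\<lambda>j. G_grp (ms j))"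
proof -
  define Ps where "Ps = {p. 2 \<le> p \<and> min_per p \<noteq> {}}"
  have "Ps \<subseteq> {p. 0 < p \<and> min_per p \<noteq> {}}" unfolding Ps_def by auto
  then have "finite Ps" using finite_min_pers finite_subset by blast
  then obtain ms where "bij_betw ms {0..<card Ps} Ps" using ex_bij_betw_nat_finite by blast
  then obtain s where ms: "bij_betw ms {..<s} Ps" by (metis lessThan_atLeast0)
  let ?A = "\<lambda>j. min_per (ms j)"
  let ?K = "centralizer f \<inter> E_supp (PerP f - FixP f)"
  have msP: "ms j \<ge> 2" "?A j \<noteq> {}" if "j < s" for j using bij_betwE[OF ms] that unfolding Ps_def by auto
  have union: "PerP f - FixP f = (\<Union>j<s. ?A j)"
  proof
    show "PerP f - FixP f \<subseteq> (\<Union>j<s. ?A j)"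
    proof
      fix x assume x: "x \<in> PerP f - FixP f"
      then obtain p where p: "p > 0" "x \<in> min_per p" using PerP_min_per by blast
      then have "p \<noteq> 1" using x FixP_min_per by auto
      then have "p \<in> Ps" unfolding Ps_def using p by auto
      then obtain j where "j < s" "p = ms j" using bij_betw_imp_surj_on[OF ms] by blast
      then show "x \<in> (\<Union>j<s. ?A j)" using p by blast
    qed
    show "(\<Union>j<s. ?A j) \<subseteq> PerP f - FixP f"
    proof
      fix x assume "x \<in> (\<Union>j<s. ?A j)"
      then obtain j where j: "j < s" "x \<in> ?A j" by blast
      have "x \<in> PerP f" using PerP_min_per[of x] j msP(1)[OF j(1)] by (metis less_le_trans pos2)
      moreover have "x \<notin> FixP f" using min_per_disj[of 1 "ms j" x] j msP(1)[OF j(1)] unfolding FixP_min_per by auto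
      ultimately show "x \<in> PerP f - FixP f" by blast
    qed
  qed
  have disj: "i = j" if "i < s" "j < s" "x \<in> ?A i" "x \<in> ?A j" for i j x
  proof -
    have "ms i = ms j" using min_per_disj[of "ms i" "ms j" x] that msP(1)[OF that(1)] msP(1)[OF that(2)] by auto
    then show ?thesis using bij_betw_imp_inj_on[OF ms] that by (metis inj_onD lessThan_iff)
  qed
  have "\<forall>j\<in>{..<s}. \<exists>k \<theta>. k > 0 \<and> paff k \<theta> (?A j) \<and> bij_betw \<theta> (?A j) {0..<1} \<and>
     (\<forall>x\<in>?A j. \<theta> (f x) = rot (1 / real (ms j)) (\<theta> x))"
  proof
    fix j assume "j \<in> {..<s}"
    then show "\<exists>k \<theta>. k > 0 \<and> paff k \<theta> (?A j) \<and> bij_betw \<theta> (?A j) {0..<1} \<and>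
     (\<forall>x\<in>?A j. \<theta> (f x) = rot (1 / real (ms j)) (\<theta> x))"
      using min_per_model[of "ms j"] msP[of j] by force
  qed
  then obtain k \<theta> where "\<forall>j\<in>{..<s}. k j > 0 \<and> paff (k j) (\<theta> j) (?A j) \<and> bij_betw (\<theta> j) (?A j) {0..<1} \<and>
     (\<forall>x\<in>?A j. \<theta> j (f x) = rot (1 / real (ms j)) (\<theta> j x))" by metis
  then have k: "\<And>j. j < s \<Longrightarrow> k j > 0" and tpaff: "\<And>j. j < s \<Longrightarrow> paff (k j) (\<theta> j) (?A j)"
    and tbij: "\<And>j. j < s \<Longrightarrow> bij_betw (\<theta> j) (?A j) {0..<1}"
    and trot: "\<And>j x. j < s \<Longrightarrow> x \<in> ?A j \<Longrightarrow> \<theta> j (f x) = rot (1 / real (ms j)) (\<theta> j x)" by auto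
  define \<tau> where "\<tau> j = inv_into (?A j) (\<theta> j)" for j
  have \<tau>\<theta>: "\<tau> j (\<theta> j x) = x" if "j < s" "x \<in> ?A j" for j x
    unfolding \<tau>_def using tbij that by (meson bij_betw_inv_into_left)
  have \<theta>\<tau>: "\<theta> j (\<tau> j y) = y" "\<tau> j y \<in> ?A j" if "j < s" "y \<in> {0..<1}" for j y
    unfolding \<tau>_def using tbij that by (meson bij_betw_inv_into_right, meson bij_betw_inv_into bij_betwE)
  have \<theta>u: "\<theta> j x \<in> {0..<1}" if "j < s" "x \<in> ?A j" for j x using tbij that bij_betwE by blast
  have \<tau>paff: "paff (1 / k j) (\<tau> j) {0..<1}" if j: "j < s" for j
  proof -
    have "paff (1 / k j) (\<tau> j) (\<theta> j ` ?A j)" using paff_inverse[OF tpaff[OF j] k[OF j]] \<tau>\<theta>[OF j] by blast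
    then show ?thesis using bij_betw_imp_surj_on[OF tbij[OF j]] by simp
  qed
  have \<tau>bij: "bij_betw (\<tau> j) {0..<1} (?A j)" if j: "j < s" for j
    unfolding \<tau>_def using tbij[OF j] by (rule bij_betw_inv_into)
  have \<tau>rot: "\<tau> j (rot (1 / real (ms j)) y) = f (\<tau> j y)" if jy: "j < s" "y \<in> {0..<1}" for j y
    using trot[OF jy(1) \<theta>\<tau>(2)[OF jy]] \<theta>\<tau>(1)[OF jy] \<tau>\<theta>[OF jy(1), of "f (\<tau> j y)"]
      centralizer_min_per[OF f_cent] \<theta>\<tau>(2)[OF jy] by metis
  have rot_unit: "rot t y \<in> {0..<1} \<longleftrightarrow> y \<in> {0..<1}" for t y unfolding rot_def by (auto simp: frac_lt_1)
  define \<Phi> where "\<Phi> h = (\<lambda>j\<in>{..<s}. \<lambda>y. if y \<in> {0..<1} then \<theta> j (h (\<tau> j y)) else y)" for h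
  have hA: "h x \<in> ?A j \<longleftrightarrow> x \<in> ?A j" if "h \<in> ?K" for h x j using centralizer_min_per that by blast
  have \<Phi>in: "\<Phi> h j \<in> centralizer (rot (1 / real (ms j)))" if h: "h \<in> ?K" and j: "j < s" for h j
    unfolding centralizer_iff
  proof
    have hI: "h \<in> carrier IET" and hc: "\<And>x. f (h x) = h (f x)" using h centralizer_iff by auto
    have hb: "bij_betw h (?A j) (?A j)"
    proof (rule bij_betw_byWitness[where f'="finv h"])
      show "finv h ` ?A j \<subseteq> ?A j" using hA[OF h, of "finv h _" j] hI by (auto simp: IET_finv_right)
    qed (use hA[OF h] hI in auto)
    have \<Phi>eq: "\<Phi> h j y = (\<theta> j \<circ> (h \<circ> \<tau> j)) y" if "y \<in> {0..<1}" for y using j that by (simp add: \<Phi>_def)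
    show "\<Phi> h j \<in> carrier IET" unfolding IET_iff
    proof (intro conjI)
      show "\<forall>x. x \<notin> {0..<1} \<longrightarrow> \<Phi> h j x = x" using j by (simp add: \<Phi>_def)
      have "bij_betw (\<theta> j \<circ> (h \<circ> \<tau> j)) {0..<1} {0..<1}"
        using bij_betw_trans[OF bij_betw_trans[OF \<tau>bij[OF j] hb] tbij[OF j]] .
      then show "bij_betw (\<Phi> h j) {0..<1} {0..<1}"
        by (rule bij_betw_cong[THEN iffD1, rotated]) (use \<Phi>eq in simp)
      have "paff (1 * (1 / k j)) (h \<circ> \<tau> j) {0..<1}"
        by (rule paff_comp[OF \<tau>paff[OF j] IET_paff[OF hI min_per_hoi min_per_unit]])
           (use k[OF j] bij_betw_imp_surj_on[OF \<tau>bij[OF j]] in auto)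
      then have "paff (k j * (1 * (1 / k j))) (\<theta> j \<circ> (h \<circ> \<tau> j)) {0..<1}"
        by (rule paff_comp[OF _ tpaff[OF j]])
           (use k[OF j] bij_betw_imp_surj_on[OF bij_betw_trans[OF \<tau>bij[OF j] hb]] in auto)
      then have "paff 1 (\<theta> j \<circ> (h \<circ> \<tau> j)) {0..<1}" using k[OF j] by simp
      then show "paff 1 (\<Phi> h j) {0..<1}" by (rule paff_cong) (use \<Phi>eq in simp)
    qed
    show "\<forall>y. rot (1 / real (ms j)) (\<Phi> h j y) = \<Phi> h j (rot (1 / real (ms j)) y)"
    proof
      fix y show "rot (1 / real (ms j)) (\<Phi> h j y) = \<Phi> h j (rot (1 / real (ms j)) y)"
      proof (cases "y \<in> {0..<1}")
        case True
        have "rot (1 / real (ms j)) (\<Phi> h j y) = \<theta> j (f (h (\<tau> j y)))"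
          using trot[OF j, of "h (\<tau> j y)"] hA[OF h] \<theta>\<tau>(2)[OF j True] \<Phi>eq[OF True] by simp
        also have "\<dots> = \<theta> j (h (\<tau> j (rot (1 / real (ms j)) y)))" using \<tau>rot[OF j True] hc by simp
        also have "\<dots> = \<Phi> h j (rot (1 / real (ms j)) y)" using \<Phi>eq rot_unit True by (metis comp_apply)
        finally show ?thesis .
      next
        case False
        then have "rot (1 / real (ms j)) y = y" unfolding rot_def by (rule if_not_P)
        then show ?thesis using False j by (simp add: \<Phi>_def del: atLeastLessThan_iff)
      qed
    qed
  qed
  have "\<Phi> \<in> Group.iso (subgrp ?K) (product_group {..<s} (\<lambda>j. G_grp (ms j)))"
    unfolding Group.iso_def
  proof (intro CollectI conjI)
    show "\<Phi> \<in> hom (subgrp ?K) (product_group {..<s} (\<lambda>j. G_grp (ms j)))"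
    proof (rule homI)
      fix h assume h: "h \<in> carrier (subgrp ?K)"
      have "\<Phi> h \<in> extensional {..<s}" unfolding \<Phi>_def by simp
      then show "\<Phi> h \<in> carrier (product_group {..<s} (\<lambda>j. G_grp (ms j)))"
        using \<Phi>in h unfolding G_grp_def by (auto simp: PiE_def)
    next
      fix h g assume "h \<in> carrier (subgrp ?K)" "g \<in> carrier (subgrp ?K)"
      then have hg: "h \<in> ?K" "g \<in> ?K" by auto
      have "\<Phi> (h \<circ> g) j = \<Phi> h j \<circ> \<Phi> g j" if j: "j < s" for j
      proof
        fix y
        show "\<Phi> (h \<circ> g) j y = (\<Phi> h j \<circ> \<Phi> g j) y"
        proof (cases "y \<in> {0..<1}")
          case True
          have gA: "g (\<tau> j y) \<in> ?A j" using hA[OF hg(2)] \<theta>\<tau>(2)[OF j True] by blast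
          then show ?thesis using True j \<tau>\<theta>[OF j gA] \<theta>u[OF j gA] by (simp add: \<Phi>_def)
        next
          case False
          then show ?thesis using j by (simp add: \<Phi>_def del: atLeastLessThan_iff)
        qed
      qed
      moreover have "\<Phi> (h \<circ> g) j = undefined" if "\<not> j < s" for j using that by (simp add: \<Phi>_def)
      ultimately show "\<Phi> (h \<otimes>\<^bsub>subgrp ?K\<^esub> g) = \<Phi> h \<otimes>\<^bsub>product_group {..<s} (\<lambda>j. G_grp (ms j))\<^esub> \<Phi> g"
        by (auto simp: product_group_def G_grp_def restrict_def fun_eq_iff simp del: comp_apply)
    qed
    have inj: "inj_on \<Phi> ?K"
    proof (rule inj_onI)
      fix h g assume hg: "h \<in> ?K" "g \<in> ?K" "\<Phi> h = \<Phi> g"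
      show "h = g"
      proof
        fix x show "h x = g x"
        proof (cases "\<exists>j<s. x \<in> ?A j")
          case True
          then obtain j where j: "j < s" "x \<in> ?A j" by blast
          have "\<Phi> h j (\<theta> j x) = \<Phi> g j (\<theta> j x)" using hg by simp
          then have "\<theta> j (h x) = \<theta> j (g x)" using \<theta>u[OF j] \<tau>\<theta>[OF j] j by (simp add: \<Phi>_def)
          then show ?thesis using \<tau>\<theta>[OF j(1), of "h x"] \<tau>\<theta>[OF j(1), of "g x"] hA[OF hg(1)] hA[OF hg(2)] j(2) by metis
        next
          case False
          then have "x \<notin> PerP f - FixP f" using union by blast
          then show ?thesis using hg by (auto simp: E_supp_iff)
        qed
      qed
    qed
    have surj: "\<Phi> ` ?K = carrier (product_group {..<s} (\<lambda>j. G_grp (ms j)))"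
    proof
      show "\<Phi> ` ?K \<subseteq> carrier (product_group {..<s} (\<lambda>j. G_grp (ms j)))"
        using \<open>\<Phi> \<in> hom _ _\<close> unfolding hom_def by auto
      show "carrier (product_group {..<s} (\<lambda>j. G_grp (ms j))) \<subseteq> \<Phi> ` ?K"
      proof
        fix G assume "G \<in> carrier (product_group {..<s} (\<lambda>j. G_grp (ms j)))"
        then have Gc: "\<And>j. j < s \<Longrightarrow> G j \<in> centralizer (rot (1 / real (ms j)))" and Ge: "G \<in> extensional {..<s}"
          by (auto simp: G_grp_def PiE_def)
        have GI: "G j \<in> carrier IET" if "j < s" for j using Gc[OF that] centralizer_iff by blast
        define h where "h x = (if \<exists>j<s. x \<in> ?A j then (let j = THE j. j < s \<and> x \<in> ?A j in \<tau> j (G j (\<theta> j x))) else x)" for x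
        have h: "h x = \<tau> j (G j (\<theta> j x))" if j: "j < s" "x \<in> ?A j" for j x
        proof -
          have "(THE j. j < s \<and> x \<in> ?A j) = j" by (rule the_equality) (use j disj in auto)
          then show ?thesis unfolding h_def using j by auto
        qed
        have hin: "h x \<in> ?A j" if j: "j < s" "x \<in> ?A j" for j x
          using h[OF j] \<theta>\<tau>(2)[OF j(1)] IET_unit[OF GI[OF j(1)]] \<theta>u[OF j] by simp
        have hout: "h x = x" if "\<And>j. j < s \<Longrightarrow> x \<notin> ?A j" for x using that unfolding h_def by auto
        have hI: "h \<in> carrier IET"
        proof (rule glue_IET[where I="{..<s}" and W="?A" and \<pi>=id])
          fix j assume "j \<in> {..<s}"
          then have j: "j < s" by simp
          have Gb: "bij_betw (G j) {0..<1} {0..<1}" "paff 1 (G j) {0..<1}" using GI[OF j] IET_iff by auto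
          have "bij_betw (\<tau> j \<circ> (G j \<circ> \<theta> j)) (?A j) (?A j)"
            using bij_betw_trans[OF bij_betw_trans[OF tbij[OF j] Gb(1)] \<tau>bij[OF j]] .
          then have b: "bij_betw h (?A j) (?A j)"
            by (rule bij_betw_cong[THEN iffD1, rotated]) (use h[OF j] in simp)
          have "paff (1 * k j) (G j \<circ> \<theta> j) (?A j)"
            by (rule paff_comp[OF tpaff[OF j] Gb(2) k[OF j]]) (use bij_betw_imp_surj_on[OF tbij[OF j]] in auto)
          then have "paff (1 / k j * (1 * k j)) (\<tau> j \<circ> (G j \<circ> \<theta> j)) (?A j)"
            by (rule paff_comp[OF _ \<tau>paff[OF j]])
               (use k[OF j] bij_betw_imp_surj_on[OF bij_betw_trans[OF tbij[OF j] Gb(1)]] in auto)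
          then have "paff 1 (\<tau> j \<circ> (G j \<circ> \<theta> j)) (?A j)" using k[OF j] by simp
          then have "paff 1 h (?A j)" by (rule paff_cong) (use h[OF j] in simp)
          then show "?A j \<subseteq> {0..<1} \<and> bij_betw h (?A j) (?A (id j)) \<and> paff 1 h (?A j)"
            using b min_per_unit by simp
        next
          show "disjoint_family_on ?A {..<s}" unfolding disjoint_family_on_def using disj by blast
          show "h x = x" if "\<And>i. i \<in> {..<s} \<Longrightarrow> x \<notin> ?A i" for x using hout that by auto
        qed auto
        have "f (h x) = h (f x)" for x
        proof (cases "\<exists>j<s. x \<in> ?A j")
          case True
          then obtain j where j: "j < s" "x \<in> ?A j" by blast
          have fx: "f x \<in> ?A j" using centralizer_min_per[OF f_cent] j by blast
          have Gu: "G j (\<theta> j x) \<in> {0..<1}" using IET_unit[OF GI[OF j(1)]] \<theta>u[OF j] by blast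
          have "h (f x) = \<tau> j (G j (rot (1 / real (ms j)) (\<theta> j x)))" using h[OF j(1) fx] trot[OF j] by simp
          also have "\<dots> = \<tau> j (rot (1 / real (ms j)) (G j (\<theta> j x)))" using Gc[OF j(1)] centralizer_iff by metis
          also have "\<dots> = f (h x)" using \<tau>rot[OF j(1) Gu] h[OF j] by simp
          finally show ?thesis by simp
        next
          case False
          then have "\<And>j. j < s \<Longrightarrow> f x \<notin> ?A j" using centralizer_min_per[OF f_cent] by blast
          then show ?thesis using hout False by metis
        qed
        then have hK: "h \<in> ?K" using hI hout union by (auto simp: centralizer_iff E_supp_iff)
        have "\<Phi> h j y = G j y" if j: "j < s" for j y
        proof (cases "y \<in> {0..<1}")
          case True
          have "G j y \<in> {0..<1}" using IET_unit[OF GI[OF j]] True by blast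
          then show ?thesis using True j h[OF j \<theta>\<tau>(2)[OF j True]] \<theta>\<tau>(1)[OF j] by (simp add: \<Phi>_def)
        next
          case False
          then show ?thesis using j IET_out[OF GI[OF j] False] by (simp add: \<Phi>_def del: atLeastLessThan_iff)
        qed
        then have "\<Phi> h = G" using Ge by (auto simp: fun_eq_iff \<Phi>_def extensional_def)
        then show "G \<in> \<Phi> ` ?K" using hK by blast
      qed
    qed
    show "bij_betw \<Phi> (carrier (subgrp ?K)) (carrier (product_group {..<s} (\<lambda>j. G_grp (ms j))))"
      unfolding bij_betw_def using inj surj by simp
  qed
  moreover have "\<forall>j<s. ms j \<ge> 1" using msP by fastforce
  ultimately show ?thesis unfolding is_iso_def by blast
qed

end

section \<open>The semidirect product decomposition\<close>

text \<open>Assembling an element from its factors is easier than decomposing it, so the isomorphism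
  is built from \<open>H\<close> to \<open>G\<close> and inverted here. Closure of the carrier
  stands in for a group structure on \<open>H\<close>, which for a \<open>semidirect\<close> product
  is not established separately.\<close>

lemma is_iso_inverse:
  assumes hom: "\<Phi> \<in> hom H G" and bij: "bij_betw \<Phi> (carrier H) (carrier G)"
    and closed: "\<And>x y. x \<in> carrier H \<Longrightarrow> y \<in> carrier H \<Longrightarrow> x \<otimes>\<^bsub>H\<^esub> y \<in> carrier H"
  shows "G \<cong> H"
proof -
  let ?\<Psi> = "inv_into (carrier H) \<Phi>"
  have b: "bij_betw ?\<Psi> (carrier G) (carrier H)" using bij by (rule bij_betw_inv_into)
  have "?\<Psi> \<in> hom G H"
  proof (rule homI)
    fix x assume "x \<in> carrier G"
    then show "?\<Psi> x \<in> carrier H" using bij_betwE[OF b] by blast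
  next
    fix x y assume xy: "x \<in> carrier G" "y \<in> carrier G"
    have in_H: "?\<Psi> x \<in> carrier H" "?\<Psi> y \<in> carrier H" using bij_betwE[OF b] xy by auto
    have "\<Phi> (?\<Psi> x \<otimes>\<^bsub>H\<^esub> ?\<Psi> y) = x \<otimes>\<^bsub>G\<^esub> y"
      using hom_mult[OF hom in_H] bij_betw_inv_into_right[OF bij] xy by simp
    then show "?\<Psi> (x \<otimes>\<^bsub>G\<^esub> y) = ?\<Psi> x \<otimes>\<^bsub>H\<^esub> ?\<Psi> y"
      using bij_betw_inv_into_left[OF bij closed[OF in_H]] by simp
  qed
  then show ?thesis unfolding is_iso_def Group.iso_def using b by blast
qed

text \<open>The action identifies the group with the permutations of \<open>M\<close> preserving the fibres of \<open>rep\<close>.\<close>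
definition fibre_action :: "'a set \<Rightarrow> ('a \<Rightarrow> 'b) \<Rightarrow> 'c monoid \<Rightarrow> ('c \<Rightarrow> 'a \<Rightarrow> 'a) \<Rightarrow> bool" where
  "fibre_action M rep F Q \<longleftrightarrow>
     (\<forall>s\<in>carrier F. bij_betw (Q s) M M \<and> (\<forall>J\<in>M. rep (Q s J) = rep J)) \<and>
     (\<forall>s\<in>carrier F. \<forall>t\<in>carrier F. \<forall>J\<in>M. Q (s \<otimes>\<^bsub>F\<^esub> t) J = Q s (Q t J)) \<and>
     (\<forall>s\<in>carrier F. \<forall>t\<in>carrier F. (\<forall>J\<in>M. Q s J = Q t J) \<longrightarrow> s = t) \<and>
     (\<forall>\<pi>. bij_betw \<pi> M M \<longrightarrow> (\<forall>J\<in>M. rep (\<pi> J) = rep J) \<longrightarrow> (\<exists>s\<in>carrier F. \<forall>J\<in>M. Q s J = \<pi> J))"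

text \<open>Numbering the values of \<open>rep\<close> and the points of each fibre gives
  \<open>J\<close> the coordinates \<open>(jj J, ii J)\<close>; the permutation indexed by the first
  coordinate acts on the second. An empty \<open>M\<close> yields the empty product, which makes the
  permutation part trivial if \<open>f\<close> has finite order.\<close>

lemma ex_fibre_action:
  fixes M :: "'a set" and rep :: "'a \<Rightarrow> 'b"
  assumes fin: "finite M"
  shows "\<exists>(r::nat) ns Q. (M = {} \<longrightarrow> r = 0) \<and> fibre_action M rep (product_group {..<r} (\<lambda>j. sym_group (ns j))) Q"
proof -
  define r where "r = card (rep ` M)"
  obtain c where c: "bij_betw c {..<r} (rep ` M)"
    using ex_bij_betw_nat_finite[of "rep ` M"] fin unfolding r_def by (metis finite_imageI lessThan_atLeast0)
  define fib where "fib j = {J \<in> M. rep J = c j}" for j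
  define ns where "ns j = card (fib j)" for j
  have "\<exists>e. bij_betw e {1..ns j} (fib j)" for j
    unfolding ns_def by (rule ex_bij_betw_nat_finite_1) (use fin in \<open>simp add: fib_def\<close>)
  then obtain e where e: "\<And>j. bij_betw (e j) {1..ns j} (fib j)" by metis
  define jj where "jj J = inv_into {..<r} c (rep J)" for J
  define ii where "ii J = inv_into {1..ns (jj J)} (e (jj J)) J" for J
  have jj: "jj J < r" "c (jj J) = rep J" if "J \<in> M" for J
    unfolding jj_def using that bij_betw_inv_into_right[OF c] bij_betwE[OF bij_betw_inv_into[OF c]] by auto
  have fibJ: "J \<in> fib (jj J)" if "J \<in> M" for J unfolding fib_def using jj that by simp
  have ii: "ii J \<in> {1..ns (jj J)}" "e (jj J) (ii J) = J" if "J \<in> M" for J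
    unfolding ii_def using bij_betw_inv_into_right[OF e fibJ[OF that]] bij_betwE[OF bij_betw_inv_into[OF e]] fibJ[OF that]
    by blast+
  have eM: "e j i \<in> M" "rep (e j i) = c j" if "i \<in> {1..ns j}" for i j
    using bij_betwE[OF e] that unfolding fib_def by blast+
  have jje: "jj (e j i) = j" if "j < r" "i \<in> {1..ns j}" for i j
    unfolding jj_def eM(2)[OF that(2)] using bij_betw_inv_into_left[OF c] that by simp
  have iie: "ii (e j i) = i" if "j < r" "i \<in> {1..ns j}" for i j
    unfolding ii_def jje[OF that] using bij_betw_inv_into_left[OF e] that by blast
  let ?F = "product_group {..<r} (\<lambda>j. sym_group (ns j))"
  have Fj: "s j permutes {1..ns j}" if "s \<in> carrier ?F" "j < r" for s j
    using that by (auto simp: sym_group_def)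
  define Q where "Q s J = e (jj J) (s (jj J) (ii J))" for s J
  have si: "s (jj J) (ii J) \<in> {1..ns (jj J)}" if "s \<in> carrier ?F" "J \<in> M" for s J
    using permutes_in_image[OF Fj[OF that(1) jj(1)[OF that(2)]]] ii(1)[OF that(2)] by blast
  have Q1: "Q s J \<in> M" "rep (Q s J) = rep J" "jj (Q s J) = jj J" "ii (Q s J) = s (jj J) (ii J)"
    if "s \<in> carrier ?F" "J \<in> M" for s J
    unfolding Q_def using eM[OF si[OF that]] jj[OF that(2)] jje[OF jj(1)[OF that(2)] si[OF that]] iie[OF jj(1)[OF that(2)] si[OF that]]
    by simp_all
  have Qmult: "Q (s \<otimes>\<^bsub>?F\<^esub> t) J = Q s (Q t J)"
    if st: "s \<in> carrier ?F" "t \<in> carrier ?F" and J: "J \<in> M" for s t J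
  proof -
    have "Q s (Q t J) = e (jj J) (s (jj J) (t (jj J) (ii J)))"
      unfolding Q_def[of s] using Q1[OF st(2) J] by simp
    moreover have "(s \<otimes>\<^bsub>?F\<^esub> t) (jj J) = s (jj J) \<circ> t (jj J)"
      using jj(1)[OF J] by (simp add: product_group_def sym_group_def)
    ultimately show ?thesis unfolding Q_def[of "s \<otimes>\<^bsub>?F\<^esub> t"] by simp
  qed
  have Qinj: "s = t" if st: "s \<in> carrier ?F" "t \<in> carrier ?F" and eq: "\<And>J. J \<in> M \<Longrightarrow> Q s J = Q t J" for s t
  proof (rule PiE_ext)
    show "s \<in> (\<Pi>\<^sub>E j\<in>{..<r}. carrier (sym_group (ns j)))" "t \<in> (\<Pi>\<^sub>E j\<in>{..<r}. carrier (sym_group (ns j)))"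
      using st by auto
    fix j assume "j \<in> {..<r}"
    then have j: "j < r" by simp
    show "s j = t j"
    proof
      fix i show "s j i = t j i"
      proof (cases "i \<in> {1..ns j}")
        case True
        have "ii (Q s (e j i)) = ii (Q t (e j i))" using eq eM(1)[OF True] by simp
        then show ?thesis
          using Q1(4)[OF st(1) eM(1)[OF True]] Q1(4)[OF st(2) eM(1)[OF True]] jje[OF j True] iie[OF j True] by simp
      next
        case False
        then show ?thesis using Fj[OF st(1) j] Fj[OF st(2) j] by (simp add: permutes_def)
      qed
    qed
  qed
  have Qsurj: "\<exists>s\<in>carrier ?F. \<forall>J\<in>M. Q s J = \<pi> J"
    if \<pi>: "bij_betw \<pi> M M" and rp: "\<And>J. J \<in> M \<Longrightarrow> rep (\<pi> J) = rep J" for \<pi>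
  proof -
    have \<pi>M: "\<pi> J \<in> M" if "J \<in> M" for J using bij_betwE[OF \<pi>] that by blast
    have jp: "jj (\<pi> J) = jj J" if "J \<in> M" for J using rp[OF that] unfolding jj_def by simp
    define s where "s = (\<lambda>j\<in>{..<r}. \<lambda>i. if i \<in> {1..ns j} then ii (\<pi> (e j i)) else i)"
    have sv: "s j i = ii (\<pi> (e j i))" if "j < r" "i \<in> {1..ns j}" for j i using that by (simp add: s_def)
    have "s j permutes {1..ns j}" if j: "j < r" for j
    proof (rule bij_imp_permutes)
      have a: "jj (\<pi> (e j i)) = j" if i: "i \<in> {1..ns j}" for i using jp[OF eM(1)[OF i]] jje[OF j i] by simp
      have inj: "inj_on (s j) {1..ns j}"
      proof (rule inj_onI)
        fix i k assume ik: "i \<in> {1..ns j}" "k \<in> {1..ns j}" "s j i = s j k"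
        then have "ii (\<pi> (e j i)) = ii (\<pi> (e j k))" using sv j by simp
        then have "\<pi> (e j i) = \<pi> (e j k)"
          using ii(2)[OF \<pi>M[OF eM(1)[OF ik(1)]]] ii(2)[OF \<pi>M[OF eM(1)[OF ik(2)]]] a ik by metis
        then have "e j i = e j k" using bij_betw_imp_inj_on[OF \<pi>] eM(1) ik by (metis inj_onD)
        then show "i = k" using iie j ik by metis
      qed
      have "s j i \<in> {1..ns j}" if i: "i \<in> {1..ns j}" for i
        using ii(1)[OF \<pi>M[OF eM(1)[OF i]]] a[OF i] sv[OF j i] by simp
      then have "s j ` {1..ns j} \<subseteq> {1..ns j}" by blast
      then show "bij_betw (s j) {1..ns j} {1..ns j}" using inj by (simp add: bij_betw_def endo_inj_surj)
    qed (use j in \<open>auto simp: s_def\<close>)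
    then have "s \<in> carrier ?F" by (auto simp: sym_group_def s_def PiE_def)
    moreover have "Q s J = \<pi> J" if J: "J \<in> M" for J
    proof -
      have "s (jj J) (ii J) = ii (\<pi> J)" using sv[OF jj(1)[OF J] ii(1)[OF J]] ii(2)[OF J] by simp
      then show ?thesis unfolding Q_def using ii(2)[OF \<pi>M[OF J]] jp[OF J] by simp
    qed
    ultimately show ?thesis by blast
  qed
  have Qbij: "bij_betw (Q s) M M" if s: "s \<in> carrier ?F" for s
  proof -
    have "inj_on (Q s) M"
    proof (rule inj_onI)
      fix J K assume JK: "J \<in> M" "K \<in> M" "Q s J = Q s K"
      have j: "jj J = jj K" using Q1(3)[OF s JK(1)] Q1(3)[OF s JK(2)] JK(3) by simp
      have "s (jj J) (ii J) = s (jj J) (ii K)" using Q1(4)[OF s JK(1)] Q1(4)[OF s JK(2)] JK(3) j by simp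
      then have "ii J = ii K" using permutes_inj[OF Fj[OF s jj(1)[OF JK(1)]]] by (simp add: inj_eq)
      then show "J = K" using ii(2)[OF JK(1)] ii(2)[OF JK(2)] j by metis
    qed
    moreover have "Q s ` M \<subseteq> M" using Q1(1)[OF s] by blast
    ultimately show ?thesis using fin by (simp add: bij_betw_def endo_inj_surj)
  qed
  have "fibre_action M rep ?F Q"
    unfolding fibre_action_def using Q1(2) Qmult Qinj Qsurj Qbij by blast
  moreover have "M = {} \<longrightarrow> r = 0" unfolding r_def by simp
  ultimately show ?thesis by blast
qed

lemma disjoint_supports_commute:
  assumes "g \<in> E_supp U" "h \<in> E_supp V" "U \<inter> V = {}" shows "g \<circ> h = h \<circ> g"
proof
  have I: "g \<in> carrier IET" "h \<in> carrier IET" using assms E_supp_iff by auto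
  have o: "\<And>x. x \<notin> U \<Longrightarrow> g x = x" "\<And>x. x \<notin> V \<Longrightarrow> h x = x" using assms E_supp_iff by auto
  have gU: "g x \<in> U \<longleftrightarrow> x \<in> U" for x using o(1) IET_inj[OF I(1)] by metis
  have hV: "h x \<in> V \<longleftrightarrow> x \<in> V" for x using o(2) IET_inj[OF I(2)] by metis
  fix x show "(g \<circ> h) x = (h \<circ> g) x"
    using o gU hV assms(3) by (cases "x \<in> U"; cases "x \<in> V") (auto, (metis disjoint_iff)+)
qed

lemma E_supp_empty: "E_supp {} = {id}"
  by (auto simp: E_supp_iff fun_eq_iff)

context iet begin

section \<open>The product over the components and conjugation on it\<close>

abbreviation Comp where "Comp J \<equiv> subgrp (centralizer f \<inter> E_supp J)"

abbreviation Npart where "Npart \<equiv> product_group (min_comps f) Comp"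

lemma Npart_carrier:
  "n \<in> carrier Npart \<longleftrightarrow> n \<in> extensional (min_comps f) \<and> (\<forall>J\<in>min_comps f. n J \<in> centralizer f \<inter> E_supp J)"
  by (auto simp: PiE_def)

lemma Npart_mult: "(n \<otimes>\<^bsub>Npart\<^esub> n') = (\<lambda>J\<in>min_comps f. n J \<circ> n' J)"
  by (simp add: product_group_def)

lemma rcl_comp: "J \<in> min_comps f \<Longrightarrow> x \<in> J \<Longrightarrow> rcl x = J"
  using min_comps_eq rcl_eq by auto

lemma nonper_comp: "x \<in> nonper \<Longrightarrow> rcl x \<in> min_comps f \<and> x \<in> rcl x"
  using min_comps_eq rcl_self by auto

lemma id_cent: "id \<in> centralizer f" by (simp add: centralizer_iff)

lemma E_supp_mem: "h \<in> E_supp W \<Longrightarrow> h x \<in> W \<longleftrightarrow> x \<in> W"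
  using IET_inj[of h] unfolding E_supp_iff by metis

text \<open>\<open>n J\<close> is used on \<open>J\<close> only and may move \<open>J\<close> to
  another component, so the same construction serves the elements of \<open>Npart\<close> and the
  lifts of permutations.\<close>

definition assemble :: "(real set \<Rightarrow> real \<Rightarrow> real) \<Rightarrow> real \<Rightarrow> real" where
  "assemble n x = (if x \<in> nonper then n (rcl x) x else x)"

lemma assemble_comp: "J \<in> min_comps f \<Longrightarrow> x \<in> J \<Longrightarrow> assemble n x = n J x"
  using rcl_comp min_comps_nonper unfolding assemble_def by auto

lemma piecewise_centralizer:
  assumes \<pi>: "bij_betw \<pi> (min_comps f) (min_comps f)"
    and n: "\<And>J. J \<in> min_comps f \<Longrightarrow> n J \<in> centralizer f"
    and im: "\<And>J. J \<in> min_comps f \<Longrightarrow> n J ` J = \<pi> J"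
  shows "assemble n \<in> centralizer f \<inter> E_supp nonper"
proof -
  have nI: "n J \<in> carrier IET" if "J \<in> min_comps f" for J using n[OF that] centralizer_iff by blast
  have "assemble n \<in> carrier IET"
  proof (rule glue_IET[where I="min_comps f" and W="\<lambda>J. J" and \<pi>=\<pi>])
    fix J assume J: "J \<in> min_comps f"
    have "bij_betw (n J) J (\<pi> J)" using im[OF J] IET_inj[OF nI[OF J]] by (auto simp: bij_betw_def inj_on_def)
    then have "bij_betw (assemble n) J (\<pi> J)"
      by (rule bij_betw_cong[THEN iffD1, rotated]) (use assemble_comp[OF J] in simp)
    moreover have "paff 1 (assemble n) J"
      by (rule paff_cong[OF IET_paff[OF nI[OF J] min_comps_hoi[OF J] min_comps_unit[OF J]]])
         (use assemble_comp[OF J] in simp)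
    ultimately show "J \<subseteq> {0..<1} \<and> bij_betw (assemble n) J (\<pi> J) \<and> paff 1 (assemble n) J"
      using min_comps_unit[OF J] by blast
  next
    show "disjoint_family_on (\<lambda>J. J) (min_comps f)"
      unfolding disjoint_family_on_def using min_comps_disj by blast
    fix x assume "\<And>J. J \<in> min_comps f \<Longrightarrow> x \<notin> J"
    then have "x \<notin> nonper" using min_comps_Union by blast
    then show "assemble n x = x" unfolding assemble_def by simp
  qed (use finite_min_comps \<pi> in auto)
  moreover have "f (assemble n x) = assemble n (f x)" for x
  proof (cases "x \<in> nonper")
    case True
    have "rcl (f x) = rcl x" using rcl_orb[of x "f x"] by simp
    then show ?thesis unfolding assemble_def using True nonper_f n[of "rcl x"] nonper_comp[OF True]
      by (simp add: centralizer_iff)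
  next
    case False
    then show ?thesis unfolding assemble_def using nonper_f by simp
  qed
  ultimately show ?thesis by (auto simp: centralizer_iff E_supp_iff assemble_def)
qed

lemma E_supp_image: "h \<in> E_supp J \<Longrightarrow> h ` J = J"
proof
  assume h: "h \<in> E_supp J"
  show "h ` J \<subseteq> J" using E_supp_mem[OF h] by blast
  show "J \<subseteq> h ` J"
  proof
    fix x assume "x \<in> J"
    then have "finv h x \<in> J" using E_supp_mem[OF E_supp_finv[OF h]] by blast
    moreover have "x = h (finv h x)" using h by (simp add: E_supp_iff)
    ultimately show "x \<in> h ` J" by (rule rev_image_eqI)
  qed
qed

lemma assemble_Npart:
  assumes "n \<in> carrier Npart" shows "assemble n \<in> centralizer f \<inter> E_supp nonper"
proof (rule piecewise_centralizer[where \<pi>="\<lambda>J. J"])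
  fix J assume "J \<in> min_comps f"
  then have "n J \<in> centralizer f \<inter> E_supp J" using assms unfolding Npart_carrier by blast
  then show "n J \<in> centralizer f" "n J ` J = J" using E_supp_image by blast+
qed (simp add: bij_betw_def)

lemma assemble_mult:
  assumes n: "n \<in> carrier Npart" "n' \<in> carrier Npart"
  shows "assemble (n \<otimes>\<^bsub>Npart\<^esub> n') = assemble n \<circ> assemble n'"
proof
  fix x show "assemble (n \<otimes>\<^bsub>Npart\<^esub> n') x = (assemble n \<circ> assemble n') x"
  proof (cases "x \<in> nonper")
    case True
    let ?J = "rcl x"
    have J: "?J \<in> min_comps f" "x \<in> ?J" using nonper_comp[OF True] by auto
    have "n' ?J x \<in> ?J" using n(2) J E_supp_mem by (metis IntD2 Npart_carrier)
    then show ?thesis using assemble_comp[OF J] assemble_comp[OF J(1)] J(1) by (simp add: Npart_mult)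
  next
    case False
    then show ?thesis by (simp add: assemble_def)
  qed
qed

text \<open>Conjugation by \<open>g\<close>, transferred to families: the member now acting on
  \<open>J\<close> is the one that acted on the preimage of \<open>J\<close> under
  \<open>g\<close>.\<close>

definition conjN :: "(real \<Rightarrow> real) \<Rightarrow> (real set \<Rightarrow> real \<Rightarrow> real) \<Rightarrow> (real set \<Rightarrow> real \<Rightarrow> real)" where
  "conjN g n = (\<lambda>J\<in>min_comps f. g \<circ> n (finv g ` J) \<circ> finv g)"

lemma conjN_Npart:
  assumes g: "g \<in> centralizer f" and n: "n \<in> carrier Npart" shows "conjN g n \<in> carrier Npart"
  unfolding Npart_carrier
proof (intro conjI ballI)
  show "conjN g n \<in> extensional (min_comps f)" unfolding conjN_def by simp
  fix J assume J: "J \<in> min_comps f"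
  have g': "finv g \<in> centralizer f" using centralizer_finv[OF fI g] .
  have gI: "g \<in> carrier IET" using g centralizer_iff by blast
  have J': "finv g ` J \<in> min_comps f" using centralizer_min_comp[OF g' J] .
  have nJ: "n (finv g ` J) \<in> centralizer f" "n (finv g ` J) \<in> E_supp (finv g ` J)" using n J' by (auto simp: Npart_carrier)
  have c: "g \<circ> n (finv g ` J) \<circ> finv g \<in> centralizer f"
    using centralizer_comp[OF fI centralizer_comp[OF fI g nJ(1)] g'] .
  moreover have "g (n (finv g ` J) (finv g x)) = x" if x: "x \<notin> J" for x
  proof -
    have "finv g x \<notin> finv g ` J" using x IET_inj[OF IET_finv[OF gI]] by auto
    then have "n (finv g ` J) (finv g x) = finv g x" using nJ(2) E_supp_iff by blast
    then show ?thesis using gI by simp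
  qed
  ultimately have "g \<circ> n (finv g ` J) \<circ> finv g \<in> E_supp J" unfolding E_supp_iff centralizer_iff by simp
  then show "conjN g n J \<in> centralizer f \<inter> E_supp J" using c J unfolding conjN_def by simp
qed

lemma assemble_conjN:
  assumes g: "g \<in> centralizer f" shows "assemble (conjN g n) = g \<circ> assemble n \<circ> finv g"
proof
  fix x
  have g': "finv g \<in> centralizer f" using centralizer_finv[OF fI g] .
  have gI: "g \<in> carrier IET" using g centralizer_iff by blast
  show "assemble (conjN g n) x = (g \<circ> assemble n \<circ> finv g) x"
  proof (cases "x \<in> nonper")
    case True
    let ?J = "rcl x"
    have J: "?J \<in> min_comps f" "x \<in> ?J" using nonper_comp[OF True] by auto
    have "assemble n (finv g x) = n (finv g ` ?J) (finv g x)"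
      by (rule assemble_comp[OF centralizer_min_comp[OF g' J(1)]]) (use J in blast)
    then show ?thesis using assemble_comp[OF J] J(1) by (simp add: conjN_def)
  next
    case False
    then have "finv g x \<notin> nonper" using centralizer_nonper[OF g'] by blast
    then show ?thesis using False gI by (simp add: assemble_def)
  qed
qed

text \<open>Allows identities between families to be checked as identities between interval
  exchanges; the support condition fixes \<open>n J\<close> off \<open>J\<close>.\<close>

lemma assemble_inj:
  assumes n: "n \<in> carrier Npart" "n' \<in> carrier Npart" and eq: "assemble n = assemble n'" shows "n = n'"
proof (rule extensionalityI[of _ "min_comps f"])
  show "n \<in> extensional (min_comps f)" "n' \<in> extensional (min_comps f)" using n Npart_carrier by auto
  fix J assume J: "J \<in> min_comps f"
  show "n J = n' J"
  proof
    fix x show "n J x = n' J x"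
    proof (cases "x \<in> J")
      case True
      then show ?thesis using assemble_comp[OF J True] eq by metis
    next
      case False
      have "n J \<in> E_supp J" "n' J \<in> E_supp J" using n J by (auto simp: Npart_carrier)
      then show ?thesis using False E_supp_iff by simp
    qed
  qed
qed

lemma Npart_closed:
  assumes "n \<in> carrier Npart" "n' \<in> carrier Npart" shows "n \<otimes>\<^bsub>Npart\<^esub> n' \<in> carrier Npart"
  using assms unfolding Npart_mult Npart_carrier
  by (auto simp: centralizer_comp[OF fI] E_supp_comp simp del: comp_apply)

lemma conjN_comp:
  assumes g: "g \<in> centralizer f" and h: "h \<in> centralizer f" and n: "n \<in> carrier Npart"
  shows "conjN g (conjN h n) = conjN (g \<circ> h) n"
proof (rule assemble_inj)
  have gh: "g \<circ> h \<in> centralizer f" using centralizer_comp[OF fI g h] .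
  show "conjN g (conjN h n) \<in> carrier Npart" "conjN (g \<circ> h) n \<in> carrier Npart"
    using conjN_Npart g h gh n by blast+
  have "bij g" "bij h" using g h centralizer_iff IET_bij by blast+
  then have "finv (g \<circ> h) = finv h \<circ> finv g" by (rule o_inv_distrib)
  then show "assemble (conjN g (conjN h n)) = assemble (conjN (g \<circ> h) n)"
    by (simp add: assemble_conjN[OF g] assemble_conjN[OF h] assemble_conjN[OF gh] o_assoc)
qed

lemma conjN_mult:
  assumes g: "g \<in> centralizer f" and n: "n \<in> carrier Npart" "n' \<in> carrier Npart"
  shows "conjN g (n \<otimes>\<^bsub>Npart\<^esub> n') = conjN g n \<otimes>\<^bsub>Npart\<^esub> conjN g n'"
proof (rule assemble_inj)
  show "conjN g (n \<otimes>\<^bsub>Npart\<^esub> n') \<in> carrier Npart" "conjN g n \<otimes>\<^bsub>Npart\<^esub> conjN g n' \<in> carrier Npart"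
    using conjN_Npart[OF g] Npart_closed n by blast+
  have gI: "g \<in> carrier IET" using g centralizer_iff by blast
  have "assemble (conjN g n \<otimes>\<^bsub>Npart\<^esub> conjN g n') = (g \<circ> assemble n \<circ> finv g) \<circ> (g \<circ> assemble n' \<circ> finv g)"
    using assemble_mult conjN_Npart[OF g] n assemble_conjN[OF g] by simp
  also have "\<dots> = g \<circ> (assemble n \<circ> assemble n') \<circ> finv g" using gI by (simp add: fun_eq_iff)
  finally show "assemble (conjN g (n \<otimes>\<^bsub>Npart\<^esub> n')) = assemble (conjN g n \<otimes>\<^bsub>Npart\<^esub> conjN g n')"
    using assemble_conjN[OF g] assemble_mult[OF n] by simp
qed

lemma conjN_id: "n \<in> carrier Npart \<Longrightarrow> conjN id n = n"
  by (rule assemble_inj[OF conjN_Npart[OF id_cent]])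
     (auto simp: assemble_conjN[OF id_cent] simp del: carrier_product_group)

text \<open>The restriction to the carrier is needed because automorphisms in \<open>auto\<close>
  are extensional maps.\<close>

lemma conjN_auto:
  assumes g: "g \<in> centralizer f"
  shows "restrict (conjN g) (carrier Npart) \<in> auto Npart"
  unfolding auto_def Bij_def
proof (intro IntI CollectI)
  show "restrict (conjN g) (carrier Npart) \<in> hom Npart Npart"
    by (rule homI) (use conjN_Npart[OF g] conjN_mult[OF g] Npart_closed in \<open>auto simp del: carrier_product_group\<close>)
  have gI: "g \<in> carrier IET" using g centralizer_iff by blast
  have g': "finv g \<in> centralizer f" using centralizer_finv[OF fI g] .
  have "finv g \<circ> g = id" "g \<circ> finv g = id" using gI by (auto simp: fun_eq_iff)
  then have "bij_betw (conjN g) (carrier Npart) (carrier Npart)"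
    by (intro bij_betw_byWitness[where f'="conjN (finv g)"])
       (use conjN_comp[OF g g'] conjN_comp[OF g' g] conjN_id conjN_Npart[OF g] conjN_Npart[OF g'] in
        \<open>auto simp del: carrier_product_group\<close>)
  then show "bij_betw (restrict (conjN g) (carrier Npart)) (carrier Npart) (carrier Npart)"
    by (simp add: bij_betw_restrict_eq del: carrier_product_group)
qed simp

section \<open>Splitting C(f) over nonperiodic, moved periodic and fixed points\<close>

lemma f_PerP: "h \<in> centralizer f \<Longrightarrow> h x \<in> PerP f - FixP f \<longleftrightarrow> x \<in> PerP f - FixP f"
  using centralizer_min_per[of h] by (simp add: PerP_min_per FixP_min_per)

lemma hoi_FixP: "hoi (FixP f)" unfolding FixP_min_per by (rule min_per_hoi)

lemma FixP_cent: "h \<in> centralizer f \<Longrightarrow> h x \<in> FixP f \<longleftrightarrow> x \<in> FixP f"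
  unfolding FixP_min_per by (rule centralizer_min_per)

lemma E_supp_FixP: "E_supp (FixP f) \<subseteq> centralizer f"
proof
  fix b assume b: "b \<in> E_supp (FixP f)"
  have "f (b x) = b (f x)" for x
  proof (cases "x \<in> FixP f")
    case True
    then have "b x \<in> FixP f" using E_supp_mem[OF b] by blast
    then show ?thesis using True unfolding FixP_def by simp
  next
    case False
    then show ?thesis using b FixP_cent[OF f_cent] by (simp add: E_supp_iff)
  qed
  then show "b \<in> centralizer f" using b by (simp add: centralizer_iff E_supp_iff)
qed


text \<open>The permutation part splits because the identification \<open>u J\<close> of the class
  representative with \<open>J\<close> is chosen once for each component: the lift of a permutation
  goes from a component back to the representative and out to the image, and under composition these
  identifications telescope. The remaining factors have disjoint supports and therefore
  commute.\<close>

lemma centralizer_structure: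
  "\<exists>(r::nat) (ns::nat \<Rightarrow> nat) \<phi>. (min_comps f = {} \<longrightarrow> r = 0) \<and>
     \<phi> \<in> hom (product_group {..<r} (\<lambda>j. sym_group (ns j))) (AutoGroup Npart) \<and>
     subgrp (centralizer f) \<cong>
       (semidirect Npart (product_group {..<r} (\<lambda>j. sym_group (ns j))) \<phi> \<times>\<times> Comp (PerP f - FixP f))
         \<times>\<times> subgrp (E_supp (FixP f))"
proof -
  let ?M = "min_comps f" and ?C = "centralizer f" and ?A = "PerP f - FixP f" and ?B = "FixP f"
  have CI: "g \<in> carrier IET" if "g \<in> ?C" for g using that centralizer_iff by blast
  have finv_im: "finv g ` (g ` J) = J" "g ` (finv g ` J) = J" if "g \<in> ?C" for g J
    using CI[OF that] by (auto simp: image_image)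
  \<comment> \<open>The condition under the choice operator depends on the C(f)-class of
    \<open>J\<close> only, so equivalent components receive literally the same
    representative.\<close>
  define repr where "repr J = (SOME J'. J' \<in> ?M \<and> (\<exists>g\<in>?C. g ` J = J'))" for J
  have repr: "repr J \<in> ?M \<and> (\<exists>g\<in>?C. g ` J = repr J)" if "J \<in> ?M" for J
  proof -
    have "\<exists>J'. J' \<in> ?M \<and> (\<exists>g\<in>?C. g ` J = J')" using that id_cent by (metis image_id id_apply)
    then show ?thesis unfolding repr_def by (rule someI_ex)
  qed
  have repr_cent: "repr (g ` J) = repr J" if g: "g \<in> ?C" for g J
  proof -
    have "(\<exists>k\<in>?C. k ` (g ` J) = J') \<longleftrightarrow> (\<exists>k\<in>?C. k ` J = J')" for J'
    proof
      assume "\<exists>k\<in>?C. k ` (g ` J) = J'"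
      then obtain k where "k \<in> ?C" "k ` (g ` J) = J'" by blast
      then show "\<exists>k\<in>?C. k ` J = J'" using centralizer_comp[OF fI _ g] by (metis image_comp)
    next
      assume "\<exists>k\<in>?C. k ` J = J'"
      then obtain k where k: "k \<in> ?C" "k ` J = J'" by blast
      then have "(k \<circ> finv g) ` (g ` J) = J'" using finv_im(1)[OF g] by (metis image_comp)
      then show "\<exists>k\<in>?C. k ` (g ` J) = J'" using centralizer_comp[OF fI k(1) centralizer_finv[OF fI g]] by blast
    qed
    then show ?thesis unfolding repr_def by simp
  qed
  have "\<forall>J\<in>?M. \<exists>g\<in>?C. g ` repr J = J"
  proof
    fix J assume "J \<in> ?M"
    then obtain g where g: "g \<in> ?C" "g ` J = repr J" using repr by blast
    then have "finv g ` repr J = J" using finv_im(1) by metis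
    then show "\<exists>g\<in>?C. g ` repr J = J" using centralizer_finv[OF fI g(1)] by blast
  qed
  then obtain u where u: "\<And>J. J \<in> ?M \<Longrightarrow> u J \<in> ?C \<and> u J ` repr J = J" by metis
  obtain r ns Q where r0: "?M = {} \<longrightarrow> r = (0::nat)"
    and act: "fibre_action ?M repr (product_group {..<r} (\<lambda>j. sym_group (ns j))) Q"
    using ex_fibre_action[OF finite_min_comps, of repr] by blast
  define F where "F = product_group {..<r} (\<lambda>j. sym_group (ns j))"
  note act' = act[folded F_def, unfolded fibre_action_def]
  note act1 = act'[THEN conjunct1] and act2 = act'[THEN conjunct2, THEN conjunct1]
    and act3 = act'[THEN conjunct2, THEN conjunct2, THEN conjunct1]
    and act4 = act'[THEN conjunct2, THEN conjunct2, THEN conjunct2]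
  have Qbij: "bij_betw (Q s) ?M ?M" if "s \<in> carrier F" for s using act1 that by simp
  have Q: "Q s J \<in> ?M \<and> repr (Q s J) = repr J" if "s \<in> carrier F" "J \<in> ?M" for s J
    using act1 that bij_betwE[OF Qbij[OF that(1)]] by simp
  have Qmult: "Q (s \<otimes>\<^bsub>F\<^esub> t) J = Q s (Q t J)" if "s \<in> carrier F" "t \<in> carrier F" "J \<in> ?M" for s t J
    using act2 that by simp
  have Qinj: "s = t" if "s \<in> carrier F" "t \<in> carrier F" "\<And>J. J \<in> ?M \<Longrightarrow> Q s J = Q t J" for s t
    by (rule act3[rule_format]) (use that in auto)
  have Qsurj: "\<exists>s\<in>carrier F. \<forall>J\<in>?M. Q s J = \<pi> J" if "bij_betw \<pi> ?M ?M" "\<And>J. J \<in> ?M \<Longrightarrow> repr (\<pi> J) = repr J" for \<pi>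
    by (rule act4[rule_format]) (use that in auto)
  have F_closed: "s \<otimes>\<^bsub>F\<^esub> t \<in> carrier F" if "s \<in> carrier F" "t \<in> carrier F" for s t
    using that unfolding F_def
    by (auto simp: product_group_def sym_group_def PiE_def Pi_def permutes_compose)
  define nn where "nn s J = u (Q s J) \<circ> finv (u J)" for s J
  define G where "G s = assemble (nn s)" for s
  have nn: "nn s J \<in> ?C" "nn s J ` J = Q s J" if s: "s \<in> carrier F" and J: "J \<in> ?M" for s J
  proof -
    note q = Q[OF s J]
    have uJ: "u J \<in> ?C" "u J ` repr J = J" and uQ: "u (Q s J) \<in> ?C" "u (Q s J) ` repr J = Q s J"
      using u[OF J] u[of "Q s J"] q by auto
    show "nn s J \<in> ?C" unfolding nn_def using centralizer_comp[OF fI uQ(1) centralizer_finv[OF fI uJ(1)]] .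
    have "finv (u J) ` J = repr J" using finv_im(1)[OF uJ(1), of "repr J"] uJ(2) by simp
    then show "nn s J ` J = Q s J" unfolding nn_def using uQ(2) by (metis image_comp)
  qed
  have GC: "G s \<in> ?C" "G s \<in> E_supp nonper" if s: "s \<in> carrier F" for s
    using piecewise_centralizer[OF Qbij[OF s] nn(1)[OF s] nn(2)[OF s]] unfolding G_def by blast+
  have GJ: "G s x = u (Q s J) (finv (u J) x)" if "J \<in> ?M" "x \<in> J" for s J x
    using assemble_comp[OF that] unfolding G_def nn_def by simp
  have GQ: "G s x \<in> Q s J" if "s \<in> carrier F" "J \<in> ?M" "x \<in> J" for s J x
    using nn(2)[OF that(1,2)] assemble_comp[OF that(2,3)] that(3) unfolding G_def by auto
  have Gmult: "G (s \<otimes>\<^bsub>F\<^esub> t) = G s \<circ> G t" if st: "s \<in> carrier F" "t \<in> carrier F" for s t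
  proof
    fix x show "G (s \<otimes>\<^bsub>F\<^esub> t) x = (G s \<circ> G t) x"
    proof (cases "x \<in> nonper")
      case True
      let ?J = "rcl x"
      have J: "?J \<in> ?M" "x \<in> ?J" using nonper_comp[OF True] by auto
      have tJ: "Q t ?J \<in> ?M" using Q[OF st(2) J(1)] by blast
      have "G s (G t x) = u (Q s (Q t ?J)) (finv (u (Q t ?J)) (u (Q t ?J) (finv (u ?J) x)))"
        using GJ[OF tJ GQ[OF st(2) J]] GJ[OF J] by simp
      also have "\<dots> = u (Q s (Q t ?J)) (finv (u ?J) x)" using u[OF tJ] CI by simp
      also have "\<dots> = G (s \<otimes>\<^bsub>F\<^esub> t) x" using GJ[OF J] Qmult[OF st J(1)] by simp
      finally show ?thesis by simp
    next
      case False
      then show ?thesis unfolding G_def assemble_def by simp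
    qed
  qed
  define \<phi> where "\<phi> s = restrict (conjN (G s)) (carrier Npart)" for s
  have \<phi>_auto: "\<phi> s \<in> auto Npart" if "s \<in> carrier F" for s unfolding \<phi>_def using conjN_auto[OF GC(1)[OF that]] .
  have hom_auto: "\<phi> \<in> hom F (AutoGroup Npart)"
  proof (rule homI)
    fix s assume "s \<in> carrier F"
    then show "\<phi> s \<in> carrier (AutoGroup Npart)" using \<phi>_auto by (simp add: AutoGroup_def)
  next
    fix s t assume st: "s \<in> carrier F" "t \<in> carrier F"
    have "\<phi> s \<in> Bij (carrier Npart)" "\<phi> t \<in> Bij (carrier Npart)" using \<phi>_auto st unfolding auto_def by blast+
    then have "\<phi> s \<otimes>\<^bsub>AutoGroup Npart\<^esub> \<phi> t = compose (carrier Npart) (\<phi> s) (\<phi> t)"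
      by (simp add: AutoGroup_def BijGroup_def del: carrier_product_group)
    also have "\<dots> = \<phi> (s \<otimes>\<^bsub>F\<^esub> t)"
    proof
      fix n show "compose (carrier Npart) (\<phi> s) (\<phi> t) n = \<phi> (s \<otimes>\<^bsub>F\<^esub> t) n"
      proof (cases "n \<in> carrier Npart")
        case True
        then show ?thesis using conjN_Npart[OF GC(1)[OF st(2)] True] conjN_comp[OF GC(1)[OF st(1)] GC(1)[OF st(2)] True] Gmult[OF st]
          by (simp add: compose_def \<phi>_def del: carrier_product_group)
      next
        case False
        then show ?thesis by (simp add: compose_def \<phi>_def del: carrier_product_group)
      qed
    qed
    finally show "\<phi> (s \<otimes>\<^bsub>F\<^esub> t) = \<phi> s \<otimes>\<^bsub>AutoGroup Npart\<^esub> \<phi> t" by simp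
  qed
  let ?H = "(semidirect Npart F \<phi> \<times>\<times> Comp ?A) \<times>\<times> subgrp (E_supp ?B)"
  define \<Phi> where "\<Phi> = (\<lambda>(((n, s), a::real \<Rightarrow> real), b::real \<Rightarrow> real). assemble n \<circ> G s \<circ> a \<circ> b)"
  have H_iff: "(((n, s), a), b) \<in> carrier ?H \<longleftrightarrow>
      n \<in> carrier Npart \<and> s \<in> carrier F \<and> a \<in> ?C \<inter> E_supp ?A \<and> b \<in> E_supp ?B" for n s a b
    by (simp add: semidirect_def del: carrier_product_group)
  have H_mult: "(((n, s), a), b) \<otimes>\<^bsub>?H\<^esub> (((n', s'), a'), b') =
      (((n \<otimes>\<^bsub>Npart\<^esub> \<phi> s n', s \<otimes>\<^bsub>F\<^esub> s'), a \<circ> a'), b \<circ> b')" for n s a b n' s' a' b'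
    by (simp add: semidirect_def)
  have \<phi>N: "\<phi> s n \<in> carrier Npart" "\<phi> s n = conjN (G s) n" if "s \<in> carrier F" "n \<in> carrier Npart" for s n
    using conjN_Npart[OF GC(1)[OF that(1)] that(2)] that(2) unfolding \<phi>_def by (simp_all del: carrier_product_group)
  have disj: "nonper \<inter> ?A = {}" "nonper \<inter> ?B = {}" "?A \<inter> ?B = {}"
    unfolding nonper_def using PerP_min_per FixP_min_per by auto
  have XS: "assemble n \<circ> G s \<in> E_supp nonper" "assemble n \<circ> G s \<in> ?C" if "n \<in> carrier Npart" "s \<in> carrier F" for n s
    using assemble_Npart[OF that(1)] GC[OF that(2)] E_supp_comp centralizer_comp[OF fI] by blast+
  have hom\<Phi>: "\<Phi> \<in> hom ?H (subgrp ?C)"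
  proof (rule homI)
    fix x assume xH: "x \<in> carrier ?H"
    obtain n s a b where x: "x = (((n, s), a), b)" by (metis surj_pair)
    note X = xH[unfolded x H_iff]
    have "assemble n \<circ> G s \<circ> a \<circ> b \<in> ?C"
      by (intro centralizer_comp[OF fI] XS(2)) (use X E_supp_FixP in auto)
    then show "\<Phi> x \<in> carrier (subgrp ?C)" unfolding x \<Phi>_def by simp
  next
    fix x y assume xy: "x \<in> carrier ?H" "y \<in> carrier ?H"
    obtain n s a b where x: "x = (((n, s), a), b)" by (metis surj_pair)
    obtain n' s' a' b' where y: "y = (((n', s'), a'), b')" by (metis surj_pair)
    note X = xy(1)[unfolded x H_iff] and Y = xy(2)[unfolded y H_iff]
    let ?Y = "assemble n' \<circ> G s'"
    have YS: "?Y \<in> E_supp nonper" using XS Y by blast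
    have "a \<circ> ?Y = ?Y \<circ> a" by (rule disjoint_supports_commute[where U="?A" and V=nonper]) (use X YS disj in auto)
    then have 1: "\<And>z. a (?Y z) = ?Y (a z)" by (metis comp_apply)
    have "b \<circ> ?Y = ?Y \<circ> b" by (rule disjoint_supports_commute[where U="?B" and V=nonper]) (use X YS disj in auto)
    then have 2: "\<And>z. b (?Y z) = ?Y (b z)" by (metis comp_apply)
    have "b \<circ> a' = a' \<circ> b" by (rule disjoint_supports_commute[where U="?B" and V="?A"]) (use X Y disj in auto)
    then have 3: "\<And>z. b (a' z) = a' (b z)" by (metis comp_apply)
    have GI: "G s \<in> carrier IET" using CI GC X by blast
    have "\<Phi> (x \<otimes>\<^bsub>?H\<^esub> y) = assemble (n \<otimes>\<^bsub>Npart\<^esub> \<phi> s n') \<circ> G (s \<otimes>\<^bsub>F\<^esub> s') \<circ> (a \<circ> a') \<circ> (b \<circ> b')"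
      unfolding x y H_mult \<Phi>_def by simp
    also have "assemble (n \<otimes>\<^bsub>Npart\<^esub> \<phi> s n') = assemble n \<circ> (G s \<circ> assemble n' \<circ> finv (G s))"
      using assemble_mult[of n "\<phi> s n'"] \<phi>N[of s n'] assemble_conjN[OF GC(1)[of s]] X Y by simp
    also have "G (s \<otimes>\<^bsub>F\<^esub> s') = G s \<circ> G s'" using Gmult X Y by blast
    \<comment> \<open>The inverse of \<open>G s\<close> produced by the twisted multiplication
      cancels against the following \<open>G s\<close>; the rest is moving \<open>a\<close> and
      \<open>b\<close> past maps with disjoint support.\<close>
    also have "assemble n \<circ> (G s \<circ> assemble n' \<circ> finv (G s)) \<circ> (G s \<circ> G s') \<circ> (a \<circ> a') \<circ> (b \<circ> b') =
       \<Phi> x \<circ> \<Phi> y"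
    proof
      fix z
      have "(\<Phi> x \<circ> \<Phi> y) z = assemble n (G s (a (b (?Y (a' (b' z))))))" unfolding x y \<Phi>_def by simp
      also have "\<dots> = assemble n (G s (?Y (a (a' (b (b' z))))))" unfolding 2 1 3 ..
      finally show "(assemble n \<circ> (G s \<circ> assemble n' \<circ> finv (G s)) \<circ> (G s \<circ> G s') \<circ> (a \<circ> a') \<circ> (b \<circ> b')) z = (\<Phi> x \<circ> \<Phi> y) z"
        using GI by simp
    qed
    finally show "\<Phi> (x \<otimes>\<^bsub>?H\<^esub> y) = \<Phi> x \<otimes>\<^bsub>subgrp ?C\<^esub> \<Phi> y" by simp
  qed
  have iso: "subgrp ?C \<cong> ?H"
  proof (rule is_iso_inverse[OF hom\<Phi>])
    fix x y assume xy: "x \<in> carrier ?H" "y \<in> carrier ?H"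
    obtain n s a b where x: "x = (((n, s), a), b)" by (metis surj_pair)
    obtain n' s' a' b' where y: "y = (((n', s'), a'), b')" by (metis surj_pair)
    note X = xy(1)[unfolded x H_iff] and Y = xy(2)[unfolded y H_iff]
    show "x \<otimes>\<^bsub>?H\<^esub> y \<in> carrier ?H"
      unfolding x y H_mult H_iff
    proof (intro conjI IntI)
      show "n \<otimes>\<^bsub>Npart\<^esub> \<phi> s n' \<in> carrier Npart" using X Y Npart_closed \<phi>N(1) by simp
      show "s \<otimes>\<^bsub>F\<^esub> s' \<in> carrier F" using X Y F_closed by simp
      show "a \<circ> a' \<in> ?C" by (rule centralizer_comp[OF fI]) (use X Y in auto)
      show "a \<circ> a' \<in> E_supp ?A" by (rule E_supp_comp) (use X Y in auto)
      show "b \<circ> b' \<in> E_supp ?B" by (rule E_supp_comp) (use X Y in auto)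
    qed
  next
    have val: "z \<in> nonper \<Longrightarrow> \<Phi> (((n, s), a), b) z = assemble n (G s z)"
      "z \<in> ?A \<Longrightarrow> \<Phi> (((n, s), a), b) z = a z"
      "z \<in> ?B \<Longrightarrow> \<Phi> (((n, s), a), b) z = b z"
      if x: "(((n, s), a), b) \<in> carrier ?H" for n s a b z
    proof -
      note X = x[unfolded H_iff]
      have o: "\<And>w. w \<notin> nonper \<Longrightarrow> assemble n (G s w) = w" "\<And>w. w \<notin> ?A \<Longrightarrow> a w = w" "\<And>w. w \<notin> ?B \<Longrightarrow> b w = w"
        using XS(1)[of n s] X by (auto simp: E_supp_iff)
      have m: "\<And>w. a w \<in> ?A \<longleftrightarrow> w \<in> ?A" "\<And>w. b w \<in> ?B \<longleftrightarrow> w \<in> ?B" using X E_supp_mem by blast+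
      have eq: "\<Phi> (((n, s), a), b) z = assemble n (G s (a (b z)))" unfolding \<Phi>_def by simp
      show "z \<in> nonper \<Longrightarrow> \<Phi> (((n, s), a), b) z = assemble n (G s z)"
        unfolding eq using o(2,3)[of z] disj by (metis disjoint_iff)
      show "z \<in> ?A \<Longrightarrow> \<Phi> (((n, s), a), b) z = a z"
        unfolding eq using o(3)[of z] o(1)[of "a z"] m(1)[of z] disj by (metis disjoint_iff)
      show "z \<in> ?B \<Longrightarrow> \<Phi> (((n, s), a), b) z = b z"
        unfolding eq using o(2)[of "b z"] o(1)[of "b z"] m(2)[of z] disj by (metis disjoint_iff)
    qed
    have cover: "z \<in> nonper \<or> z \<in> ?A \<or> z \<in> ?B \<or> z \<notin> {0..<1}" for z unfolding nonper_def by blast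
    show "bij_betw \<Phi> (carrier ?H) (carrier (subgrp ?C))"
      unfolding bij_betw_def
    proof
      show "inj_on \<Phi> (carrier ?H)"
      proof (rule inj_onI)
        fix x y assume xy: "x \<in> carrier ?H" "y \<in> carrier ?H" "\<Phi> x = \<Phi> y"
        obtain n s a b where x: "x = (((n, s), a), b)" by (metis surj_pair)
        obtain n' s' a' b' where y: "y = (((n', s'), a'), b')" by (metis surj_pair)
        note X = xy(1)[unfolded x H_iff] and Y = xy(2)[unfolded y H_iff]
        note vx = val[OF xy(1)[unfolded x]] and vy = val[OF xy(2)[unfolded y]]
        have "a z = a' z" for z
          using vx(2)[of z] vy(2)[of z] xy(3) X Y unfolding x y by (cases "z \<in> ?A") (auto simp: E_supp_iff)
        then have a: "a = a'" by blast
        have "b z = b' z" for z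
          using vx(3)[of z] vy(3)[of z] xy(3) X Y unfolding x y by (cases "z \<in> ?B") (auto simp: E_supp_iff)
        then have b: "b = b'" by blast
        have eq: "assemble n (G s z) = assemble n' (G s' z)" if "z \<in> nonper" for z
          using vx(1)[OF that] vy(1)[OF that] xy(3) unfolding x y by simp
        have asm: "assemble m w \<in> J" if "m \<in> carrier Npart" "J \<in> ?M" "w \<in> J" for m w J
          using assemble_comp[OF that(2,3)] that E_supp_mem by (metis IntD2 Npart_carrier)
        \<comment> \<open>\<open>assemble n\<close> keeps every component in place, so the action of
          the composite on components shows \<open>s\<close> alone.\<close>
        have s: "s = s'"
        proof (rule Qinj)
          show "s \<in> carrier F" "s' \<in> carrier F" using X Y by auto
          fix J assume J: "J \<in> ?M"
          obtain z where z: "z \<in> J" using min_comps_ne[OF J] by blast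
          have "assemble n (G s z) \<in> Q s J" "assemble n' (G s' z) \<in> Q s' J"
            using asm GQ[OF _ J z] Q[OF _ J] X Y by blast+
          moreover have "assemble n (G s z) = assemble n' (G s' z)" using eq z min_comps_nonper[OF J] by blast
          ultimately show "Q s J = Q s' J" using min_comps_disj Q[OF _ J] X Y by metis
        qed
        have "assemble n w = assemble n' w" for w
        proof (cases "w \<in> nonper")
          case True
          have GI: "G s \<in> carrier IET" using CI GC X by blast
          have "finv (G s) w \<in> nonper" using True E_supp_mem[OF E_supp_finv[OF GC(2)]] X by blast
          then show ?thesis using eq[of "finv (G s) w"] s GI by simp
        qed (simp add: assemble_def)
        then have "n = n'" using assemble_inj X Y by blast
        then show "x = y" unfolding x y using a b s by simp
      qed
      show "\<Phi> ` carrier ?H = carrier (subgrp ?C)"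
      proof
        show "\<Phi> ` carrier ?H \<subseteq> carrier (subgrp ?C)" using hom\<Phi> unfolding hom_def by blast
        show "carrier (subgrp ?C) \<subseteq> \<Phi> ` carrier ?H"
        proof
          fix h assume "h \<in> carrier (subgrp ?C)"
          then have h: "h \<in> ?C" by simp
          have h': "finv h \<in> ?C" using centralizer_finv[OF fI h] .
          have "bij_betw (\<lambda>J. h ` J) ?M ?M"
          proof (rule bij_betw_byWitness[where f'="\<lambda>J. finv h ` J"])
            show "\<forall>J\<in>?M. finv h ` (h ` J) = J" "\<forall>J\<in>?M. h ` (finv h ` J) = J" using finv_im[OF h] by simp_all
            show "(\<lambda>J. h ` J) ` ?M \<subseteq> ?M" using centralizer_min_comp[OF h] by blast
            show "(\<lambda>J. finv h ` J) ` ?M \<subseteq> ?M" using centralizer_min_comp[OF h'] by blast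
          qed
          from Qsurj[OF this repr_cent[OF h]]
          obtain s where s: "s \<in> carrier F" "\<And>J. J \<in> ?M \<Longrightarrow> Q s J = h ` J" by blast
          \<comment> \<open>Dividing by the lift of the permutation induced by \<open>h\<close>
            leaves a map that preserves each component, whose restrictions form the family
            \<open>n\<close>.\<close>
          let ?k = "h \<circ> finv (G s)"
          have GsI: "G s \<in> carrier IET" using CI GC(1)[OF s(1)] .
          have k: "?k \<in> ?C" using centralizer_comp[OF fI h centralizer_finv[OF fI GC(1)[OF s(1)]]] .
          have kJ: "?k z \<in> J \<longleftrightarrow> z \<in> J" if J: "J \<in> ?M" for J z
          proof -
            have "finv h ` J \<in> ?M" using centralizer_min_comp[OF h' J] .
            then have "Q s (finv h ` J) = J" using s(2) finv_im(2)[OF h] by simp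
            then have GJ': "G s w \<in> J" if "w \<in> finv h ` J" for w using GQ[OF s(1) \<open>finv h ` J \<in> ?M\<close> that] by simp
            have im: "G s ` (finv h ` J) = J"
              using nn(2)[OF s(1) \<open>finv h ` J \<in> ?M\<close>] \<open>Q s (finv h ` J) = J\<close> assemble_comp[OF \<open>finv h ` J \<in> ?M\<close>]
              unfolding G_def by (metis (no_types, lifting) image_cong)
            have "finv (G s) ` J = finv h ` J" using finv_im(1)[OF GC(1)[OF s(1)], of "finv h ` J"] im by simp
            then have "?k ` J = J" using finv_im(2)[OF h] by (metis image_comp)
            then show ?thesis using IET_inj[OF CI[OF k]] by (metis imageE imageI)
          qed
          define n where "n = (\<lambda>J\<in>?M. \<lambda>z. if z \<in> J then ?k z else z)"
          have n: "n \<in> carrier Npart" unfolding Npart_carrier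
          proof (intro conjI ballI)
            fix J assume J: "J \<in> ?M"
            show "n J \<in> ?C \<inter> E_supp J"
              using restrict_centralizer[OF min_comps_hoi[OF J] min_comps_unit[OF J] min_comps_f[OF J] k kJ[OF J]] J
              unfolding n_def by simp
          qed (simp add: n_def)
          define a where "a z = (if z \<in> ?A then h z else z)" for z
          define b where "b z = (if z \<in> ?B then h z else z)" for z
          have AB: "?A \<subseteq> {0..<1}" "?B \<subseteq> {0..<1}" unfolding PerP_def FixP_def by auto
          have a: "a \<in> ?C \<inter> E_supp ?A" unfolding a_def
            by (rule restrict_centralizer[OF _ AB(1) f_PerP[OF f_cent] h f_PerP[OF h]])
               (rule hoi_Diff[OF hoi_PerP hoi_FixP])
          have b: "b \<in> E_supp ?B" unfolding b_def
            using restrict_centralizer[OF hoi_FixP AB(2) FixP_cent[OF f_cent] h FixP_cent[OF h]] by blast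
          have xH: "(((n, s), a), b) \<in> carrier ?H" unfolding H_iff using n s a b by blast
          have "\<Phi> (((n, s), a), b) z = h z" for z
          proof -
            consider "z \<in> nonper" | "z \<in> ?A" | "z \<in> ?B" | "z \<notin> {0..<1}" using cover by blast
            then show ?thesis
            proof cases
              case 1
              let ?J = "rcl (G s z)"
              have Gz: "G s z \<in> nonper" using 1 E_supp_mem[OF GC(2)[OF s(1)]] by blast
              then have J: "?J \<in> ?M" "G s z \<in> ?J" using nonper_comp by auto
              then have "assemble n (G s z) = ?k (G s z)" using assemble_comp[OF J] unfolding n_def by simp
              then show ?thesis using val(1)[OF xH 1] GsI by simp
            next
              case 2
              then show ?thesis using val(2)[OF xH 2] unfolding a_def by simp
            next
              case 3
              then show ?thesis using val(3)[OF xH 3] unfolding b_def by simp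
            next
              case 4
              have "\<Phi> (((n, s), a), b) \<in> carrier IET" using hom\<Phi> xH CI unfolding hom_def by fastforce
              then show ?thesis using IET_out 4 CI[OF h] by metis
            qed
          qed
          then have "\<Phi> (((n, s), a), b) = h" by blast
          then show "h \<in> \<Phi> ` carrier ?H" using xH by blast
        qed
      qed
    qed
  qed
  show ?thesis
    by (rule exI[of _ r], rule exI[of _ ns], rule exI[of _ \<phi>])
       (use r0 hom_auto iso in \<open>unfold F_def, blast\<close>)
qed

end

theorem theorem5p7:
  fixes f :: "real \<Rightarrow> real"
  assumes "f \<in> carrier IET"
  defines "Ci \<equiv> (\<lambda>J. subgrp (centralizer f \<inter> E_supp J))"
      and "CA \<equiv> subgrp (centralizer f \<inter> E_supp (PerP f - FixP f))"
  shows "\<exists>(r::nat) (ns::nat \<Rightarrow> nat) (\<phi>::(nat \<Rightarrow> nat \<Rightarrow> nat) \<Rightarrow> (real set \<Rightarrow> real \<Rightarrow> real) \<Rightarrow> (real set \<Rightarrow> real \<Rightarrow> real)).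
           let F = product_group {..<r} (\<lambda>j. sym_group (ns j));
               N = product_group (min_comps f) Ci
           in \<phi> \<in> hom F (AutoGroup N) \<and>
              subgrp (centralizer f) \<cong> (semidirect N F \<phi> \<times>\<times> CA) \<times>\<times> subgrp (E_supp (FixP f)) \<and>
              (\<forall>J \<in> min_comps f.
                 (infinite (carrier (Ci J)) \<and> virtually_cyclic (Ci J)) \<or>
                 (\<exists>m \<ge> 1. \<exists>\<psi>. \<psi> \<in> hom (Ci J) (torus_wreath m) \<and> inj_on \<psi> (carrier (Ci J)) \<and>
                     diagonal m \<subseteq> \<psi> ` carrier (Ci J))) \<and>
              (\<exists>(s::nat) (ms::nat \<Rightarrow> nat). (\<forall>j<s. ms j \<ge> 1) \<and>
                 CA \<cong> product_group {..<s} (\<lambda>j. G_grp (ms j))) \<and>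
              (PerP f = {} \<longrightarrow> carrier CA = {id} \<and> carrier (subgrp (E_supp (FixP f))) = {id}) \<and>
              ((\<exists>n>0. f ^^ n = id) \<longrightarrow>
                 (\<forall>J \<in> min_comps f. carrier (Ci J) = {id}) \<and> carrier F = {\<one>\<^bsub>F\<^esub>})"
proof -
  interpret iet f using assms(1) by unfold_locales
  obtain r ns \<phi> where r: "min_comps f = {} \<longrightarrow> r = (0::nat)"
    and hom: "\<phi> \<in> hom (product_group {..<r} (\<lambda>j. sym_group (ns j))) (AutoGroup Npart)"
    and iso: "subgrp (centralizer f) \<cong>
       (semidirect Npart (product_group {..<r} (\<lambda>j. sym_group (ns j))) \<phi> \<times>\<times> CA) \<times>\<times> subgrp (E_supp (FixP f))"
    using centralizer_structure unfolding CA_def by blast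
  have dich: "(infinite (carrier (Ci J)) \<and> virtually_cyclic (Ci J)) \<or>
      (\<exists>m \<ge> 1. \<exists>\<psi>. \<psi> \<in> hom (Ci J) (torus_wreath m) \<and> inj_on \<psi> (carrier (Ci J)) \<and>
         diagonal m \<subseteq> \<psi> ` carrier (Ci J))" if J: "J \<in> min_comps f" for J
  proof -
    interpret iet_component f J using J by unfold_locales
    show ?thesis using component_dichotomy unfolding Ci_def C_def by simp
  qed
  have per: "carrier CA = {id} \<and> carrier (subgrp (E_supp (FixP f))) = {id}" if "PerP f = {}"
  proof -
    have "FixP f = {}" using that PerP_min_per FixP_min_per by auto
    then show ?thesis using that id_cent by (auto simp: CA_def E_supp_empty)
  qed
  \<comment> \<open>Every point is periodic, so there are no components: the claim about the
    \<open>Ci J\<close> becomes vacuous and \<open>r = 0\<close> makes the permutation part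
    trivial.\<close>
  have order: "min_comps f = {}" if fin: "\<exists>n>0. f ^^ n = id"
  proof -
    have "nonper = {}" using fin nonper_iff by (metis all_not_in_conv id_apply)
    then show ?thesis using min_comps_eq by simp
  qed
  have F0: "carrier (product_group {..<r} (\<lambda>j. sym_group (ns j))) = {\<one>\<^bsub>product_group {..<r} (\<lambda>j. sym_group (ns j))\<^esub>}"
    if "min_comps f = {}"
    using r that by (simp add: product_group_def restrict_def)
  show ?thesis
    unfolding Let_def
    by (rule exI[of _ r], rule exI[of _ ns], rule exI[of _ \<phi>], intro conjI impI ballI)
       (use hom iso dich periodic_iso per order F0 in \<open>auto simp: Ci_def CA_def simp del: carrier_product_group\<close>)
qed

end
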